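(* Let $n\ge1$, $t>0$, $1<p<\infty$, and let $A$ be a bounded linear operator on $F_t^p$. Then for each $r>0$, the mapping $$w\mapsto\int_{\mathbb C^n}\langle AW_zk_0^t,W_zk_w^t\rangle_t\,(W_zk_w^t)\otimes(W_zk_0^t)\,dV(z)=\int_{\mathbb C^n}\langle Ak_z^t,k_{z+w}^t\rangle_t\,(k_{z+w}^t\otimes k_z^t)\,dV(z)$$ is uniformly continuous and uniformly bounded from $B(0,r)$ to the set of bounded linear operators on $F_t^p$ (with the operator norm). Moreover, the integral $$\int_{B(0,r)}\int_{\mathbb C^n}\langle Ak_z^t,k_{z+w}^t\rangle_t\,(k_{z+w}^t\otimes k_z^t)\,dV(z)\,dV(w)$$ is convergent in the norm topology. Furthermore, if $A$ is weakly localized on $F_t^p$, then $$\frac1{(\pi t)^{2n}}\int_{B(0,r)}\int_{\mathbb C^n}\langle Ak_z^t,k_{z+w}^t\rangle_t\,(k_{z+w}^t\otimes k_z^t)\,dV(z)\,dV(w)$$ converges to $A$ in norm as $r\to\infty$.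
   Context: For $s>0$ let $d\mu_s(z)=\frac{1}{(\pi s)^n}e^{-|z|^2/s}dV(z)$ on $\mathbb C^n$, with $dV$ Lebesgue measure. For $1\le p<\infty$, $F_t^p$ is the Banach space of entire functions $f$ on $\mathbb C^n$ with $\|f\|_{F_t^p}=\big[\int_{\mathbb C^n}|f|^p\,d\mu_{2t/p}\big]^{1/p}<\infty$. For $1<p<\infty$ and $\frac1p+\frac1q=1$ the dual of $F_t^p$ is $F_t^q$ under $\langle f,g\rangle_t=\int_{\mathbb C^n}f\overline g\,d\mu_t$; $T^*$ is the operator on $F_t^q$ with $\langle Tf,g\rangle_t=\langle f,T^*g\rangle_t$. Let $k_z^t(w)=e^{\frac{w\cdot\overline z}{t}-\frac{|z|^2}{2t}}$ with $w\cdot\overline z=\sum_jw_j\overline{z_j}$. The Weyl operator is $W_zf(w)=k_z^t(w)f(w-z)$. $B(z,r)$ is the Euclidean ball with center $z$ and radius $r$. Rank-one operators are $(f\otimes g)h=\langle h,g\rangle_tf$. An operator integral $\int_{\mathbb C^n}h_0(u)(W_uh_1)\otimes(W_uh_2)\,dV(u)$, with $h_0\in L^\infty$ and $h_1,h_2\in F_t^1$, is the bounded operator on $F_t^p$ defined weakly by $\langle(\cdot)f,g\rangle_t=\int_{\mathbb C^n}h_0(u)\langle f,W_uh_2\rangle_t\langle W_uh_1,g\rangle_t\,dV(u)$, $f\in F_t^p$, $g\in F_t^q$. A bounded operator $T$ on $F_t^p$ is weakly localized if $\sup_{z\in\mathbb C^n}\int_{\mathbb C^n}|\langle Tk_z^t,k_w^t\rangle_t|dV(w)<\infty$,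 $\sup_{z\in\mathbb C^n}\int_{\mathbb C^n}|\langle T^*k_z^t,k_w^t\rangle_t|dV(w)<\infty$, and both of the suprema $\sup_{z\in\mathbb C^n}\int_{\mathbb C^n\setminus B(z,r)}|\langle Tk_z^t,k_w^t\rangle_t|dV(w)$ and $\sup_{z\in\mathbb C^n}\int_{\mathbb C^n\setminus B(z,r)}|\langle T^*k_z^t,k_w^t\rangle_t|dV(w)$ tend to $0$ as $r\to\infty$. *)

theory Defs
  imports "HOL-Analysis.Analysis"
begin

text \<open>
  \<open>\<complex>\<^sup>n\<close> is \<^typ>\<open>complex^'n\<close> with \<open>n = CARD('n)\<close>; its \<^const>\<open>norm\<close> is the Euclidean one and
  \<^const>\<open>lborel\<close> is Lebesgue measure \<open>dV\<close>.  The Fock spaces depend on the real parameters \<open>t\<close> and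
  \<open>p\<close>, so they are carrier sets of functions.  An operator on a Fock space is a HOL function
  \<open>T\<close> between functions on \<open>\<complex>\<^sup>n\<close>, and only its restriction to the carrier is meaningful.
\<close>

type_synonym 'n cfun = "complex^'n \<Rightarrow> complex"
type_synonym 'n cop = "'n cfun \<Rightarrow> 'n cfun"

section \<open>Fock spaces\<close>

definition entire_cn :: "'n::finite cfun \<Rightarrow> bool" where
  "entire_cn f \<longleftrightarrow>
     (\<forall>z. \<exists>D. (f has_derivative D) (at z) \<and> (\<forall>c v. D (c *s v) = c * D v))"

definition gauss_measure :: "real \<Rightarrow> (complex^'n::finite) measure" where
  "gauss_measure s =
     density lborel (\<lambda>z. ennreal (1 / (pi * s) ^ CARD('n) * exp (- (norm z)\<^sup>2 / s)))"

definition fock_space :: "real \<Rightarrow> real \<Rightarrow> 'n::finite cfun set" where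
  "fock_space t p =
     {f. entire_cn f \<and> integrable (gauss_measure (2 * t / p)) (\<lambda>z. norm (f z) powr p)}"

definition fock_norm :: "real \<Rightarrow> real \<Rightarrow> 'n::finite cfun \<Rightarrow> real" where
  "fock_norm t p f = (LINT z|gauss_measure (2 * t / p). norm (f z) powr p) powr (1 / p)"

definition conj_exponent :: "real \<Rightarrow> real" where
  "conj_exponent p = p / (p - 1)"

lemma conj_exponent: "1 < p \<Longrightarrow> 1 / p + 1 / conj_exponent p = 1"
  by (simp add: conj_exponent_def field_simps)

definition fock_pairing :: "real \<Rightarrow> 'n::finite cfun \<Rightarrow> 'n cfun \<Rightarrow> complex" where
  "fock_pairing t f g = (LINT z|gauss_measure t. f z * cnj (g z))"

definition herm_dot :: "complex^'n::finite \<Rightarrow> complex^'n \<Rightarrow> complex" where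
  "herm_dot w z = (\<Sum>j\<in>UNIV. w $ j * cnj (z $ j))"

definition fock_kernel :: "real \<Rightarrow> complex^'n::finite \<Rightarrow> 'n cfun" where
  "fock_kernel t z w =
     exp (herm_dot w z / complex_of_real t - complex_of_real ((norm z)\<^sup>2 / (2 * t)))"

definition weyl :: "real \<Rightarrow> complex^'n::finite \<Rightarrow> 'n cop" where
  "weyl t z f = (\<lambda>w. fock_kernel t z w * f (w - z))"

section \<open>Bounded operators\<close>

definition fock_bounded_op :: "real \<Rightarrow> real \<Rightarrow> 'n::finite cop \<Rightarrow> bool" where
  "fock_bounded_op t p T \<longleftrightarrow>
     (\<forall>f\<in>fock_space t p. T f \<in> fock_space t p) \<and>
     (\<forall>f\<in>fock_space t p. \<forall>g\<in>fock_space t p. T (\<lambda>z. f z + g z) = (\<lambda>z. T f z + T g z)) \<and>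
     (\<forall>c. \<forall>f\<in>fock_space t p. T (\<lambda>z. c * f z) = (\<lambda>z. c * T f z)) \<and>
     (\<exists>C. \<forall>f\<in>fock_space t p. fock_norm t p (T f) \<le> C * fock_norm t p f)"

definition fock_opnorm :: "real \<Rightarrow> real \<Rightarrow> 'n::finite cop \<Rightarrow> real" where
  "fock_opnorm t p T = Sup {fock_norm t p (T f) | f. f \<in> fock_space t p \<and> fock_norm t p f \<le> 1}"

definition is_fock_adjoint :: "real \<Rightarrow> real \<Rightarrow> 'n::finite cop \<Rightarrow> 'n cop \<Rightarrow> bool" where
  "is_fock_adjoint t p T S \<longleftrightarrow>
     fock_bounded_op t (conj_exponent p) S \<and>
     (\<forall>f\<in>fock_space t p. \<forall>g\<in>fock_space t (conj_exponent p).
        fock_pairing t (T f) g = fock_pairing t f (S g))"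

text \<open>
  By the duality of \<open>F\<^sub>t\<^sup>p\<close> and \<open>F\<^sub>t\<^sup>q\<close> every bounded \<open>T\<close> has an adjoint, and it is unique on
  \<open>F\<^sub>t\<^sup>q\<close>; the existential quantifier over \<open>S\<close> below therefore just names \<open>T\<^sup>*\<close>.
\<close>

definition weakly_localized :: "real \<Rightarrow> real \<Rightarrow> 'n::finite cop \<Rightarrow> bool" where
  "weakly_localized t p T \<longleftrightarrow>
     fock_bounded_op t p T \<and>
     (\<exists>S. is_fock_adjoint t p T S \<and>
        (\<forall>U\<in>{T, S}.
           (SUP z. \<integral>\<^sup>+ w. ennreal (norm (fock_pairing t (U (fock_kernel t z)) (fock_kernel t w)))
              \<partial>lborel) < \<infinity> \<and>
           ((\<lambda>r::real. SUP z. \<integral>\<^sup>+ w.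
                ennreal (norm (fock_pairing t (U (fock_kernel t z)) (fock_kernel t w)))
                  * indicator (- ball z r) w \<partial>lborel) \<longlongrightarrow> 0) at_top))"

section \<open>Operator integrals\<close>

text \<open>
  \<open>has_op_integral t p h \<phi> \<psi> S\<close>: the bounded operator \<open>S\<close> on \<open>F\<^sub>t\<^sup>p\<close> is the weak integral
  \<open>\<integral> h(u) \<phi>\<^sub>u \<otimes> \<psi>\<^sub>u dV(u)\<close>, where \<open>(f \<otimes> g) h = \<langle>h, g\<rangle>\<^sub>t f\<close>.
\<close>

definition has_op_integral ::
  "real \<Rightarrow> real \<Rightarrow> (complex^'n::finite \<Rightarrow> complex) \<Rightarrow> (complex^'n \<Rightarrow> 'n cfun)
     \<Rightarrow> (complex^'n \<Rightarrow> 'n cfun) \<Rightarrow> 'n cop \<Rightarrow> bool" where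
  "has_op_integral t p h \<phi> \<psi> S \<longleftrightarrow>
     fock_bounded_op t p S \<and>
     (\<forall>f\<in>fock_space t p. \<forall>g\<in>fock_space t (conj_exponent p).
        integrable lborel (\<lambda>u. h u * fock_pairing t f (\<psi> u) * fock_pairing t (\<phi> u) g) \<and>
        fock_pairing t (S f) g =
          (LINT u|lborel. h u * fock_pairing t f (\<psi> u) * fock_pairing t (\<phi> u) g))"

definition op_integral ::
  "real \<Rightarrow> real \<Rightarrow> (complex^'n::finite \<Rightarrow> complex) \<Rightarrow> (complex^'n \<Rightarrow> 'n cfun)
     \<Rightarrow> (complex^'n \<Rightarrow> 'n cfun) \<Rightarrow> 'n cop" where
  "op_integral t p h \<phi> \<psi> = (SOME S. has_op_integral t p h \<phi> \<psi> S)"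

text \<open>
  Norm-convergent (Bochner) integral over \<open>B\<close> of an operator-valued function \<open>G\<close>.  The library's
  \<^const>\<open>has_bochner_integral\<close> needs a separable normed value type, so its definition by
  approximation with simple functions is repeated here for the operator norm: the \<open>k\<close>-th simple
  function is \<open>\<Sum>i<m k. indicator (E k i) \<cdot> T k i\<close>.
\<close>

definition simple_op ::
  "nat \<Rightarrow> (nat \<Rightarrow> (complex^'n::finite) set) \<Rightarrow> (nat \<Rightarrow> 'n cop) \<Rightarrow> complex^'n \<Rightarrow> 'n cop" where
  "simple_op m E T w = (\<lambda>f x. \<Sum>i<m. indicator (E i) w * T i f x)"

definition simple_op_integral ::
  "nat \<Rightarrow> (nat \<Rightarrow> (complex^'n::finite) set) \<Rightarrow> (nat \<Rightarrow> 'n cop) \<Rightarrow> 'n cop" where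
  "simple_op_integral m E T = (\<lambda>f x. \<Sum>i<m. complex_of_real (measure lborel (E i)) * T i f x)"

definition has_op_bochner_integral ::
  "real \<Rightarrow> real \<Rightarrow> (complex^'n::finite) set \<Rightarrow> (complex^'n \<Rightarrow> 'n cop) \<Rightarrow> 'n cop \<Rightarrow> bool" where
  "has_op_bochner_integral t p B G S \<longleftrightarrow>
     B \<in> sets lborel \<and> (\<forall>w\<in>B. fock_bounded_op t p (G w)) \<and> fock_bounded_op t p S \<and>
     (\<exists>(m :: nat \<Rightarrow> nat) E T.
        (\<forall>k. \<forall>i<m k. E k i \<in> sets lborel \<and> E k i \<subseteq> B \<and> emeasure lborel (E k i) < \<infinity> \<and>
           fock_bounded_op t p (T k i)) \<and>
        (\<forall>k. (\<lambda>w. indicator B w * fock_opnorm t p (G w - simple_op (m k) (E k) (T k) w))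
           \<in> borel_measurable lborel) \<and>
        (\<lambda>k. \<integral>\<^sup>+ w. ennreal (indicator B w *
                 fock_opnorm t p (G w - simple_op (m k) (E k) (T k) w)) \<partial>lborel)
           \<longlonglongrightarrow> 0 \<and>
        (\<lambda>k. fock_opnorm t p (S - simple_op_integral (m k) (E k) (T k))) \<longlonglongrightarrow> 0)"

definition op_bochner_integral ::
  "real \<Rightarrow> real \<Rightarrow> (complex^'n::finite) set \<Rightarrow> (complex^'n \<Rightarrow> 'n cop) \<Rightarrow> 'n cop" where
  "op_bochner_integral t p B G = (SOME S. has_op_bochner_integral t p B G S)"

section \<open>The two forms of the integrand\<close>

definition weyl_coeff ::
  "real \<Rightarrow> 'n::finite cop \<Rightarrow> complex^'n \<Rightarrow> complex^'n \<Rightarrow> complex" where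
  "weyl_coeff t A w z =
     fock_pairing t (A (weyl t z (fock_kernel t 0))) (weyl t z (fock_kernel t w))"

definition kernel_coeff ::
  "real \<Rightarrow> 'n::finite cop \<Rightarrow> complex^'n \<Rightarrow> complex^'n \<Rightarrow> complex" where
  "kernel_coeff t A w z = fock_pairing t (A (fock_kernel t z)) (fock_kernel t (z + w))"

definition weyl_integral :: "real \<Rightarrow> real \<Rightarrow> 'n::finite cop \<Rightarrow> complex^'n \<Rightarrow> 'n cop" where
  "weyl_integral t p A w =
     op_integral t p (weyl_coeff t A w)
       (\<lambda>z. weyl t z (fock_kernel t w)) (\<lambda>z. weyl t z (fock_kernel t 0))"

definition kernel_integral :: "real \<Rightarrow> real \<Rightarrow> 'n::finite cop \<Rightarrow> complex^'n \<Rightarrow> 'n cop" where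
  "kernel_integral t p A w =
     op_integral t p (kernel_coeff t A w) (\<lambda>z. fock_kernel t (z + w)) (\<lambda>z. fock_kernel t z)"

end

theory Submission
  imports Defs "HOL-Probability.Distributions" "HOL-Complex_Analysis.Cauchy_Integral_Formula"
begin

text \<open>
  Multiplication by \<open>exp (- |z|\<^sup>2 / 2t)\<close> turns the Fock norms into plain \<open>L\<^sup>p\<close> norms and \<open>k\<^sub>z\<close> into a
  unimodular function times a Gaussian centred at \<open>z\<close>.  By the reproducing formula every operator
  of the theorem becomes an integral operator on \<open>\<complex>\<^sup>n\<close> whose kernel is built from
  \<open>\<langle>A k\<^sub>z, k\<^sub>u\<rangle>\<close>, and its norm is controlled by Schur's test.  The integrand at \<open>w\<close> is dominated by a
  Gaussian convolution and is Lipschitz in \<open>w\<close> on bounded sets, because the Weyl form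
  isolates the dependence on \<open>w\<close> in \<open>k\<^sub>w\<close>; the Bochner integral is then a limit of Riemann sums.  It
  integrates \<open>\<langle>f, k\<^sub>z\<rangle> \<langle>A k\<^sub>z, k\<^sub>u\<rangle> k\<^sub>u\<close> over \<open>|u - z| < r\<close>, while \<open>(\<pi>t)\<^sup>2\<^sup>n A f\<close> is the same integral without
  the restriction, so Schur's test bounds the difference by the tails in the definition of weak
  localization.
\<close>

text \<open>The kernels \<open>k_(z+w)\<close> are not Lipschitz in \<open>w\<close> uniformly in
  \<open>z\<close>: besides a Gaussian they carry a phase whose speed in \<open>w\<close> grows like
  |z|. The Weyl form differs from them by a unimodular constant, which the coefficient carries
  conjugated, so the product is unchanged; but \<open>W_z k_w\<close> is a translate of
  \<open>k_w\<close> times a unimodular factor independent of \<open>w\<close>. This is what frees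
  the constants from \<open>z\<close>.

  \<open>op_integral\<close> and \<open>op_bochner_integral\<close> are choices, so nothing can be
  computed from them directly. The explicit integrals \<open>avg_op\<close> and
  \<open>ball_op\<close> are shown to be admissible, and every other admissible operator agrees with
  them on the Fock space because point evaluations are bounded.

  Schur's test asks for a bound in each variable of the kernel. The tails of \<open>A\<close> bound
  the coefficients for fixed \<open>z\<close>, the tails of the adjoint for fixed \<open>u\<close>.
  The adjoint has a second task: \<open>A\<close> is not an integral operator by definition, and
  only by moving it to the kernel in the pairing does \<open>A f\<close> at a point become a scalar
  integral over \<open>f\<close>.\<close>

abbreviation gauss :: "real \<Rightarrow> 'a::real_normed_vector \<Rightarrow> real" where
  "gauss s z \<equiv> exp (- ((norm z)\<^sup>2 / s))"

section \<open>Jensen's inequality and Schur's test\<close>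

text \<open>Convexity: the line tangent to \<open>x powr p\<close> at \<open>c\<close> lies below
  the curve. The contact point stays free so that it can be chosen to suit an integral.\<close>

lemma Youngs_inequality_scaled:
  fixes p c x :: real
  assumes "1 < p" "0 < c" "0 \<le> x"
  shows "p * c powr (p - 1) * x \<le> x powr p + (p - 1) * c powr p"
proof -
  define q where "q = p / (p - 1)"
  have q: "q > 1" "1 / p + 1 / q = 1" "(p - 1) * q = p"
    using assms by (simp_all add: q_def field_simps)
  have "x * c powr (p - 1) \<le> x powr p / p + (c powr (p - 1)) powr q / q"
    by (rule Youngs_inequality) (use assms q in auto)
  also have "(c powr (p - 1)) powr q = c powr p"
    using q by (simp add: powr_powr)
  finally have "p * (x * c powr (p - 1)) \<le> p * (x powr p / p + c powr p / q)"
    using assms by (intro mult_left_mono) auto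
  also have "\<dots> = x powr p + (p / q) * c powr p"
    using assms by (simp add: field_simps)
  also have "p / q = p - 1"
    using assms by (simp add: q_def)
  finally show ?thesis by (simp add: mult_ac)
qed

text \<open>Jensen's inequality for the measure with density \<open>K\<close>, whose mass is at most
  \<open>C\<close>. Integrating the tangent line gives \<open>p * d \<le> I + (p - 1) * d\<close>,
  and cancelling leaves \<open>d \<le> I\<close>. The number \<open>h\<close> only has to lie below
  the integral, which may be infinite.\<close>

lemma nn_integral_powr_mean:
  fixes K :: "'a \<Rightarrow> ennreal" and F :: "'a \<Rightarrow> real"
  assumes [measurable]: "K \<in> borel_measurable M" "F \<in> borel_measurable M"
    and F: "\<And>y. 0 \<le> F y" and p: "1 < p" and C: "0 < C" and h: "0 \<le> h"
    and K: "(\<integral>\<^sup>+y. K y \<partial>M) \<le> ennreal C"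
    and hK: "ennreal h \<le> (\<integral>\<^sup>+y. K y * ennreal (F y) \<partial>M)"
  shows "ennreal (h powr p) \<le> ennreal (C powr (p - 1)) * (\<integral>\<^sup>+y. K y * ennreal (F y powr p) \<partial>M)"
proof (cases "h = 0")
  case True
  then show ?thesis by simp
next
  case False
  define I where "I = (\<integral>\<^sup>+y. K y * ennreal (F y powr p) \<partial>M)"
  \<comment> \<open>With this contact point both terms of the tangent line become multiples of the
    same number \<open>d\<close>.\<close>
  define c where "c = h / C"
  have c: "c > 0" using False h C by (simp add: c_def)
  have h': "h > 0" using False h by simp
  define d where "d = h powr p / C powr (p - 1)"
  have pos: "C powr (p - 1) > 0" using C by simp
  have hp: "h powr p = h powr (p - 1) * h" "C powr p = C powr (p - 1) * C"
    using h' C by (auto simp: powr_diff)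
  have d1: "p * c powr (p - 1) * h = p * d"
    using h' C by (simp add: c_def d_def powr_divide hp)
  have d2: "(p - 1) * c powr p * C = (p - 1) * d"
    using h' C pos by (simp add: c_def d_def powr_divide hp)
  have "ennreal (p * d) = ennreal (p * c powr (p - 1)) * ennreal h"
    using p h by (subst d1[symmetric]) (simp add: ennreal_mult)
  also have "\<dots> \<le> ennreal (p * c powr (p - 1)) * (\<integral>\<^sup>+y. K y * ennreal (F y) \<partial>M)"
    by (intro mult_left_mono hK) auto
  also have "\<dots> = (\<integral>\<^sup>+y. K y * ennreal (p * c powr (p - 1) * F y) \<partial>M)"
    using p F by (subst nn_integral_cmult[symmetric]) (auto simp: ennreal_mult mult_ac)
  also have "\<dots> \<le> (\<integral>\<^sup>+y. K y * ennreal (F y powr p + (p - 1) * c powr p) \<partial>M)"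
    by (intro nn_integral_mono mult_left_mono ennreal_leI Youngs_inequality_scaled p c F) auto
  also have "\<dots> = (\<integral>\<^sup>+y. K y * ennreal (F y powr p) + ennreal ((p - 1) * c powr p) * K y \<partial>M)"
    using p by (intro nn_integral_cong) (simp add: ennreal_plus distrib_left mult_ac)
  also have "\<dots> = I + ennreal ((p - 1) * c powr p) * (\<integral>\<^sup>+y. K y \<partial>M)"
    unfolding I_def by (subst nn_integral_add) (auto simp: nn_integral_cmult)
  also have "\<dots> \<le> I + ennreal ((p - 1) * c powr p) * ennreal C"
    by (intro add_left_mono mult_left_mono K) auto
  also have "ennreal ((p - 1) * c powr p) * ennreal C = ennreal ((p - 1) * d)"
    using p C by (subst ennreal_mult[symmetric]) (auto simp: d2)
  finally have main: "ennreal (p * d) \<le> I + ennreal ((p - 1) * d)" .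
  \<comment> \<open>The term \<open>(p - 1) * d\<close> can be cancelled only when \<open>I\<close>
    is finite; for infinite \<open>I\<close> the claim is trivial.\<close>
  have "ennreal d \<le> I"
  proof (cases I)
    case (real i)
    have "d \<ge> 0" by (simp add: d_def)
    have "ennreal (p * d) \<le> ennreal (i + (p - 1) * d)"
      using main real p \<open>d \<ge> 0\<close> by (simp add: ennreal_plus)
    then have "p * d \<le> i + (p - 1) * d"
      using real p \<open>d \<ge> 0\<close> by (subst (asm) ennreal_le_iff) auto
    then show ?thesis using real by (auto intro!: ennreal_leI simp: algebra_simps)
  qed simp
  then have "ennreal (C powr (p - 1)) * ennreal d \<le> ennreal (C powr (p - 1)) * I"
    by (intro mult_left_mono) auto
  also have "ennreal (C powr (p - 1)) * ennreal d = ennreal (h powr p)"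
    using pos by (subst ennreal_mult[symmetric]) (auto simp: d_def)
  finally show ?thesis by (simp add: I_def)
qed

text \<open>The bound on the rows enters through Jensen as \<open>C powr (p - 1)\<close>, the bound
  on the columns through Tonelli as one more factor \<open>C\<close>. No dual exponent appears, and
  since \<open>H\<close> is merely dominated, the phases of a complex kernel are gone before the
  test is applied.\<close>

lemma schur_test:
  fixes K :: "'a::euclidean_space \<times> 'a \<Rightarrow> ennreal" and F H :: "'a \<Rightarrow> real"
  assumes [measurable]: "K \<in> borel_measurable (lborel \<Otimes>\<^sub>M lborel)" "F \<in> borel_measurable borel"
      "H \<in> borel_measurable borel"
    and F: "\<And>z. 0 \<le> F z" and H0: "\<And>x. 0 \<le> H x" and p: "1 < p" and C: "0 < C"
    and K1: "\<And>x. (\<integral>\<^sup>+z. K (x, z) \<partial>lborel) \<le> ennreal C"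
    and K2: "\<And>z. (\<integral>\<^sup>+x. K (x, z) \<partial>lborel) \<le> ennreal C"
    and H: "\<And>x. ennreal (H x) \<le> (\<integral>\<^sup>+z. K (x, z) * ennreal (F z) \<partial>lborel)"
  shows "(\<integral>\<^sup>+x. ennreal (H x powr p) \<partial>lborel) \<le> ennreal (C powr p) * (\<integral>\<^sup>+z. ennreal (F z powr p) \<partial>lborel)"
proof -
  have Fp[measurable]: "(\<lambda>z. F z powr p) \<in> borel_measurable borel" by measurable
  have "(\<integral>\<^sup>+x. ennreal (H x powr p) \<partial>lborel)
      \<le> (\<integral>\<^sup>+x. ennreal (C powr (p - 1)) * (\<integral>\<^sup>+z. K (x, z) * ennreal (F z powr p) \<partial>lborel) \<partial>lborel)"
    by (intro nn_integral_mono nn_integral_powr_mean F H0 H p C K1) auto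
  also have "\<dots> = ennreal (C powr (p - 1)) * (\<integral>\<^sup>+x. (\<integral>\<^sup>+z. K (x, z) * ennreal (F z powr p) \<partial>lborel) \<partial>lborel)"
    by (intro nn_integral_cmult) measurable
  also have "(\<integral>\<^sup>+x. (\<integral>\<^sup>+z. K (x, z) * ennreal (F z powr p) \<partial>lborel) \<partial>lborel)
      = (\<integral>\<^sup>+z. (\<integral>\<^sup>+x. K (x, z) * ennreal (F z powr p) \<partial>lborel) \<partial>lborel)"
    by (rule lborel_pair.Fubini'[symmetric]) measurable
  also have "\<dots> = (\<integral>\<^sup>+z. (\<integral>\<^sup>+x. K (x, z) \<partial>lborel) * ennreal (F z powr p) \<partial>lborel)"
    by (intro nn_integral_cong nn_integral_multc) measurable
  also have "\<dots> \<le> (\<integral>\<^sup>+z. ennreal C * ennreal (F z powr p) \<partial>lborel)"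
    by (intro nn_integral_mono mult_right_mono K2) auto
  also have "\<dots> = ennreal C * (\<integral>\<^sup>+z. ennreal (F z powr p) \<partial>lborel)"
    by (intro nn_integral_cmult) measurable
  finally have "(\<integral>\<^sup>+x. ennreal (H x powr p) \<partial>lborel)
      \<le> ennreal (C powr (p - 1)) * (ennreal C * (\<integral>\<^sup>+z. ennreal (F z powr p) \<partial>lborel))"
    by (simp add: mult_left_mono)
  also have "\<dots> = ennreal (C powr p) * (\<integral>\<^sup>+z. ennreal (F z powr p) \<partial>lborel)"
    using C by (simp add: mult.assoc[symmetric] ennreal_mult[symmetric] powr_diff)
  finally show ?thesis .
qed

section \<open>Minkowski's inequality\<close>

text \<open>On the boundary of the quadrant, where one argument vanishes, the claim shrinks to
  \<open>l powr p \<le> l\<close> for weights between 0 and 1.\<close>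

lemma powr_convex_nonneg:
  fixes x y p l :: real
  assumes "1 < p" "0 \<le> x" "0 \<le> y" "0 < l" "l < 1"
  shows "(l * x + (1 - l) * y) powr p \<le> l * x powr p + (1 - l) * y powr p"
proof -
  have le: "l powr p \<le> l" if "0 < l" "l < 1" for l :: real
    using powr_mono'[of 1 p l] that assms by simp
  consider "x > 0" "y > 0" | "x = 0" | "y = 0" using assms by force
  then show ?thesis
  proof cases
    case 1
    then show ?thesis
      using convex_onD[OF powr_convex[of p], of "1 - l" x y] assms by simp
  next
    case 2
    then show ?thesis using le[of "1 - l"] assms
      by (simp add: powr_mult mult_right_mono)
  next
    case 3
    then show ?thesis using le[of l] assms
      by (simp add: powr_mult mult_right_mono)
  qed
qed

text \<open>Convexity with the weights \<open>a / (a + b)\<close> and \<open>b / (a + b)\<close>,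
  applied to \<open>norm (f x) / a\<close> and \<open>norm (g x) / b\<close>. Only the norms of
  \<open>f\<close> and \<open>g\<close> are controlled, which says nothing about measurability of
  the sum, hence the separate hypothesis.\<close>

lemma Lp_minkowski:
  fixes f g :: "'a \<Rightarrow> 'b::real_normed_vector"
  assumes p: "1 < p"
    and f: "integrable M (\<lambda>x. norm (f x) powr p)" and g: "integrable M (\<lambda>x. norm (g x) powr p)"
    and [measurable]: "(\<lambda>x. norm (f x + g x)) \<in> borel_measurable M"
  shows "integrable M (\<lambda>x. norm (f x + g x) powr p)" (is ?I)
    and "(LINT x|M. norm (f x + g x) powr p) powr (1 / p)
      \<le> (LINT x|M. norm (f x) powr p) powr (1 / p) + (LINT x|M. norm (g x) powr p) powr (1 / p)"
proof -
  have bound: "norm (f x + g x) powr p \<le> (a + b) powr (p - 1) *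
      (norm (f x) powr p / a powr (p - 1) + norm (g x) powr p / b powr (p - 1))"
    if ab: "a > 0" "b > 0" for a b :: real and x
  proof -
    define l where "l = a / (a + b)"
    have l: "0 < l" "l < 1" "1 - l = b / (a + b)" using ab by (auto simp: l_def field_simps)
    have lab: "(a + b) * l = a" "(a + b) * (1 - l) = b" using ab l by (auto simp: l_def)
    then have "(a + b) * (l * (norm (f x) / a) + (1 - l) * (norm (g x) / b)) = norm (f x) + norm (g x)"
      using ab by (simp only: distrib_left mult.assoc[symmetric]) simp
    then have "norm (f x + g x) \<le> (a + b) * (l * (norm (f x) / a) + (1 - l) * (norm (g x) / b))"
      using norm_triangle_ineq[of "f x" "g x"] by simp
    then have "norm (f x + g x) powr p
        \<le> ((a + b) * (l * (norm (f x) / a) + (1 - l) * (norm (g x) / b))) powr p"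
      using p by (intro powr_mono2) auto
    also have "\<dots> = (a + b) powr p * (l * (norm (f x) / a) + (1 - l) * (norm (g x) / b)) powr p"
      using ab l by (intro powr_mult)
    also have "\<dots> \<le> (a + b) powr p * (l * (norm (f x) / a) powr p + (1 - l) * (norm (g x) / b) powr p)"
      using ab by (intro mult_left_mono powr_convex_nonneg p l) auto
    also have "\<dots> = (a + b) powr (p - 1) *
      (norm (f x) powr p / a powr (p - 1) + norm (g x) powr p / b powr (p - 1))"
    proof -
      have sc: "a * (norm (f x) / a) powr p = norm (f x) powr p / a powr (p - 1)"
        "b * (norm (g x) / b) powr p = norm (g x) powr p / b powr (p - 1)"
        using ab by (auto simp: powr_divide powr_diff)
      have "(a + b) powr p = (a + b) powr (p - 1) * (a + b)" using ab by (simp add: powr_diff)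
      then have "(a + b) powr p * (l * (norm (f x) / a) powr p + (1 - l) * (norm (g x) / b) powr p)
        = (a + b) powr (p - 1) * ((a + b) * l * (norm (f x) / a) powr p + (a + b) * (1 - l) * (norm (g x) / b) powr p)"
        by (simp only: algebra_simps)
      then show ?thesis by (simp only: lab sc)
    qed
    finally show ?thesis .
  qed
  show int: ?I
  proof (rule Bochner_Integration.integrable_bound)
    show "integrable M (\<lambda>x. (1 + 1) powr (p - 1) *
      (norm (f x) powr p / 1 powr (p - 1) + norm (g x) powr p / 1 powr (p - 1)))"
      by (intro integrable_mult_right Bochner_Integration.integrable_add integrable_divide f g)
    show "AE x in M. norm (norm (f x + g x) powr p) \<le> norm ((1 + 1) powr (p - 1) *
      (norm (f x) powr p / 1 powr (p - 1) + norm (g x) powr p / 1 powr (p - 1)))"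
      using bound[of 1 1] by (intro AE_I2) (auto intro: order.trans)
  qed measurable
  define a0 where "a0 = (LINT x|M. norm (f x) powr p) powr (1 / p)"
  define b0 where "b0 = (LINT x|M. norm (g x) powr p) powr (1 / p)"
  have a0: "(LINT x|M. norm (f x) powr p) = a0 powr p" "a0 \<ge> 0"
    using p by (auto simp: a0_def powr_powr)
  have b0: "(LINT x|M. norm (g x) powr p) = b0 powr p" "b0 \<ge> 0"
    using p by (auto simp: b0_def powr_powr)
  have "(LINT x|M. norm (f x + g x) powr p) powr (1 / p) \<le> a0 + b0"
  proof (rule field_le_epsilon)
    fix e :: real assume e: "e > 0"
    \<comment> \<open>The optimal weights are the two norms themselves, but either may be 0 and the
      bound divides by them. The shifts cost \<open>e\<close> in total.\<close>
    define a where "a = a0 + e / 2"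
    define b where "b = b0 + e / 2"
    have ab: "a > 0" "b > 0" "a0 \<le> a" "b0 \<le> b" using a0 b0 e by (auto simp: a_def b_def)
    have "(LINT x|M. norm (f x + g x) powr p) \<le> (LINT x|M. (a + b) powr (p - 1) *
      (norm (f x) powr p / a powr (p - 1) + norm (g x) powr p / b powr (p - 1)))"
      by (intro integral_mono int integrable_mult_right Bochner_Integration.integrable_add
        integrable_divide f g bound ab)
    also have "\<dots> = (a + b) powr (p - 1) * (a0 powr p / a powr (p - 1) + b0 powr p / b powr (p - 1))"
      using f g by (simp add: a0(1) b0(1))
    also have "\<dots> \<le> (a + b) powr (p - 1) * (a powr p / a powr (p - 1) + b powr p / b powr (p - 1))"
      using ab p a0 b0 by (intro mult_left_mono add_mono divide_right_mono powr_mono2) auto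
    also have "\<dots> = (a + b) powr p"
      using ab by (simp add: powr_diff)
    finally have "(LINT x|M. norm (f x + g x) powr p) powr (1 / p) \<le> ((a + b) powr p) powr (1 / p)"
      using p by (intro powr_mono2) (auto intro!: integral_nonneg_AE)
    then show "(LINT x|M. norm (f x + g x) powr p) powr (1 / p) \<le> a0 + b0 + e"
      using p ab by (simp add: powr_powr a_def b_def)
  qed
  then show "(LINT x|M. norm (f x + g x) powr p) powr (1 / p)
      \<le> (LINT x|M. norm (f x) powr p) powr (1 / p) + (LINT x|M. norm (g x) powr p) powr (1 / p)"
    by (simp add: a0_def b0_def)
qed

section \<open>Gaussian integrals and translation of Lebesgue measure\<close>

lemma nn_integral_gauss_real:
  fixes s :: real assumes s: "0 < s"
  shows "(\<integral>\<^sup>+x. ennreal (exp (- (x\<^sup>2 / s))) \<partial>lborel) = ennreal (sqrt (pi * s))"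
proof -
  \<comment> \<open>The deviation for which the exponent of the normal density becomes
    \<open>x\<^sup>2 / s\<close>.\<close>
  define \<sigma> where "\<sigma> = sqrt (s / 2)"
  have \<sigma>: "\<sigma> > 0" "2 * \<sigma>\<^sup>2 = s" "2 * pi * \<sigma>\<^sup>2 = pi * s" using s by (auto simp: \<sigma>_def)
  have nd: "normal_density 0 \<sigma> x = 1 / sqrt (pi * s) * exp (- (x\<^sup>2 / s))" for x
    unfolding normal_density_def \<sigma>(2,3) by simp
  have "(\<integral>\<^sup>+x. ennreal (exp (- (x\<^sup>2 / s))) \<partial>lborel)
      = (\<integral>\<^sup>+x. ennreal (sqrt (pi * s)) * ennreal (normal_density 0 \<sigma> x) \<partial>lborel)"
    using s by (intro nn_integral_cong)
      (simp add: ennreal_mult[symmetric] nd del: real_sqrt_mult)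
  also have "\<dots> = ennreal (sqrt (pi * s)) * (\<integral>\<^sup>+x. ennreal (normal_density 0 \<sigma> x) \<partial>lborel)"
    by (intro nn_integral_cmult) auto
  also have "(\<integral>\<^sup>+x. ennreal (normal_density 0 \<sigma> x) \<partial>lborel) = 1"
    using prob_space.emeasure_space_1[OF prob_space_normal_density[OF \<sigma>(1), of 0]]
    by (simp add: emeasure_density)
  finally show ?thesis by simp
qed

text \<open>The Gaussian factors over the 2n real coordinates, each of which contributes
  \<open>sqrt (pi * s)\<close>.\<close>

lemma nn_integral_gauss:
  fixes s :: real assumes s: "0 < s"
  shows "(\<integral>\<^sup>+(z::complex^'n). ennreal (gauss s z) \<partial>lborel) = ennreal ((pi * s) ^ CARD('n))"
proof -
  have "(\<integral>\<^sup>+(z::complex^'n). ennreal (gauss s z) \<partial>lborel)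
      = (\<integral>\<^sup>+(z::complex^'n). (\<Prod>b\<in>Basis. ennreal (exp (- ((z \<bullet> b)\<^sup>2 / s)))) \<partial>lborel)"
  proof (intro nn_integral_cong)
    fix z :: "complex^'n"
    have "(norm z)\<^sup>2 = (\<Sum>b\<in>Basis. (z \<bullet> b)\<^sup>2)"
      unfolding power2_norm_eq_inner by (subst euclidean_inner) (simp add: power2_eq_square)
    then have "gauss s z = (\<Prod>b\<in>Basis. exp (- ((z \<bullet> b)\<^sup>2 / s)))"
      by (simp add: exp_sum[symmetric] sum_negf sum_divide_distrib)
    then show "ennreal (gauss s z) = (\<Prod>b\<in>Basis. ennreal (exp (- ((z \<bullet> b)\<^sup>2 / s))))"
      by (simp add: prod_ennreal)
  qed
  also have "\<dots> = (\<Prod>b\<in>(Basis::(complex^'n) set). (\<integral>\<^sup>+x. ennreal (exp (- (x\<^sup>2 / s))) \<partial>lborel))"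
    by (intro nn_integral_lborel_prod) auto
  also have "\<dots> = ennreal (sqrt (pi * s) ^ (2 * CARD('n)))"
    using s by (simp add: nn_integral_gauss_real ennreal_power mult.commute del: real_sqrt_mult)
  also have "sqrt (pi * s) ^ (2 * CARD('n)) = (pi * s) ^ CARD('n)"
    using s by (simp add: power_mult del: real_sqrt_mult)
  finally show ?thesis .
qed

lemma integrable_gauss:
  fixes s :: real assumes s: "0 < s"
  shows "integrable lborel (\<lambda>z::complex^'n. gauss s z)"
    and "(LINT (z::complex^'n)|lborel. gauss s z) = (pi * s) ^ CARD('n)"
proof -
  show "integrable lborel (\<lambda>z::complex^'n. gauss s z)"
    by (intro integrableI_nonneg) (auto simp: nn_integral_gauss s less_top[symmetric])
  show "(LINT (z::complex^'n)|lborel. gauss s z) = (pi * s) ^ CARD('n)"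
    using s by (subst integral_eq_nn_integral) (auto simp: nn_integral_gauss)
qed

lemma nn_integral_lborel_translate:
  fixes f :: "'a::euclidean_space \<Rightarrow> ennreal"
  assumes [measurable]: "f \<in> borel_measurable borel"
  shows "(\<integral>\<^sup>+x. f (c + x) \<partial>lborel) = (\<integral>\<^sup>+x. f x \<partial>lborel)"
  by (subst (2) lborel_distr_plus[of c, symmetric]) (simp add: nn_integral_distr)

lemma lborel_translate:
  fixes f :: "'a::euclidean_space \<Rightarrow> 'b::{banach, second_countable_topology}"
  assumes [measurable]: "f \<in> borel_measurable borel"
  shows "(LINT x|lborel. f (c + x)) = (LINT x|lborel. f x)"
    and "integrable lborel (\<lambda>x. f (c + x)) \<longleftrightarrow> integrable lborel f"
   by (subst (2) lborel_distr_plus[of c, symmetric], simp add: integral_distr integrable_distr_eq)+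

lemma nn_integral_gauss_translate:
  fixes s :: real and x :: "complex^'n" assumes s: "0 < s"
  shows "(\<integral>\<^sup>+(z::complex^'n). ennreal (gauss s (x - z)) \<partial>lborel) = ennreal ((pi * s) ^ CARD('n))"
    and "(\<integral>\<^sup>+(z::complex^'n). ennreal (gauss s (z - x)) \<partial>lborel) = ennreal ((pi * s) ^ CARD('n))"
proof -
  show "(\<integral>\<^sup>+(z::complex^'n). ennreal (gauss s (z - x)) \<partial>lborel) = ennreal ((pi * s) ^ CARD('n))"
    using nn_integral_lborel_translate[of "\<lambda>z. ennreal (gauss s z)" "- x"]
    by (simp add: nn_integral_gauss s)
  then show "(\<integral>\<^sup>+(z::complex^'n). ennreal (gauss s (x - z)) \<partial>lborel) = ennreal ((pi * s) ^ CARD('n))"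
    by (simp add: norm_minus_commute)
qed

section \<open>Rotation invariance of Lebesgue measure\<close>

text \<open>Separates real and imaginary parts, so that multiplication by a unimodular number acts
  on a pair of real vectors and can be factored into shears.\<close>

definition complex_vec :: "(real^'n) \<times> (real^'n) \<Rightarrow> complex^'n::finite" where
  "complex_vec v = (\<chi> j. Complex (fst v $ j) (snd v $ j))"

lemma continuous_complex_vec: "continuous_on UNIV (complex_vec :: _ \<Rightarrow> complex^'n::finite)"
  unfolding complex_vec_def Complex_eq by (intro continuous_intros)

lemma measurable_complex_vec[measurable]: "(complex_vec :: _ \<Rightarrow> complex^'n::finite) \<in> borel_measurable borel"
  by (intro borel_measurable_continuous_onI continuous_complex_vec)

text \<open>Lebesgue measure is determined by the volumes of boxes, and the preimage of a box is the
  product of the boxes of real and of imaginary parts.\<close>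

lemma distr_complex_vec: "distr lborel borel complex_vec = (lborel :: (complex^'n::finite) measure)"
proof (rule lborel_eqI[symmetric])
  fix l u :: "complex^'n" assume lu: "\<And>b. b \<in> Basis \<Longrightarrow> l \<bullet> b \<le> u \<bullet> b"
  define re where "re z = (\<chi> j. Re (z $ j))" for z :: "complex^'n"
  define im where "im z = (\<chi> j. Im (z $ j))" for z :: "complex^'n"
  have ax: "axis j 1 \<in> (Basis :: (complex^'n) set)" "axis j \<i> \<in> (Basis :: (complex^'n) set)" for j
    by (auto simp: Basis_vec_def Basis_complex_def)
  have inn: "z \<bullet> axis j 1 = Re (z $ j)" "z \<bullet> axis j \<i> = Im (z $ j)" for z :: "complex^'n" and j
    by (auto simp: inner_axis inner_complex_def)
  have B: "(Basis :: (complex^'n) set) = (\<lambda>j. axis j 1) ` UNIV \<union> (\<lambda>j. axis j \<i>) ` UNIV"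
    by (auto simp: Basis_vec_def Basis_complex_def)
  have Br: "(Basis :: (real^'n) set) = (\<lambda>j. axis j 1) ` UNIV"
    by (auto simp: Basis_vec_def)
  have vimage: "complex_vec -` box l u = box (re l) (re u) \<times> box (im l) (im u)"
    by (auto simp: complex_vec_def box_def B Br inn inner_axis re_def im_def ball_Un)
  have le: "re l \<bullet> b \<le> re u \<bullet> b" "im l \<bullet> b \<le> im u \<bullet> b" if "b \<in> Basis" for b
    using that lu[OF ax(1)] lu[OF ax(2)] by (auto simp: Br inner_axis inn re_def im_def)
  have "emeasure (distr lborel borel complex_vec) (box l u)
      = emeasure (lborel \<Otimes>\<^sub>M lborel) (box (re l) (re u) \<times> box (im l) (im u))"
    by (simp add: emeasure_distr vimage lborel_prod)
  also have "\<dots> = emeasure lborel (box (re l) (re u)) * emeasure lborel (box (im l) (im u))"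
    by (intro lborel.emeasure_pair_measure_Times) auto
  also have "\<dots> = ennreal ((\<Prod>b\<in>Basis. (re u - re l) \<bullet> b) * (\<Prod>b\<in>Basis. (im u - im l) \<bullet> b))"
    using le by (simp add: emeasure_lborel_box ennreal_mult prod_nonneg inner_diff_left)
  also have "(\<Prod>b\<in>Basis. (re u - re l) \<bullet> b) = (\<Prod>j\<in>UNIV. Re (u $ j) - Re (l $ j))"
    unfolding Br by (subst prod.reindex) (auto simp: inj_on_def axis_eq_axis inner_axis re_def inner_diff_left)
  also have "(\<Prod>b\<in>Basis. (im u - im l) \<bullet> b) = (\<Prod>j\<in>UNIV. Im (u $ j) - Im (l $ j))"
    unfolding Br by (subst prod.reindex) (auto simp: inj_on_def axis_eq_axis inner_axis im_def inner_diff_left)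
  also have "(\<Prod>j\<in>UNIV. Re (u $ j) - Re (l $ j)) * (\<Prod>j\<in>UNIV. Im (u $ j) - Im (l $ j))
      = (\<Prod>b\<in>Basis. (u - l) \<bullet> b)"
    unfolding B
    by (subst prod.union_disjoint)
       (auto simp: prod.reindex inj_on_def axis_eq_axis inn inner_diff_left)
  finally show "emeasure (distr lborel borel complex_vec) (box l u) = (\<Prod>b\<in>Basis. (u - l) \<bullet> b)" .
qed simp

text \<open>Cavalieri's principle: the slices of the preimage of a set are translates of the slices
  of the set. The second shear is the first one conjugated by exchanging the two factors.\<close>

lemma distr_shear:
  fixes a :: real
  shows "distr lborel borel (\<lambda>v. (fst v + a *\<^sub>R snd v, snd v)) = (lborel :: ('a::euclidean_space \<times> 'a) measure)" (is ?A)
    and "distr lborel borel (\<lambda>v. (fst v, snd v + a *\<^sub>R fst v)) = (lborel :: ('a \<times> 'a) measure)" (is ?B)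
proof -
  have [measurable]: "(\<lambda>v::'a\<times>'a. (fst v + a *\<^sub>R snd v, snd v)) \<in> borel_measurable borel"
    "(\<lambda>v::'a\<times>'a. (fst v, snd v + a *\<^sub>R fst v)) \<in> borel_measurable borel"
    by (auto intro!: borel_measurable_continuous_onI continuous_intros)
  have shift: "emeasure lborel ((\<lambda>x. x + c) -` S) = emeasure lborel S"
    if [measurable]: "S \<in> sets borel" for c :: 'a and S
  proof -
    have "emeasure lborel S = emeasure (distr lborel borel ((+) c)) S" by (simp add: lborel_distr_plus)
    also have "\<dots> = emeasure lborel ((\<lambda>x. x + c) -` S)"
    proof -
      have "(+) c = (\<lambda>x. x + c)" by (rule ext) (rule add.commute)
      then show ?thesis by (subst emeasure_distr) simp_all
    qed
    finally show ?thesis by simp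
  qed
  have "distr lborel borel (\<lambda>v. (fst v + a *\<^sub>R snd v, snd v)) = (lborel :: ('a \<times> 'a) measure)"
  proof (rule measure_eqI)
    fix X :: "('a \<times> 'a) set" assume "X \<in> sets (distr lborel borel (\<lambda>v. (fst v + a *\<^sub>R snd v, snd v)))"
    then have X[measurable]: "X \<in> sets borel" by simp
    then have X': "X \<in> sets (lborel \<Otimes>\<^sub>M lborel)" unfolding lborel_prod by simp
    define Y where "Y = (\<lambda>v. (fst v + a *\<^sub>R snd v, snd v)) -` X"
    have Y: "Y \<in> sets borel" using measurable_sets[of "\<lambda>v. (fst v + a *\<^sub>R snd v, snd v)" borel borel X]
      by (simp add: Y_def)
    then have Y': "Y \<in> sets (lborel \<Otimes>\<^sub>M lborel)" unfolding lborel_prod by simp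
    have "emeasure (distr lborel borel (\<lambda>v. (fst v + a *\<^sub>R snd v, snd v))) X
       = emeasure (lborel \<Otimes>\<^sub>M lborel) Y"
      by (subst emeasure_distr) (auto simp: Y_def lborel_prod)
    also have "\<dots> = (\<integral>\<^sup>+ y. emeasure lborel ((\<lambda>x. (x, y)) -` Y) \<partial>lborel)"
      unfolding lborel_pair.emeasure_pair_measure_alt2[OF Y'] by simp
    also have "\<dots> = (\<integral>\<^sup>+ y. emeasure lborel ((\<lambda>x. (x, y)) -` X) \<partial>lborel)"
    proof (intro nn_integral_cong)
      fix y :: 'a
      have "(\<lambda>x. (x, y)) -` Y = (\<lambda>x. x + a *\<^sub>R y) -` ((\<lambda>x. (x, y)) -` X)" by (auto simp: Y_def)
      moreover have "(\<lambda>x. (x, y)) -` X \<in> sets borel"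
        using measurable_sets[of "\<lambda>x. (x, y)" borel borel X] X by (simp add: borel_prod[symmetric])
      ultimately show "emeasure lborel ((\<lambda>x. (x, y)) -` Y) = emeasure lborel ((\<lambda>x. (x, y)) -` X)"
        by (simp add: shift)
    qed
    also have "\<dots> = emeasure (lborel \<Otimes>\<^sub>M lborel) X"
      unfolding lborel_pair.emeasure_pair_measure_alt2[OF X'] by simp
    finally show "emeasure (distr lborel borel (\<lambda>v. (fst v + a *\<^sub>R snd v, snd v))) X = emeasure lborel X"
      by (simp add: lborel_prod)
  qed simp
  then show A: ?A .
  have [measurable]: "prod.swap \<in> borel_measurable (borel :: ('a \<times> 'a) measure)"
    by (intro borel_measurable_continuous_onI continuous_on_swap)
  have swap: "distr lborel borel prod.swap = (lborel :: ('a \<times> 'a) measure)"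
  proof -
    have "prod.swap = (\<lambda>(x::'a, y::'a). (y, x))" by auto
    then have "distr (lborel \<Otimes>\<^sub>M lborel) (lborel \<Otimes>\<^sub>M lborel) prod.swap = (lborel \<Otimes>\<^sub>M lborel :: ('a \<times> 'a) measure)"
      using lborel_pair.distr_pair_swap[symmetric, where ?'a = 'a and ?'b = 'a] by (simp only:)
    moreover have "distr lborel borel prod.swap = distr lborel (lborel :: ('a \<times> 'a) measure) prod.swap"
      by (intro distr_cong) auto
    ultimately show ?thesis by (simp add: lborel_prod)
  qed
  define S where "S v = (fst v + a *\<^sub>R snd v, snd v)" for v :: "'a \<times> 'a"
  have [measurable]: "S \<in> borel_measurable borel" unfolding S_def by measurable
  have "distr lborel borel (\<lambda>v. prod.swap (S (prod.swap v)))
      = distr (distr (distr lborel borel prod.swap) borel S) borel prod.swap"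
    by (simp add: distr_distr o_def)
  also have "\<dots> = lborel" using A by (simp add: swap S_def[abs_def])
  finally show ?B by (simp add: S_def)
qed

text \<open>A rotation by \<open>\<theta>\<close> is the product of three shears, with parameters \<open>- tan (\<theta> / 2)\<close>,
  \<open>sin \<theta>\<close> and \<open>- tan (\<theta> / 2)\<close>.\<close>

lemma distr_rotation:
  fixes \<theta> :: real
  assumes c: "cos (\<theta> / 2) \<noteq> 0"
  shows "distr lborel borel (\<lambda>z. cis \<theta> *s z) = (lborel :: (complex^'n::finite) measure)"
proof -
  define b where "b = - tan (\<theta> / 2)"
  define S where "S v = (fst v + b *\<^sub>R snd v, snd v)" for v :: "(real^'n) \<times> (real^'n)"
  define T where "T v = (fst v, snd v + sin \<theta> *\<^sub>R fst v)" for v :: "(real^'n) \<times> (real^'n)"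
  have [measurable]: "S \<in> borel_measurable borel" "T \<in> borel_measurable borel"
    unfolding S_def T_def by (auto intro!: borel_measurable_continuous_onI continuous_intros)
  have [measurable]: "(\<lambda>z::complex^'n. cis \<theta> *s z) \<in> borel_measurable borel"
    unfolding vector_scalar_mult_def by (intro borel_measurable_continuous_onI continuous_intros)
  have s: "sin \<theta> = 2 * sin (\<theta> / 2) * cos (\<theta> / 2)" using sin_double[of "\<theta> / 2"] by simp
  have co: "cos \<theta> = 1 - 2 * (sin (\<theta> / 2))\<^sup>2" using cos_double_sin[of "\<theta> / 2"] by simp
  \<comment> \<open>\<open>e1\<close> and \<open>e2\<close> evaluate the entries of the product of
    the three shear matrices; the half-angle formulas turn them into \<open>cos \<theta>\<close> and
    \<open>- sin \<theta>\<close>.\<close>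
  have e1: "1 + b * sin \<theta> = cos \<theta>"
    using c unfolding s co b_def tan_def by (simp add: power2_eq_square)
  have "b + b * (1 + b * sin \<theta>) = b * (1 + cos \<theta>)" using e1 by (simp add: algebra_simps)
  also have "1 + cos \<theta> = 2 * (cos (\<theta> / 2))\<^sup>2" using cos_double_cos[of "\<theta> / 2"] by simp
  also have "b * (2 * (cos (\<theta> / 2))\<^sup>2) = - sin \<theta>"
    using c unfolding s b_def tan_def by (simp add: power2_eq_square)
  finally have e2: "b + b * (1 + b * sin \<theta>) = - sin \<theta>" .
  have eq: "complex_vec (S (T (S v))) = cis \<theta> *s complex_vec v" for v
  proof (rule vec_eq_iff[THEN iffD2], intro allI complex_eqI)
    fix j
    define x where "x = fst v $ j"
    define y where "y = snd v $ j"
    have "Re (complex_vec (S (T (S v))) $ j) = (1 + b * sin \<theta>) * x + (b + b * (1 + b * sin \<theta>)) * y"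
      by (simp add: complex_vec_def S_def T_def x_def y_def algebra_simps)
    then show "Re (complex_vec (S (T (S v))) $ j) = Re ((cis \<theta> *s complex_vec v) $ j)"
      unfolding e1 e2[unfolded e1] by (simp add: complex_vec_def x_def y_def)
    have "Im (complex_vec (S (T (S v))) $ j) = sin \<theta> * x + (1 + b * sin \<theta>) * y"
      by (simp add: complex_vec_def S_def T_def x_def y_def algebra_simps)
    then show "Im (complex_vec (S (T (S v))) $ j) = Im ((cis \<theta> *s complex_vec v) $ j)"
      unfolding e1 by (simp add: complex_vec_def x_def y_def)
  qed
  have ST: "distr lborel borel S = lborel" "distr lborel borel T = lborel"
    unfolding S_def T_def by (rule distr_shear)+
  have STS: "distr lborel borel (\<lambda>v. S (T (S v))) = lborel"
  proof -
    have "distr lborel borel (\<lambda>v. T (S v)) = distr (distr lborel borel S) borel T"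
      by (subst distr_distr) (auto simp: o_def)
    then have TS: "distr lborel borel (\<lambda>v. T (S v)) = lborel" by (simp add: ST)
    have "distr lborel borel (\<lambda>v. S (T (S v))) = distr (distr lborel borel (\<lambda>v. T (S v))) borel S"
      by (subst distr_distr) (auto simp: o_def)
    then show ?thesis by (simp add: TS ST)
  qed
  have "distr lborel borel (\<lambda>z. cis \<theta> *s z) = distr (distr lborel borel complex_vec) borel (\<lambda>z. cis \<theta> *s (z::complex^'n))"
    by (simp add: distr_complex_vec)
  also have "\<dots> = distr lborel borel (\<lambda>v. complex_vec (S (T (S v))))"
    by (subst distr_distr) (auto simp: o_def eq)
  also have "\<dots> = distr (distr lborel borel (\<lambda>v. S (T (S v)))) borel complex_vec"
    by (subst distr_distr) (auto simp: o_def)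
  also have "\<dots> = lborel" by (simp add: STS distr_complex_vec)
  finally show ?thesis .
qed

lemma measurable_vector_scalar_mult[measurable]:
  fixes f :: "'a \<Rightarrow> complex" and g :: "'a \<Rightarrow> complex^'n::finite"
  assumes [measurable]: "f \<in> borel_measurable M" "g \<in> borel_measurable M"
  shows "(\<lambda>x. f x *s g x) \<in> borel_measurable M"
proof -
  have "continuous_on UNIV (\<lambda>p::complex \<times> (complex^'n). fst p *s snd p)"
    unfolding vector_scalar_mult_def by (intro continuous_intros)
  then have "(\<lambda>p::complex \<times> (complex^'n). fst p *s snd p) \<in> borel_measurable borel"
    by (rule borel_measurable_continuous_onI)
  from measurable_compose[OF _ this, of "\<lambda>x. (f x, g x)" M] show ?thesis by simp
qed

lemma norm_cis_scale: "norm (cis a *s (z::complex^'n::finite)) = norm z"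
  by (simp add: norm_vec_def vector_scalar_mult_def norm_mult)

section \<open>Entire functions on \<open>\<complex>\<^sup>n\<close>\<close>

lemma entire_cnI:
  assumes "\<And>z. (f has_derivative D z) (at z)" "\<And>z c v. D z (c *s v) = c * D z v"
  shows "entire_cn f"
  using assms unfolding entire_cn_def by blast

lemma entire_cn_continuous: "entire_cn f \<Longrightarrow> continuous_on UNIV f"
  unfolding entire_cn_def continuous_on_eq_continuous_at[OF open_UNIV]
  by (metis has_derivative_continuous)

lemma entire_cn_measurable[measurable_dest]: "entire_cn f \<Longrightarrow> f \<in> borel_measurable borel"
  by (intro borel_measurable_continuous_onI entire_cn_continuous)

lemma entire_cn_const: "entire_cn (\<lambda>z. c)"
  unfolding entire_cn_def by (intro allI exI[of _ "\<lambda>v. 0"]) simp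

lemma entire_cn_add: "entire_cn f \<Longrightarrow> entire_cn g \<Longrightarrow> entire_cn (\<lambda>z. f z + g z)"
  unfolding entire_cn_def
proof
  fix z
  assume "\<forall>z. \<exists>D. (f has_derivative D) (at z) \<and> (\<forall>c v. D (c *s v) = c * D v)"
    "\<forall>z. \<exists>D. (g has_derivative D) (at z) \<and> (\<forall>c v. D (c *s v) = c * D v)"
  then obtain D E where "(f has_derivative D) (at z)" "(g has_derivative E) (at z)"
    "\<forall>c v. D (c *s v) = c * D v" "\<forall>c v. E (c *s v) = c * E v" by blast
  then show "\<exists>D. ((\<lambda>z. f z + g z) has_derivative D) (at z) \<and> (\<forall>c v. D (c *s v) = c * D v)"
    by (intro exI[of _ "\<lambda>v. D v + E v"] conjI has_derivative_add) (auto simp: algebra_simps)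
qed

lemma entire_cn_mult: "entire_cn f \<Longrightarrow> entire_cn g \<Longrightarrow> entire_cn (\<lambda>z. f z * g z)"
  unfolding entire_cn_def
proof
  fix z
  assume "\<forall>z. \<exists>D. (f has_derivative D) (at z) \<and> (\<forall>c v. D (c *s v) = c * D v)"
    "\<forall>z. \<exists>D. (g has_derivative D) (at z) \<and> (\<forall>c v. D (c *s v) = c * D v)"
  then obtain D E where "(f has_derivative D) (at z)" "(g has_derivative E) (at z)"
    "\<forall>c v. D (c *s v) = c * D v" "\<forall>c v. E (c *s v) = c * E v" by blast
  then show "\<exists>D. ((\<lambda>z. f z * g z) has_derivative D) (at z) \<and> (\<forall>c v. D (c *s v) = c * D v)"
    by (intro exI[of _ "\<lambda>v. f z * E v + D v * g z"] conjI has_derivative_mult) (auto simp: algebra_simps)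
qed

lemma entire_cn_translate: "entire_cn f \<Longrightarrow> entire_cn (\<lambda>z. f (z + x))"
  unfolding entire_cn_def
proof
  fix z
  assume "\<forall>z. \<exists>D. (f has_derivative D) (at z) \<and> (\<forall>c v. D (c *s v) = c * D v)"
  then obtain D where D: "(f has_derivative D) (at (z + x))" "\<forall>c v. D (c *s v) = c * D v" by blast
  have "((\<lambda>z. z + x) has_derivative (\<lambda>v. v)) (at z)" by (auto intro!: derivative_eq_intros)
  from has_derivative_compose[OF this D(1)] D(2)
  show "\<exists>D. ((\<lambda>z. f (z + x)) has_derivative D) (at z) \<and> (\<forall>c v. D (c *s v) = c * D v)"
    by blast
qed

section \<open>The Hermitian product and its exponentials\<close>

lemma herm_dot_add_left: "herm_dot (x + y) z = herm_dot x z + herm_dot y z"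
  by (simp add: herm_dot_def algebra_simps sum.distrib)

lemma herm_dot_add_right: "herm_dot x (y + z) = herm_dot x y + herm_dot x z"
  by (simp add: herm_dot_def algebra_simps sum.distrib)

lemma herm_dot_diff_left: "herm_dot (x - y) z = herm_dot x z - herm_dot y z"
  by (simp add: herm_dot_def algebra_simps sum_subtractf)

lemma herm_dot_diff_right: "herm_dot x (y - z) = herm_dot x y - herm_dot x z"
  by (simp add: herm_dot_def algebra_simps sum_subtractf)

lemma herm_dot_scale_left: "herm_dot (c *s x) z = c * herm_dot x z"
  by (simp add: herm_dot_def sum_distrib_left mult_ac)

lemma herm_dot_0[simp]: "herm_dot 0 z = 0" "herm_dot z 0 = 0"
  by (simp_all add: herm_dot_def)

lemma cnj_herm_dot: "cnj (herm_dot x y) = herm_dot y x"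
  by (simp add: herm_dot_def mult.commute)

lemma herm_dot_self: "herm_dot x x = complex_of_real ((norm x)\<^sup>2)"
  unfolding power2_norm_eq_inner
  by (simp add: herm_dot_def inner_vec_def complex_norm_square[symmetric] power2_norm_eq_inner[symmetric])

lemma Re_herm_dot: "Re (herm_dot x y) = x \<bullet> y"
  by (simp add: herm_dot_def inner_vec_def inner_complex_def)

lemma norm_herm_dot_le: "norm (herm_dot x y) \<le> norm x * norm y"
proof -
  have "norm (herm_dot x y) \<le> (\<Sum>j\<in>UNIV. norm (x $ j) * norm (y $ j))"
    unfolding herm_dot_def by (rule order.trans[OF norm_sum]) (simp add: norm_mult)
  also have "\<dots> \<le> norm x * norm y"
    using L2_set_mult_ineq[of "\<lambda>j. norm (x $ j)" "\<lambda>j. norm (y $ j)" UNIV] by (simp add: norm_vec_def)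
  finally show ?thesis .
qed

lemma bounded_linear_herm_dot: "bounded_linear (\<lambda>x. herm_dot x z)"
  by (rule bounded_linear_intro[of _ "norm z"])
     (simp_all add: herm_dot_add_left norm_herm_dot_le, simp add: herm_dot_def scaleR_sum_right)

lemma continuous_on_herm_dot[continuous_intros]:
  "continuous_on S f \<Longrightarrow> continuous_on S g \<Longrightarrow> continuous_on S (\<lambda>x. herm_dot (f x) (g x))"
  unfolding herm_dot_def by (intro continuous_intros)

lemma measurable_herm_dot[measurable]:
  assumes [measurable]: "f \<in> borel_measurable M" "g \<in> borel_measurable M"
  shows "(\<lambda>x. herm_dot (f x) (g x)) \<in> borel_measurable M"
proof -
  have "(\<lambda>p. herm_dot (fst p) (snd p)) \<in> borel_measurable borel"
    by (intro borel_measurable_continuous_onI continuous_intros)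
  from measurable_compose[OF _ this, of "\<lambda>x. (f x, g x)" M] show ?thesis by simp
qed

text \<open>The parameters \<open>a\<close> and \<open>b\<close> cover both the kernels and the
  exponential factor that recentres a function in the reproducing formula.\<close>

lemma entire_cn_exp_herm_dot: "entire_cn (\<lambda>z. exp (a * herm_dot z x + b))"
proof (rule entire_cnI)
  fix z
  have d: "((\<lambda>z. a * herm_dot z x + b) has_derivative (\<lambda>v. a * herm_dot v x)) (at z)"
    by (rule has_derivative_add_const[OF has_derivative_mult_right[OF
          bounded_linear_imp_has_derivative[OF bounded_linear_herm_dot]]])
  show "((\<lambda>z. exp (a * herm_dot z x + b)) has_derivative
      (\<lambda>v. a * herm_dot v x * exp (a * herm_dot z x + b))) (at z)"
    by (rule has_derivative_eq_rhs[OF has_derivative_compose[OF d DERIV_exp[unfolded has_field_derivative_def]]])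
       (simp add: fun_eq_iff mult.commute)
qed (simp add: herm_dot_scale_left)

lemma entire_cn_fock_kernel: "entire_cn (fock_kernel t z)"
  using entire_cn_exp_herm_dot[of "1 / complex_of_real t" z "- complex_of_real ((norm z)\<^sup>2 / (2 * t))"]
  by (simp add: fock_kernel_def[abs_def])

section \<open>Mean values over circles and over Gaussian measure\<close>

text \<open>On the complex line through 0 and \<open>v\<close> the function becomes entire in one
  variable, and Cauchy's formula on the unit circle gives its value at the centre.\<close>

lemma entire_cn_circle_mean:
  fixes g :: "'n::finite cfun"
  assumes g: "entire_cn g"
  shows "((\<lambda>s. g (cis (2 * pi * s) *s v)) has_integral g 0) {0..1}"
proof -
  define h where "h l = g (l *s v)" for l
  have "h field_differentiable at l" for l
  proof -
    obtain D where D: "(g has_derivative D) (at (l *s v))" "\<And>c v. D (c *s v) = c * D v"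
      using g unfolding entire_cn_def by blast
    have "linear (\<lambda>c::complex. c *s v)"
      by (rule linearI) (auto simp: vec_eq_iff algebra_simps)
    then have "bounded_linear (\<lambda>c::complex. c *s v)"
      by (simp add: linear_conv_bounded_linear)
    from has_derivative_compose[OF bounded_linear_imp_has_derivative[OF this] D(1)]
    have "(h has_derivative (\<lambda>c. c * D v)) (at l)"
      unfolding h_def D(2) .
    then have "(h has_field_derivative D v) (at l)"
    proof -
      have "times (D v) = (\<lambda>c. c * D v)" by (simp add: fun_eq_iff mult.commute)
      then show ?thesis using \<open>(h has_derivative (\<lambda>c. c * D v)) (at l)\<close>
        by (simp add: has_field_derivative_def)
    qed
    then show ?thesis by (auto simp: field_differentiable_def)
  qed
  then have "h holomorphic_on cball 0 1"
    by (auto simp: holomorphic_on_def intro: field_differentiable_at_within)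
  from Cauchy_integral_circlepath_simple[OF this, of 0]
  have "((\<lambda>u. h u / u) has_contour_integral 2 * of_real pi * \<i> * h 0) (circlepath 0 1)" by simp
  then have "((\<lambda>x. h (circlepath 0 1 x) / circlepath 0 1 x *
      vector_derivative (circlepath 0 1) (at x within {0..1})) has_integral 2 * of_real pi * \<i> * h 0) {0..1}"
    unfolding has_contour_integral_def .
  then have "((\<lambda>x. (2 * of_real pi * \<i>) * h (cis (2 * pi * x))) has_integral (2 * of_real pi * \<i>) * h 0) {0..1}"
  proof (rule has_integral_eq[rotated])
    fix x :: real assume "x \<in> {0..1}"
    then have "vector_derivative (circlepath 0 1) (at x within {0..1}) = 2 * pi * \<i> * exp (2 * of_real pi * \<i> * x)"
      by (subst vector_derivative_circlepath01) auto
    moreover have "exp (2 * of_real pi * \<i> * x) = cis (2 * pi * x)"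
      by (simp add: cis_conv_exp mult_ac)
    ultimately show "h (circlepath 0 1 x) / circlepath 0 1 x *
      vector_derivative (circlepath 0 1) (at x within {0..1}) = (2 * of_real pi * \<i>) * h (cis (2 * pi * x))"
      by (simp add: circlepath)
  qed
  from has_integral_mult_right[OF this, of "1 / (2 * of_real pi * \<i>)"]
  show ?thesis by (simp add: h_def vector_scalar_mult_def zero_vec_def)
qed

text \<open>Averaging over the circle action \<open>z \<mapsto> e\<^sup>i\<^sup>\<theta> z\<close>, which preserves Gaussian measure, replaces
  \<open>g\<close> by the constant \<open>g 0\<close>.\<close>

lemma gauss_mean_value:
  fixes g :: "'n::finite cfun"
  assumes t: "0 < t" and g: "entire_cn g"
    and int: "integrable lborel (\<lambda>z. complex_of_real (gauss t z) * g z)"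
  shows "(LINT z|lborel. complex_of_real (gauss t z) * g z) = complex_of_real ((pi * t) ^ CARD('n)) * g 0"
proof -
  note [measurable] = entire_cn_measurable[OF g]
  define G where "G z = complex_of_real (gauss t z) * g z" for z
  have [measurable]: "G \<in> borel_measurable borel" unfolding G_def by measurable
  define R where "R s z = cis (2 * pi * s) *s z" for s :: real and z :: "complex^'n"
  have R[measurable]: "(\<lambda>x. R (fst x) (snd x)) \<in> borel_measurable (borel \<Otimes>\<^sub>M borel)"
    unfolding R_def cis_conv_exp by measurable
  have RM[measurable]: "R s \<in> borel_measurable borel" for s
    unfolding R_def by measurable
  \<comment> \<open>At \<open>s = 1/2\<close> the rotation is by pi, where the shear factorization
    breaks down because \<open>cos (pi * s)\<close> vanishes. A single parameter is a null set, so
    almost every \<open>s\<close> suffices below.\<close>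
  have rot: "distr lborel borel (R s) = lborel" if "s \<in> {0..1}" "s \<noteq> 1/2" for s
  proof -
    have "pi * s \<noteq> pi / 2" using that by simp
    then have "cos (pi * s) \<noteq> 0"
      using that cos_monotone_0_pi[of "pi * s" "pi / 2"] cos_monotone_0_pi[of "pi / 2" "pi * s"]
      by (cases "pi * s < pi / 2") (auto simp: mult_le_cancel_left1)
    then show ?thesis unfolding R_def by (intro distr_rotation) simp
  qed
  have rotI: "integrable lborel (\<lambda>z. F (R s z)) \<longleftrightarrow> integrable lborel F"
      "(LINT z|lborel. F (R s z)) = (LINT z|lborel. F z)"
    if "s \<in> {0..1}" "s \<noteq> 1/2" and [measurable]: "F \<in> borel_measurable borel"
    for s and F :: "complex^'n \<Rightarrow> 'b::{banach, second_countable_topology}"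
    by (subst (2) rot[OF that(1,2), symmetric], simp add: integral_distr integrable_distr_eq)+
  \<comment> \<open>Integrated over \<open>z\<close>, \<open>\<Phi>\<close> gives the Gaussian
    integral for almost every \<open>s\<close>; integrated over \<open>s\<close>, it gives the
    circle mean. Fubini equates the two.\<close>
  define \<Phi> where "\<Phi> s z = indicator {0..1::real} s *\<^sub>R G (R s z)" for s z
  have [measurable]: "(\<lambda>x. \<Phi> (fst x) (snd x)) \<in> borel_measurable (lborel \<Otimes>\<^sub>M lborel)"
    unfolding \<Phi>_def by measurable
  have AE12: "AE s in lborel. s \<noteq> (1/2::real)"
    by (rule AE_lborel_singleton)
  have intG: "integrable lborel G" using int by (simp add: G_def[abs_def])
  have intN: "integrable lborel (\<lambda>s. indicator {0..1::real} s *\<^sub>R c)" for c :: "'b::{banach, second_countable_topology}"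
    by (rule integrable_indicator) auto
  have \<Phi>: "integrable (lborel \<Otimes>\<^sub>M lborel) (\<lambda>(s, z). \<Phi> s z)"
  proof (rule lborel_pair.Fubini_integrable)
    show "(\<lambda>(s, z). \<Phi> s z) \<in> borel_measurable (lborel \<Otimes>\<^sub>M lborel)"
      by (simp add: case_prod_beta')
    show "AE s in lborel. integrable lborel (\<lambda>z. case (s, z) of (s, z) \<Rightarrow> \<Phi> s z)"
      using AE12
    proof eventually_elim
      case (elim s)
      then show ?case using rotI(1)[of s G] intG by (cases "s \<in> {0..1}") (auto simp: \<Phi>_def)
    qed
    have "AE s in lborel. (LINT z|lborel. norm (\<Phi> s z)) = indicator {0..1} s *\<^sub>R (LINT z|lborel. norm (G z))"
      using AE12
    proof eventually_elim
      case (elim s)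
      then show ?case using rotI(2)[of s "\<lambda>z. norm (G z)"] by (cases "s \<in> {0..1}") (auto simp: \<Phi>_def)
    qed
    then have "integrable lborel (\<lambda>s. LINT z|lborel. norm (\<Phi> s z))"
      by (subst integrable_cong_AE) (auto intro!: intN simp del: real_scaleR_def)
    then show "integrable lborel (\<lambda>s. LINT z|lborel. norm (case (s, z) of (s, z) \<Rightarrow> \<Phi> s z))" by simp
  qed
  have "(LINT s|lborel. (LINT z|lborel. \<Phi> s z)) = (LINT s|lborel. indicator {0..1::real} s *\<^sub>R (LINT z|lborel. G z))"
  proof (rule integral_cong_AE)
    show "AE s in lborel. (LINT z|lborel. \<Phi> s z) = indicator {0..1} s *\<^sub>R (LINT z|lborel. G z)"
      using AE12
    proof eventually_elim
      case (elim s)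
      then show ?case using rotI(2)[of s G] by (cases "s \<in> {0..1}") (auto simp: \<Phi>_def)
    qed
  qed measurable
  also have "\<dots> = (LINT z|lborel. G z)" by simp
  finally have 1: "(LINT s|lborel. (LINT z|lborel. \<Phi> s z)) = (LINT z|lborel. G z)" .
  have "(LINT s|lborel. \<Phi> s z) = complex_of_real (gauss t z) * g 0" for z
  proof -
    have cont: "continuous_on {0..1::real} (\<lambda>s. g (R s z))"
      unfolding R_def cis_conv_exp vector_scalar_mult_def
      by (intro continuous_on_compose2[OF entire_cn_continuous[OF g]] continuous_intros) auto
    have hi: "((\<lambda>s. g (R s z)) has_integral g 0) {0..1}"
      unfolding R_def by (rule entire_cn_circle_mean[OF g])
    have "(LINT s|lborel. indicator {0..1} s *\<^sub>R g (R s z)) = integral {0..1} (\<lambda>s. g (R s z))"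
      using set_borel_integral_eq_integral(2)[OF borel_integrable_atLeastAtMost'[OF cont]]
      by (simp add: set_lebesgue_integral_def)
    then have a: "(LINT s|lborel. indicator {0..1} s *\<^sub>R g (R s z)) = g 0"
      using hi by (simp add: integral_unique)
    have eq: "\<Phi> s z = complex_of_real (gauss t z) * (indicator {0..1} s *\<^sub>R g (R s z))" for s
      by (simp add: \<Phi>_def G_def R_def norm_cis_scale)
    show ?thesis unfolding eq integral_mult_right_zero a ..
  qed
  then have "(LINT z|lborel. (LINT s|lborel. \<Phi> s z)) = complex_of_real ((pi * t) ^ CARD('n)) * g 0"
    using integrable_gauss(2)[OF t, where 'n='n] by (simp add: integral_complex_of_real)
  then show ?thesis using 1 lborel_pair.Fubini_integral[OF \<Phi>] by (simp add: G_def)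
qed

section \<open>Fock spaces in terms of Lebesgue measure\<close>

definition weighted :: "real \<Rightarrow> (complex^'n::finite \<Rightarrow> complex) \<Rightarrow> complex^'n \<Rightarrow> complex" where
  "weighted t f z = complex_of_real (gauss (2 * t) z) * f z"

lemma weighted_add: "weighted t (\<lambda>z. f z + g z) z = weighted t f z + weighted t g z"
  by (simp add: weighted_def algebra_simps)

lemma weighted_diff: "weighted t (\<lambda>z. f z - g z) z = weighted t f z - weighted t g z"
  by (simp add: weighted_def algebra_simps)

lemma weighted_cmult: "weighted t (\<lambda>z. c * f z) z = c * weighted t f z"
  by (simp add: weighted_def algebra_simps)

lemma weighted_zero_iff: "weighted t f z = 0 \<longleftrightarrow> f z = 0"
  by (simp add: weighted_def)

lemma weighted_eq_iff: "weighted t f z = weighted t g z \<longleftrightarrow> f z = g z"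
  by (simp add: weighted_def)

lemma continuous_on_weighted: "t \<noteq> 0 \<Longrightarrow> entire_cn f \<Longrightarrow> continuous_on UNIV (weighted t f)"
  unfolding weighted_def[abs_def] by (intro continuous_intros entire_cn_continuous) auto

lemma measurable_weighted: "f \<in> borel_measurable borel \<Longrightarrow> weighted t f \<in> borel_measurable borel"
  unfolding weighted_def[abs_def] by measurable

lemma norm_weighted_powr:
  assumes "0 < t" "1 < p"
  shows "norm (weighted t f z) powr p = exp (- (norm z)\<^sup>2 / (2 * t / p)) * norm (f z) powr p"
proof -
  have "norm (weighted t f z) powr p = gauss (2 * t) z powr p * norm (f z) powr p"
    by (simp add: weighted_def norm_mult powr_mult)
  also have "gauss (2 * t) z powr p = exp (- (norm z)\<^sup>2 / (2 * t / p))"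
    by (simp add: powr_def)
  finally show ?thesis .
qed

lemma gauss_measure_integrable:
  fixes f :: "complex^'n::finite \<Rightarrow> 'b::{banach, second_countable_topology}"
  assumes "0 < s" and [measurable]: "f \<in> borel_measurable borel"
  shows "integrable (gauss_measure s) f \<longleftrightarrow> integrable lborel (\<lambda>z. exp (- (norm z)\<^sup>2 / s) *\<^sub>R f z)"
    and "integral\<^sup>L (gauss_measure s) f = (1 / (pi * s) ^ CARD('n)) *\<^sub>R (LINT z|lborel. exp (- (norm z)\<^sup>2 / s) *\<^sub>R f z)"
proof -
  have c: "1 / (pi * s) ^ CARD('n) \<noteq> 0" using assms by simp
  have "integrable (gauss_measure s) f \<longleftrightarrow>
    integrable lborel (\<lambda>z. (1 / (pi * s) ^ CARD('n)) *\<^sub>R (exp (- (norm z)\<^sup>2 / s) *\<^sub>R f z))"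
    unfolding gauss_measure_def using assms by (subst integrable_density) auto
  then show "integrable (gauss_measure s) f \<longleftrightarrow> integrable lborel (\<lambda>z. exp (- (norm z)\<^sup>2 / s) *\<^sub>R f z)"
    using c integrable_scaleR_right[of "1 / (pi * s) ^ CARD('n)" lborel "\<lambda>z. exp (- (norm z)\<^sup>2 / s) *\<^sub>R f z"]
      integrable_scaleR_right[of "(pi * s) ^ CARD('n)" lborel
        "\<lambda>z. (1 / (pi * s) ^ CARD('n)) *\<^sub>R (exp (- (norm z)\<^sup>2 / s) *\<^sub>R f z)"] by auto
  have "integral\<^sup>L (gauss_measure s) f =
    (LINT z|lborel. (1 / (pi * s) ^ CARD('n)) *\<^sub>R (exp (- (norm z)\<^sup>2 / s) *\<^sub>R f z))"
    unfolding gauss_measure_def using assms by (subst integral_density) auto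
  then show "integral\<^sup>L (gauss_measure s) f = (1 / (pi * s) ^ CARD('n)) *\<^sub>R (LINT z|lborel. exp (- (norm z)\<^sup>2 / s) *\<^sub>R f z)"
    by (simp only: integral_scaleR_right)
qed

lemma fock_space_iff:
  assumes "0 < t" "1 < p"
  shows "f \<in> fock_space t p \<longleftrightarrow> entire_cn f \<and> integrable lborel (\<lambda>z. norm (weighted t f z) powr p)"
proof (cases "entire_cn f")
  case True
  note [measurable] = entire_cn_measurable[OF True]
  show ?thesis
    unfolding fock_space_def using assms True
    by (simp add: norm_weighted_powr gauss_measure_integrable del: times_divide_eq_right)
qed (simp add: fock_space_def)

lemma fock_norm_eq:
  fixes f :: "'n::finite cfun"
  assumes "0 < t" "1 < p" "f \<in> borel_measurable borel"
  shows "fock_norm t p f = ((1 / (pi * (2 * t / p)) ^ CARD('n)) * (LINT z|lborel. norm (weighted t f z) powr p)) powr (1 / p)"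
  unfolding fock_norm_def using assms by (subst gauss_measure_integrable(2)) (auto simp: norm_weighted_powr)

lemma measurable_cnj[measurable (raw)]:
  "f \<in> borel_measurable M \<Longrightarrow> (\<lambda>x. cnj (f x)) \<in> borel_measurable M"
proof -
  have "cnj \<in> borel_measurable borel"
    by (intro borel_measurable_continuous_onI continuous_on_cnj continuous_on_id)
  then show "(\<lambda>x. cnj (f x)) \<in> borel_measurable M" if "f \<in> borel_measurable M"
    using that by (rule measurable_compose[rotated])
qed

text \<open>The weight \<open>gauss t\<close> of the pairing splits evenly into two factors
  \<open>gauss (2 * t)\<close>. The splitting does not involve the exponent, so the same
  \<open>weighted\<close> serves for both spaces in duality.\<close>

lemma fock_pairing_eq:
  fixes f g :: "'n::finite cfun"
  assumes "0 < t" and [measurable]: "f \<in> borel_measurable borel" "g \<in> borel_measurable borel"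
  shows "fock_pairing t f g = complex_of_real (1 / (pi * t) ^ CARD('n)) * (LINT z|lborel. weighted t f z * cnj (weighted t g z))"
proof -
  have eq: "exp (- (norm z)\<^sup>2 / t) *\<^sub>R (f z * cnj (g z)) = weighted t f z * cnj (weighted t g z)" for z
  proof -
    have "exp (- (norm z)\<^sup>2 / t) = gauss (2 * t) z * gauss (2 * t) z"
      by (simp add: exp_add[symmetric])
    then show ?thesis by (simp add: weighted_def scaleR_conv_of_real)
  qed
  show ?thesis
  proof -
    have "(\<lambda>z. f z * cnj (g z)) \<in> borel_measurable borel" by measurable
    from gauss_measure_integrable(2)[OF assms(1) this] show ?thesis
      unfolding fock_pairing_def eq unfolding scaleR_conv_of_real .
  qed
qed

lemma fock_pairing_cnj: "cnj (fock_pairing t f g) = fock_pairing t g f"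
  unfolding fock_pairing_def Bochner_Integration.integral_cnj[symmetric] complex_cnj_mult complex_cnj_cnj
  by (simp only: mult.commute)

lemma fock_pairing_cmult: "fock_pairing t (\<lambda>z. c * f z) g = c * fock_pairing t f g"
    "fock_pairing t f (\<lambda>z. c * g z) = cnj c * fock_pairing t f g"
  unfolding fock_pairing_def
  by (simp_all add: mult.assoc mult.left_commute)

lemma fock_space_entire: "f \<in> fock_space t p \<Longrightarrow> entire_cn f"
  by (simp add: fock_space_def)

lemma fock_space_measurable: "f \<in> fock_space t p \<Longrightarrow> f \<in> borel_measurable borel"
  by (intro entire_cn_measurable fock_space_entire)

lemma fock_norm_nonneg: "0 \<le> fock_norm t p f"
  by (simp add: fock_norm_def)

lemma fock_norm_cmult:
  assumes "0 < p" shows "fock_norm t p (\<lambda>z. c * f z) = norm c * fock_norm t p f"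
  using assms by (simp add: fock_norm_def norm_mult powr_mult powr_powr)

lemma fock_space_zero: "(\<lambda>z. 0) \<in> fock_space t p"
  by (simp add: fock_space_def entire_cn_const)

lemma fock_norm_zero: "fock_norm t p (\<lambda>z. 0) = 0"
  by (simp add: fock_norm_def)

lemma fock_space_cmult:
  assumes "f \<in> fock_space t p" shows "(\<lambda>z. c * f z) \<in> fock_space t p"
  using assms by (auto simp: fock_space_def norm_mult powr_mult intro!: entire_cn_mult entire_cn_const)

lemma fock_space_add:
  assumes "0 < t" "1 < p" "f \<in> fock_space t p" "g \<in> fock_space t p"
  shows "(\<lambda>z. f z + g z) \<in> fock_space t p"
proof -
  note [measurable] = fock_space_measurable[OF assms(3), THEN measurable_weighted]
    fock_space_measurable[OF assms(4), THEN measurable_weighted]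
  have "(\<lambda>z. norm (weighted t f z + weighted t g z)) \<in> borel_measurable lborel" by measurable
  then show ?thesis
    using assms by (auto simp: fock_space_iff weighted_add intro!: entire_cn_add Lp_minkowski(1) measurable_weighted
      borel_measurable_norm borel_measurable_add)
qed

lemma fock_norm_triangle:
  fixes f g :: "'n::finite cfun"
  assumes "0 < t" "1 < p" "f \<in> fock_space t p" "g \<in> fock_space t p"
  shows "fock_norm t p (\<lambda>z. f z + g z) \<le> fock_norm t p f + fock_norm t p g"
proof -
  note [measurable] = fock_space_measurable[OF assms(3)] fock_space_measurable[OF assms(4)]
  have "(borel_measurable (gauss_measure (2 * t / p)) :: (complex^'n \<Rightarrow> real) set) = borel_measurable borel"
    by (rule measurable_cong_sets) (simp_all add: gauss_measure_def)
  then have "(\<lambda>z. norm (f z + g z)) \<in> borel_measurable (gauss_measure (2 * t / p))"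
    by simp
  then show ?thesis
    using assms unfolding fock_norm_def by (intro Lp_minkowski(2)) (auto simp: fock_space_def)
qed

lemma fock_space_uminus: "f \<in> fock_space t p \<Longrightarrow> (\<lambda>z. - f z) \<in> fock_space t p"
  using fock_space_cmult[of f t p "-1"] by simp

lemma fock_space_diff:
  assumes "0 < t" "1 < p" "f \<in> fock_space t p" "g \<in> fock_space t p"
  shows "(\<lambda>z. f z - g z) \<in> fock_space t p"
  using fock_space_add[OF assms(1-3) fock_space_uminus[OF assms(4)]] by simp

lemma nn_integral_weighted_powr:
  fixes f :: "'n::finite cfun"
  assumes "0 < t" "1 < p" "f \<in> fock_space t p"
  shows "(\<integral>\<^sup>+z. ennreal (norm (weighted t f z) powr p) \<partial>lborel)
    = ennreal ((pi * (2 * t / p)) ^ CARD('n) * fock_norm t p f powr p)"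
proof -
  have i: "integrable lborel (\<lambda>z. norm (weighted t f z) powr p)" using assms by (simp add: fock_space_iff)
  have "fock_norm t p f powr p = (1 / (pi * (2 * t / p)) ^ CARD('n)) * (LINT z|lborel. norm (weighted t f z) powr p)"
    using assms by (simp add: fock_norm_eq fock_space_measurable powr_powr)
  then have "(LINT z|lborel. norm (weighted t f z) powr p) = (pi * (2 * t / p)) ^ CARD('n) * fock_norm t p f powr p"
    using assms by (simp add: field_simps)
  then show ?thesis using i by (subst nn_integral_eq_integral) auto
qed

text \<open>One \<open>nn_integral\<close> bound yields finiteness, hence membership, together with
  the norm estimate. This is the shape in which Schur's test delivers its result.\<close>

lemma fock_norm_le:
  fixes f :: "'n::finite cfun"
  assumes t: "0 < t" and p: "1 < p" and f: "entire_cn f" and C: "0 \<le> C"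
    and le: "(\<integral>\<^sup>+z. ennreal (norm (weighted t f z) powr p) \<partial>lborel)
      \<le> ennreal ((pi * (2 * t / p)) ^ CARD('n) * C powr p)"
  shows "f \<in> fock_space t p" and "fock_norm t p f \<le> C"
proof -
  note [measurable] = measurable_weighted[OF entire_cn_measurable[OF f], of t]
  have i: "integrable lborel (\<lambda>z. norm (weighted t f z) powr p)"
    using le_less_trans[OF le ennreal_less_top] by (intro integrableI_nonneg) auto
  then show fs: "f \<in> fock_space t p" using t p f by (simp add: fock_space_iff)
  have "fock_norm t p f powr p \<le> C powr p"
    using le t p C unfolding nn_integral_weighted_powr[OF t p fs]
    by (subst (asm) ennreal_le_iff) auto
  then show "fock_norm t p f \<le> C"
    using p C fock_norm_nonneg by (metis powr_less_mono2 less_trans not_le zero_less_one)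
qed

section \<open>The normalized reproducing kernel\<close>

abbreviation kern :: "real \<Rightarrow> complex^'n::finite \<Rightarrow> 'n cfun" where
  "kern t z \<equiv> weighted t (fock_kernel t z)"

lemma weighted_fock_kernel:
  "kern t z x =
    exp (herm_dot x z / complex_of_real t - complex_of_real ((norm z)\<^sup>2 / (2 * t)) - complex_of_real ((norm x)\<^sup>2 / (2 * t)))"
  by (simp add: weighted_def fock_kernel_def exp_of_real[symmetric] exp_add[symmetric] algebra_simps)

text \<open>The real part of the exponent is a completed square.\<close>

lemma norm_weighted_fock_kernel:
  assumes "0 < t"
  shows "norm (kern t z x) = gauss (2 * t) (x - z)"
proof -
  have "x \<bullet> z / t - (norm z)\<^sup>2 / (2 * t) - (norm x)\<^sup>2 / (2 * t) = - ((norm (x - z))\<^sup>2 / (2 * t))"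
    using assms unfolding power2_norm_eq_inner
    by (simp add: field_simps inner_diff_left inner_diff_right inner_commute)
  then show ?thesis
    by (simp add: weighted_fock_kernel Re_divide_of_real Re_herm_dot)
qed

text \<open>The exponent is Hermitian in \<open>(x, z)\<close>. Hence a pairing with
  \<open>k_x\<close> can be read as the integral operator with kernel
  \<open>kern t z x\<close>.\<close>

lemma cnj_weighted_fock_kernel:
  "cnj (kern t z x) = kern t x z"
  by (simp add: weighted_fock_kernel exp_cnj cnj_herm_dot) (rule arg_cong[of _ _ exp], simp add: algebra_simps)

lemma measurable_weighted_fock_kernel[measurable]:
  assumes [measurable]: "f \<in> borel_measurable M" "g \<in> borel_measurable M"
  shows "(\<lambda>y. kern t (f y) (g y)) \<in> borel_measurable M"
  unfolding weighted_fock_kernel by measurable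

lemma fock_kernel_in_fock_space:
  assumes "0 < t" "1 < p" shows "fock_kernel t z \<in> fock_space t p"
proof -
  have "gauss (2 * t) (x - z) powr p = gauss (2 * t / p) (x - z)" for x
    by (simp add: powr_def)
  moreover have "integrable lborel (\<lambda>x. gauss (2 * t / p) (x - z))"
    using lborel_translate(2)[of "\<lambda>x. gauss (2 * t / p) x" "- z"] integrable_gauss(1)[of "2 * t / p"] assms
    by simp
  ultimately show ?thesis
    using assms by (simp add: fock_space_iff entire_cn_fock_kernel norm_weighted_fock_kernel)
qed

lemma integrable_gauss_translate:
  fixes x :: "complex^'n::finite" assumes "0 < s"
  shows "integrable lborel (\<lambda>z. gauss s (x - z))"
  using lborel_translate(2)[of "\<lambda>x::complex^'n. gauss s x" "- x"] integrable_gauss(1)[OF assms, where 'n='n]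
  by (simp add: norm_minus_commute)

text \<open>Since a Gaussian is at most 1, \<open>a * b \<le> a powr p + b\<close> takes the place
  of Hoelder's inequality. The width \<open>s\<close> is free because several Gaussians occur
  later.\<close>

lemma integrable_weighted_gauss:
  fixes f :: "'n::finite cfun"
  assumes t: "0 < t" and p: "1 < p" and s: "0 < s" and f: "f \<in> fock_space t p"
  shows "integrable lborel (\<lambda>z. norm (weighted t f z) * gauss s (x - z))"
proof (rule Bochner_Integration.integrable_bound)
  note [measurable] = measurable_weighted[OF fock_space_measurable[OF f], of t]
  show "(\<lambda>z. norm (weighted t f z) * gauss s (x - z)) \<in> borel_measurable lborel"
    by measurable
  show "integrable lborel (\<lambda>z. norm (weighted t f z) powr p + gauss s (x - z))"
    using assms by (intro Bochner_Integration.integrable_add integrable_gauss_translate) (auto simp: fock_space_iff)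
  have "a * b \<le> a powr p + b" if "0 \<le> a" "0 \<le> b" "b \<le> 1" for a b :: real
  proof (cases "a \<le> 1")
    case True
    then show ?thesis using that mult_right_mono[of a 1 b] by (simp add: add_increasing)
  next
    case False
    then have "a \<le> a powr p" using p powr_mono[of 1 p a] by simp
    moreover have "a * b \<le> a * 1" using that by (intro mult_left_mono) auto
    ultimately have "a * b \<le> a powr p" by simp
    then show ?thesis using that by simp
  qed
  then show "AE z in lborel. norm (norm (weighted t f z) * gauss s (x - z))
      \<le> norm (norm (weighted t f z) powr p + gauss s (x - z))"
    using s by (intro AE_I2) auto
qed

text \<open>The mean value property at \<open>0\<close>, applied to a Weyl translate of \<open>f\<close>.\<close>

lemma fock_reproducing:
  fixes f :: "'n::finite cfun"
  assumes t: "0 < t" and p: "1 < p" and f: "f \<in> fock_space t p"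
  shows "fock_pairing t f (fock_kernel t x) = weighted t f x"
    and "fock_pairing t (fock_kernel t x) f = cnj (weighted t f x)"
proof -
  note fm = fock_space_measurable[OF f]
  note [measurable] = fm measurable_weighted[OF fm, of t]
  \<comment> \<open>Up to a constant factor this is the Weyl translate of \<open>f\<close> by
    \<open>- x\<close>; its value at 0 is \<open>f x\<close>.\<close>
  define g where "g v = f (v + x) * exp (- (1 / complex_of_real t) * herm_dot v x + 0)" for v
  have g: "entire_cn g"
    unfolding g_def by (intro entire_cn_mult entire_cn_exp_herm_dot entire_cn_translate fock_space_entire[OF f])
  define H where "H z = weighted t f z * cnj (kern t x z)" for z
  have H_meas[measurable]: "H \<in> borel_measurable borel"
    unfolding H_def cnj_weighted_fock_kernel by measurable
  have intH: "integrable lborel H"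
  proof (rule Bochner_Integration.integrable_bound[OF integrable_weighted_gauss[OF t p _ f, of "2 * t" x]])
    show "0 < 2 * t" using t by simp
    show "AE z in lborel. norm (H z) \<le> norm (norm (weighted t f z) * gauss (2 * t) (x - z))"
      using t by (intro AE_I2) (simp add: H_def norm_mult norm_weighted_fock_kernel norm_minus_commute)
  qed measurable
  define e where "e = complex_of_real (exp ((norm x)\<^sup>2 / (2 * t)))"
  \<comment> \<open>After the substitution \<open>z = x + v\<close> the exponents recombine into
    \<open>gauss t v\<close> times an entire function of \<open>v\<close>, which is what the mean
    value property requires.\<close>
  have eq: "complex_of_real (gauss t v) * g v = e * H (x + v)" for v
  proof -
    have nn: "complex_of_real ((norm u)\<^sup>2) = herm_dot u u" for u :: "complex^'n" by (simp add: herm_dot_self)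
    have "e * H (x + v) = f (v + x) * exp (herm_dot x x / (2 * t) - herm_dot (x + v) (x + v) / (2 * t)
        + (herm_dot x (x + v) / t - herm_dot (x + v) (x + v) / (2 * t) - herm_dot x x / (2 * t)))"
    proof -
      have E1: "e = exp (herm_dot x x / (2 * t))"
        by (simp add: e_def exp_of_real[symmetric] nn[symmetric])
      have E2: "weighted t f (x + v) = exp (- (herm_dot (x + v) (x + v) / (2 * t))) * f (v + x)"
        by (simp add: weighted_def exp_of_real[symmetric] nn[symmetric] add.commute)
      have E3: "kern t (x + v) x =
          exp (herm_dot x (x + v) / t - herm_dot (x + v) (x + v) / (2 * t) - herm_dot x x / (2 * t))"
        unfolding weighted_fock_kernel by (simp add: nn[symmetric])
      show ?thesis
        unfolding H_def cnj_weighted_fock_kernel E1 E2 E3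
        by (simp only: exp_add exp_diff exp_minus divide_inverse mult_ac)
    qed
    also have "herm_dot x x / (2 * t) - herm_dot (x + v) (x + v) / (2 * t)
        + (herm_dot x (x + v) / t - herm_dot (x + v) (x + v) / (2 * t) - herm_dot x x / (2 * t))
        = - (herm_dot v v / t) - (1 / t) * herm_dot v x"
      using t by (simp add: herm_dot_add_left herm_dot_add_right field_simps)
    also have "f (v + x) * exp (- (herm_dot v v / t) - (1 / t) * herm_dot v x)
        = complex_of_real (gauss t v) * g v"
      unfolding g_def exp_diff by (simp add: exp_of_real[symmetric] nn[symmetric] exp_minus field_simps)
    finally show ?thesis by simp
  qed
  have "integrable lborel (\<lambda>v. e * H (x + v))"
    using intH lborel_translate(2)[of H x] by simp
  then have "(LINT v|lborel. e * H (x + v)) = complex_of_real ((pi * t) ^ CARD('n)) * g 0"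
    using gauss_mean_value[OF t g] by (simp add: eq)
  then have "e * (LINT z|lborel. H z) = complex_of_real ((pi * t) ^ CARD('n)) * f x"
    using lborel_translate(1)[of H x] by (simp add: g_def)
  moreover have "e \<noteq> 0" by (simp add: e_def)
  moreover have "f x = e * weighted t f x"
    by (simp add: e_def weighted_def of_real_mult[symmetric] exp_add[symmetric] mult.assoc[symmetric] del: of_real_mult)
  ultimately have "(LINT z|lborel. H z) = complex_of_real ((pi * t) ^ CARD('n)) * weighted t f x"
    by simp
  then show 1: "fock_pairing t f (fock_kernel t x) = weighted t f x"
    using t entire_cn_measurable[OF entire_cn_fock_kernel] by (subst fock_pairing_eq) (auto simp: H_def[symmetric])
  show "fock_pairing t (fock_kernel t x) f = cnj (weighted t f x)"
    unfolding 1[symmetric] by (simp add: fock_pairing_cnj)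
qed

lemma weighted_reproducing:
  fixes f :: "'n::finite cfun"
  assumes t: "0 < t" and p: "1 < p" and f: "f \<in> fock_space t p"
  shows "weighted t f x = complex_of_real (1 / (pi * t) ^ CARD('n)) *
    (LINT z|lborel. weighted t f z * kern t z x)"
  using fock_reproducing(1)[OF assms, of x] assms
  by (simp add: fock_pairing_eq fock_space_measurable entire_cn_measurable entire_cn_fock_kernel cnj_weighted_fock_kernel)

section \<open>Boundedness of point evaluations\<close>

text \<open>The normalized kernel \<open>gauss (2 * t) / (pi * t) ^ n\<close> has mass
  \<open>2 ^ n\<close>, which Jensen raises to the power \<open>p - 1\<close>, and maximum
  \<open>1 / (pi * t) ^ n\<close>; the last factor undoes the normalization of the Fock norm. The
  type argument carries the dimension.\<close>

definition fock_sup_const :: "real \<Rightarrow> real \<Rightarrow> 'n::finite itself \<Rightarrow> real" where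
  "fock_sup_const t p n = ((2 ^ CARD('n)) powr (p - 1) / (pi * t) ^ CARD('n) * (pi * (2 * t / p)) ^ CARD('n)) powr (1 / p)"

text \<open>Jensen is applied to the reproducing formula; then the Gaussian under the integral is
  replaced by its maximum, which leaves the full integral of
  \<open>norm (weighted t f z) powr p\<close>.\<close>

lemma norm_weighted_le_fock_norm:
  fixes f :: "'n::finite cfun"
  assumes t: "0 < t" and p: "1 < p" and f: "f \<in> fock_space t p"
  shows "norm (weighted t f x) \<le> fock_sup_const t p TYPE('n) * fock_norm t p f"
proof -
  note fm = fock_space_measurable[OF f]
  note [measurable] = fm measurable_weighted[OF fm, of t]
  define c where "c = 1 / (pi * t) ^ CARD('n)"
  have c: "c > 0" using t by (simp add: c_def)
  define K where "K z = c * gauss (2 * t) (x - z)" for z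
  have K: "0 \<le> K z" "K z \<le> c" for z using c t by (auto simp: K_def)
  have [measurable]: "K \<in> borel_measurable borel" unfolding K_def by measurable
  have iK: "(\<integral>\<^sup>+z. ennreal (K z) \<partial>lborel) \<le> ennreal (2 ^ CARD('n))"
  proof -
    have "(\<integral>\<^sup>+z. ennreal (K z) \<partial>lborel) = ennreal c * (\<integral>\<^sup>+z. ennreal (gauss (2 * t) (x - z)) \<partial>lborel)"
      unfolding K_def using c by (subst nn_integral_cmult[symmetric]) (auto simp: ennreal_mult)
    also have "\<dots> = ennreal (2 ^ CARD('n))"
      using t c by (subst nn_integral_gauss_translate(1)) (auto simp: ennreal_mult[symmetric] c_def power_mult_distrib)
    finally show ?thesis by simp
  qed
  have int: "integrable lborel (\<lambda>z. norm (weighted t f z) * K z)"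
    using t integrable_mult_right[OF integrable_weighted_gauss[OF t p _ f, of "2 * t" x], of c] by (simp add: K_def mult_ac)
  have "norm (weighted t f x) \<le> c * (LINT z|lborel. norm (weighted t f z * kern t z x))"
  proof -
    have "norm (weighted t f x) = c * norm (LINT z|lborel. weighted t f z * kern t z x)"
      using c by (subst weighted_reproducing[OF t p f]) (simp add: norm_mult c_def[symmetric] del: of_real_divide)
    then show ?thesis using c by (simp only: mult_left_mono integral_norm_bound less_imp_le)
  qed
  also have "\<dots> = (LINT z|lborel. norm (weighted t f z) * K z)"
    using t by (simp add: norm_mult norm_weighted_fock_kernel K_def mult_ac flip: integral_mult_right_zero)
  finally have "ennreal (norm (weighted t f x)) \<le> (\<integral>\<^sup>+z. ennreal (K z) * ennreal (norm (weighted t f z)) \<partial>lborel)"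
  proof -
    assume le: "norm (weighted t f x) \<le> (LINT z|lborel. norm (weighted t f z) * K z)"
    have "ennreal (norm (weighted t f x)) \<le> ennreal (LINT z|lborel. norm (weighted t f z) * K z)"
      using le by (rule ennreal_leI)
    also have "\<dots> = (\<integral>\<^sup>+z. ennreal (norm (weighted t f z) * K z) \<partial>lborel)"
      using int K by (intro nn_integral_eq_integral[symmetric]) auto
    also have "\<dots> = (\<integral>\<^sup>+z. ennreal (K z) * ennreal (norm (weighted t f z)) \<partial>lborel)"
      using K by (simp add: ennreal_mult mult.commute)
    finally show ?thesis .
  qed
  then have "ennreal (norm (weighted t f x) powr p) \<le> ennreal ((2 ^ CARD('n)) powr (p - 1)) *
      (\<integral>\<^sup>+z. ennreal (K z) * ennreal (norm (weighted t f z) powr p) \<partial>lborel)"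
    by (intro nn_integral_powr_mean p iK) auto
  also have "\<dots> \<le> ennreal ((2 ^ CARD('n)) powr (p - 1)) *
      (\<integral>\<^sup>+z. ennreal c * ennreal (norm (weighted t f z) powr p) \<partial>lborel)"
    by (intro mult_left_mono nn_integral_mono mult_right_mono ennreal_leI K) auto
  also have "(\<integral>\<^sup>+z. ennreal c * ennreal (norm (weighted t f z) powr p) \<partial>lborel)
      = ennreal c * ennreal ((pi * (2 * t / p)) ^ CARD('n) * fock_norm t p f powr p)"
    by (subst nn_integral_cmult) (auto simp: nn_integral_weighted_powr[OF t p f])
  also have "ennreal ((2 ^ CARD('n)) powr (p - 1)) * (ennreal c * ennreal ((pi * (2 * t / p)) ^ CARD('n) * fock_norm t p f powr p))
      = ennreal ((fock_sup_const t p TYPE('n) * fock_norm t p f) powr p)"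
    using t p c by (simp add: ennreal_mult[symmetric] powr_mult powr_powr fock_sup_const_def c_def fock_norm_nonneg mult_ac)
  finally have "norm (weighted t f x) powr p \<le> (fock_sup_const t p TYPE('n) * fock_norm t p f) powr p"
    by (subst (asm) ennreal_le_iff) auto
  then show ?thesis
    using p by (metis powr_less_mono2 less_trans not_le zero_less_one fock_norm_nonneg fock_sup_const_def powr_ge_zero mult_nonneg_nonneg)
qed

lemma fock_sup_const_nonneg: "0 \<le> fock_sup_const t p n"
  by (simp add: fock_sup_const_def)

section \<open>Lipschitz dependence of the kernel on its centre\<close>

text \<open>The mean value inequality on a half-plane, which is convex and on which the derivative
  is at most \<open>exp M\<close> in modulus.\<close>

lemma norm_exp_diff_le:
  fixes a b :: complex
  assumes "Re a \<le> M" "Re b \<le> M"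
  shows "norm (exp a - exp b) \<le> exp M * norm (a - b)"
proof (rule field_differentiable_bound[where S = "{z. Re z \<le> M}" and f' = exp])
  show "convex {z. Re z \<le> M}" by (rule convex_halfspace_Re_le)
qed (use assms in \<open>auto intro!: derivative_eq_intros\<close>)

text \<open>From \<open>|x|^2 \<le> 2 |x - w|^2 + 2 |w|^2\<close>: recentring the Gaussian at 0
  costs half of its decay, so the width doubles.\<close>

lemma gauss_shift_le:
  fixes w x :: "complex^'n::finite"
  assumes t: "0 < t" and w: "norm w \<le> R"
  shows "gauss (2 * t) (x - w) \<le> exp (R\<^sup>2 / (2 * t)) * gauss (4 * t) x"
proof -
  have "(norm x)\<^sup>2 \<le> (norm (x - w) + norm w)\<^sup>2"
    using norm_triangle_sub[of x w] by (intro power_mono) auto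
  also have "\<dots> \<le> 2 * (norm (x - w))\<^sup>2 + 2 * (norm w)\<^sup>2"
    using sum_squares_bound[of "norm (x - w)" "norm w"] by (simp add: power2_sum)
  also have "(norm w)\<^sup>2 \<le> R\<^sup>2" using w by (intro power_mono) auto
  finally have "(norm x)\<^sup>2 / (4 * t) \<le> (2 * (norm (x - w))\<^sup>2 + 2 * R\<^sup>2) / (4 * t)"
    using t by (intro divide_right_mono) auto
  then show ?thesis
    using t by (simp add: exp_add[symmetric] add_divide_distrib)
qed

text \<open>The first summand is the Lipschitz constant of the kernel, the second its pointwise
  bound, both for centres of norm at most \<open>R\<close>; their sum serves for both
  purposes.\<close>

definition kernel_lip :: "real \<Rightarrow> real \<Rightarrow> real" where
  "kernel_lip t R = (R + 1 + 8 * t) / t * exp (R\<^sup>2 / (2 * t)) + exp (R\<^sup>2 / (2 * t))"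

lemma kernel_lip_pos: "0 < t \<Longrightarrow> 0 \<le> R \<Longrightarrow> 0 < kernel_lip t R"
  unfolding kernel_lip_def by (intro add_nonneg_pos mult_nonneg_nonneg) auto

lemma norm_weighted_kernel_le:
  fixes w x :: "complex^'n::finite"
  assumes t: "0 < t" and w: "norm w \<le> R"
  shows "norm (kern t w x) \<le> kernel_lip t R * gauss (8 * t) x"
proof -
  have R: "0 \<le> R" using w norm_ge_zero[of w] by linarith
  have "norm (kern t w x) \<le> exp (R\<^sup>2 / (2 * t)) * gauss (4 * t) x"
    using gauss_shift_le[OF t w, of x] by (simp add: norm_weighted_fock_kernel t)
  also have "\<dots> \<le> kernel_lip t R * gauss (8 * t) x"
  proof (intro mult_mono)
    show "exp (R\<^sup>2 / (2 * t)) \<le> kernel_lip t R"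
      using t R unfolding kernel_lip_def by simp
    show "gauss (4 * t) x \<le> gauss (8 * t) x"
      using t by (simp add: frac_le)
  qed (use kernel_lip_pos[OF t R] in auto)
  finally show ?thesis .
qed

text \<open>The exponent varies with \<open>w\<close> at a rate of order
  \<open>(norm x + R) / t\<close>. This growth in \<open>x\<close> is absorbed by giving up half of
  the remaining decay, which is where the width \<open>8 * t\<close> comes from.\<close>

lemma norm_weighted_kernel_diff_le:
  fixes w w' x :: "complex^'n::finite"
  assumes t: "0 < t" and w: "norm w \<le> R" and w': "norm w' \<le> R"
  shows "norm (kern t w x - kern t w' x)
    \<le> kernel_lip t R * norm (w - w') * gauss (8 * t) x"
proof -
  have R: "0 \<le> R" using w norm_ge_zero[of w] by linarith
  define E where "E w = herm_dot x w / complex_of_real t - complex_of_real ((norm w)\<^sup>2 / (2 * t)) - complex_of_real ((norm x)\<^sup>2 / (2 * t))"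
    for w :: "complex^'n"
  \<comment> \<open>The logarithm of the bound in \<open>gauss_shift_le\<close>; it confines both
    exponents to one half-plane.\<close>
  define M where "M = R\<^sup>2 / (2 * t) - (norm x)\<^sup>2 / (4 * t)"
  have ReE: "Re (E v) \<le> M" if "norm v \<le> R" for v
  proof -
    have "exp (Re (E v)) = norm (kern t v x)"
      by (simp add: weighted_fock_kernel E_def)
    also have "\<dots> \<le> exp M"
      using gauss_shift_le[OF t that, of x] by (simp add: norm_weighted_fock_kernel t M_def exp_add[symmetric])
    finally show ?thesis by simp
  qed
  have "norm (E w - E w') \<le> norm (w - w') * ((norm x + R) / t)"
  proof -
    have "E w - E w' = herm_dot x (w - w') / complex_of_real t - complex_of_real (((norm w)\<^sup>2 - (norm w')\<^sup>2) / (2 * t))"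
      by (simp add: E_def herm_dot_diff_right diff_divide_distrib)
    then have "norm (E w - E w') \<le> norm (herm_dot x (w - w') / complex_of_real t)
        + norm (complex_of_real (((norm w)\<^sup>2 - (norm w')\<^sup>2) / (2 * t)))"
      by (simp only: norm_triangle_ineq4)
    also have "norm (herm_dot x (w - w') / complex_of_real t) \<le> norm x * norm (w - w') / t"
      using t norm_herm_dot_le[of x "w - w'"] by (simp add: norm_divide divide_right_mono)
    also have "norm (complex_of_real (((norm w)\<^sup>2 - (norm w')\<^sup>2) / (2 * t))) = \<bar>(norm w)\<^sup>2 - (norm w')\<^sup>2\<bar> / (2 * t)"
      unfolding norm_of_real using t by simp
    also have "\<bar>(norm w)\<^sup>2 - (norm w')\<^sup>2\<bar> = \<bar>norm w - norm w'\<bar> * (norm w + norm w')"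
      by (simp add: power2_eq_square square_diff_square_factored abs_mult mult.commute)
    also have "\<dots> \<le> norm (w - w') * (2 * R)"
      using w w' R by (intro mult_mono) (auto simp: norm_triangle_ineq3)
    finally show ?thesis using t by (simp add: field_simps)
  qed
  moreover have "norm (exp (E w) - exp (E w')) \<le> exp M * norm (E w - E w')"
    by (intro norm_exp_diff_le ReE w w')
  ultimately have "norm (exp (E w) - exp (E w')) \<le> exp M * (norm (w - w') * ((norm x + R) / t))"
    by (meson exp_ge_zero mult_left_mono order_trans)
  also have "\<dots> \<le> exp M * (norm (w - w') * ((R + 1 + 8 * t) / t * exp ((norm x)\<^sup>2 / (8 * t))))"
  proof (intro mult_left_mono)
    have "norm x \<le> 1 + (norm x)\<^sup>2"
      using sum_squares_bound[of "norm x" 1] by (simp add: power2_eq_square) (smt (verit) mult_nonneg_nonneg norm_ge_zero)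
    \<comment> \<open>The factor is large enough for the expanded product to contain
      \<open>R + 1 + (norm x)\<^sup>2\<close>; afterwards \<open>1 + y \<le> exp y\<close>
      applies.\<close>
    then have "norm x + R \<le> (R + 1 + 8 * t) * (1 + (norm x)\<^sup>2 / (8 * t))"
    proof -
      have "(R + 1 + 8 * t) * (1 + (norm x)\<^sup>2 / (8 * t))
          = R + (1 + (norm x)\<^sup>2) + (8 * t + (R + 1) * ((norm x)\<^sup>2 / (8 * t)))"
        using t by (simp add: field_simps)
      moreover have "0 \<le> 8 * t + (R + 1) * ((norm x)\<^sup>2 / (8 * t))" using t R by simp
      ultimately show ?thesis using \<open>norm x \<le> 1 + (norm x)\<^sup>2\<close> by linarith
    qed
    also have "\<dots> \<le> (R + 1 + 8 * t) * exp ((norm x)\<^sup>2 / (8 * t))"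
      using t R by (intro mult_left_mono exp_ge_add_one_self) auto
    finally show "(norm x + R) / t \<le> (R + 1 + 8 * t) / t * exp ((norm x)\<^sup>2 / (8 * t))"
      using t by (simp add: divide_right_mono)
  qed auto
  also have "\<dots> = ((R + 1 + 8 * t) / t * exp (R\<^sup>2 / (2 * t))) * norm (w - w') * gauss (8 * t) x"
  proof -
    have "exp M * exp ((norm x)\<^sup>2 / (8 * t)) = exp (R\<^sup>2 / (2 * t)) * gauss (8 * t) x"
      unfolding exp_add[symmetric] M_def using t by (simp add: field_simps)
    then show ?thesis by (simp add: mult_ac)
  qed
  also have "\<dots> \<le> kernel_lip t R * norm (w - w') * gauss (8 * t) x"
    by (intro mult_right_mono) (auto simp: kernel_lip_def)
  finally show ?thesis unfolding weighted_fock_kernel E_def .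
qed

section \<open>Superpositions of kernels\<close>

text \<open>Differentiation under the integral, with a remainder that is quadratic in the increment.
  Assuming only the decay \<open>gauss (4 * t)\<close> leaves half of the Gaussian in the kernel to
  dominate every factor \<open>exp (r * norm (\<alpha> y) / t)\<close>. The measure is arbitrary
  because both a single and a double integral of kernels occur.\<close>

lemma entire_cn_superposition:
  fixes \<alpha> :: "'a \<Rightarrow> complex^'n::finite" and m :: "'a \<Rightarrow> complex"
  assumes t: "0 < t" and [measurable]: "m \<in> borel_measurable M" "\<alpha> \<in> borel_measurable M"
    and int: "integrable M (\<lambda>y. norm (m y) * gauss (4 * t) (\<alpha> y))"
  shows "entire_cn (\<lambda>x. LINT y|M. m y * fock_kernel t (\<alpha> y) x)"
proof -
  define \<mu> where "\<mu> y = m y * complex_of_real (gauss (2 * t) (\<alpha> y))" for y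
  define L where "L v y = herm_dot v (\<alpha> y) / complex_of_real t" for v y
  define s where "s y = norm (\<alpha> y) / t" for y
  have [measurable]: "\<mu> \<in> borel_measurable M" "L v \<in> borel_measurable M" "s \<in> borel_measurable M" for v
    unfolding \<mu>_def L_def s_def by measurable
  have s0: "0 \<le> s y" for y using t by (simp add: s_def)
  have s_exp: "s y \<le> exp (s y)" for y using exp_ge_add_one_self[of "s y"] by linarith
  have L: "norm (L v y) \<le> norm v * s y" for v y
    using t norm_herm_dot_le[of v "\<alpha> y"] by (simp add: L_def s_def norm_divide divide_right_mono)
  have L_add: "L (u + v) y = L u y + L v y" and L_scale: "L (c *s v) y = c * L v y"
    and L_scaleR: "L (r *\<^sub>R v) y = complex_of_real r * L v y" for u v c r y
  proof -
    show "L (u + v) y = L u y + L v y" "L (c *s v) y = c * L v y"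
      by (simp_all add: L_def herm_dot_add_left herm_dot_scale_left add_divide_distrib)
    have "herm_dot (r *\<^sub>R v) (\<alpha> y) = complex_of_real r * herm_dot v (\<alpha> y)"
      using linear_scale[OF bounded_linear.linear[OF bounded_linear_herm_dot]] by (metis scaleR_conv_of_real)
    then show "L (r *\<^sub>R v) y = complex_of_real r * L v y" by (simp add: L_def)
  qed
  have exp_L: "norm (exp (L v y)) \<le> exp (norm v * s y)" for v y
    using L[of v y] norm_exp[of "L v y"] by (meson exp_le_cancel_iff order_trans)
  have kern: "m y * fock_kernel t (\<alpha> y) x = \<mu> y * exp (L x y)" for x y
  proof -
    have "fock_kernel t (\<alpha> y) x = exp (L x y + complex_of_real (- ((norm (\<alpha> y))\<^sup>2 / (2 * t))))"
      by (simp add: fock_kernel_def L_def)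
    then show ?thesis unfolding exp_add exp_of_real \<mu>_def by (simp only: mult_ac)
  qed
  \<comment> \<open>Completing the square, \<open>r * q \<le> q\<^sup>2 / 4 + r\<^sup>2\<close> with
    \<open>q = norm (\<alpha> y)\<close>.\<close>
  have int_exp: "integrable M (\<lambda>y. norm (\<mu> y) * exp (r * s y))" for r
  proof (rule Bochner_Integration.integrable_bound)
    show "integrable M (\<lambda>y. exp (r\<^sup>2 / t) * (norm (m y) * gauss (4 * t) (\<alpha> y)))"
      using int by simp
    show "AE y in M. norm (norm (\<mu> y) * exp (r * s y)) \<le> norm (exp (r\<^sup>2 / t) * (norm (m y) * gauss (4 * t) (\<alpha> y)))" (is "AE y in _. ?P y")
    proof (rule AE_I2)
      fix y
      define q where "q = norm (\<alpha> y)"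
      have "r * q \<le> q\<^sup>2 / 4 + r\<^sup>2"
        using zero_le_power2[of "q / 2 - r"] by (simp add: power2_eq_square algebra_simps)
      then have "(r * q) / t \<le> (q\<^sup>2 / 4 + r\<^sup>2) / t" using t by (intro divide_right_mono) auto
      moreover have "q\<^sup>2 / (2 * t) = q\<^sup>2 / (4 * t) + q\<^sup>2 / (4 * t)" by simp
      ultimately have "- (q\<^sup>2 / (2 * t)) + r * (q / t) \<le> r\<^sup>2 / t + - (q\<^sup>2 / (4 * t))"
        using t by (simp add: add_divide_distrib)
      then have "exp (- (q\<^sup>2 / (2 * t))) * exp (r * (q / t)) \<le> exp (r\<^sup>2 / t) * exp (- (q\<^sup>2 / (4 * t)))"
        unfolding exp_add[symmetric] by simp
      from mult_left_mono[OF this, of "norm (m y)"]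
      show "?P y"
        by (simp add: \<mu>_def s_def norm_mult q_def mult_ac)
    qed
  qed measurable
  have int0: "integrable M (\<lambda>y. \<mu> y * exp (L x y))" for x
    by (rule Bochner_Integration.integrable_bound[OF int_exp[of "norm x"]])
       (auto intro!: AE_I2 mult_left_mono simp: norm_mult exp_L[of x, simplified])
  have D_bound: "norm (\<mu> y * (L v y * exp (L x y))) \<le> norm v * (norm (\<mu> y) * exp ((norm x + 1) * s y))" for x v y
  proof -
    have "norm (L v y * exp (L x y)) \<le> (norm v * s y) * exp (norm x * s y)"
      unfolding norm_mult by (intro mult_mono L exp_L) (use s0 in auto)
    also have "\<dots> \<le> (norm v * exp (s y)) * exp (norm x * s y)"
      by (intro mult_right_mono mult_left_mono s_exp) auto
    also have "\<dots> = norm v * exp ((norm x + 1) * s y)"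
      by (simp add: exp_add[symmetric] algebra_simps)
    finally have "norm (\<mu> y) * norm (L v y * exp (L x y)) \<le> norm (\<mu> y) * (norm v * exp ((norm x + 1) * s y))"
      by (intro mult_left_mono) auto
    then show ?thesis by (simp only: norm_mult mult_ac)
  qed
  have int1: "integrable M (\<lambda>y. \<mu> y * (L v y * exp (L x y)))" for x v
    by (rule Bochner_Integration.integrable_bound[OF integrable_mult_right[OF int_exp[of "norm x + 1"], of "norm v"]])
       (use D_bound in \<open>auto intro!: AE_I2 intro: order_trans\<close>)
  define F where "F x = (LINT y|M. \<mu> y * exp (L x y))" for x
  define D where "D x v = (LINT y|M. \<mu> y * (L v y * exp (L x y)))" for x v
  have "entire_cn F"
  proof (rule entire_cnI)
    fix x
    show "D x (c *s v) = c * D x v" for c v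
      unfolding D_def L_scale by (simp add: mult.left_commute[of _ c] mult.assoc)
    \<comment> \<open>The exponent \<open>norm x + 3\<close> collects \<open>norm x\<close> from
      \<open>exp (L x y)\<close>, 1 from the Taylor remainder of the exponential, and 2 from the
      squared increment, where \<open>s y \<le> exp (s y)\<close> is used twice.\<close>
    define K where "K = (LINT y|M. norm (\<mu> y) * exp ((norm x + 3) * s y))"
    have lin: "bounded_linear (D x)"
    proof (rule bounded_linear_intro)
      show "D x (u + v) = D x u + D x v" for u v
        unfolding D_def L_add using int1[of u x] int1[of v x]
        by (simp add: distrib_left distrib_right)
      show "D x (r *\<^sub>R v) = r *\<^sub>R D x v" for r v
        unfolding D_def L_scaleR by (simp add: mult.left_commute[of _ "complex_of_real r"] mult.assoc scaleR_conv_of_real)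
      show "norm (D x v) \<le> norm v * (LINT y|M. norm (\<mu> y) * exp ((norm x + 1) * s y))" for v
      proof -
        have "norm (D x v) \<le> (LINT y|M. norm (\<mu> y * (L v y * exp (L x y))))"
          unfolding D_def by (rule integral_norm_bound)
        also have "\<dots> \<le> (LINT y|M. norm v * (norm (\<mu> y) * exp ((norm x + 1) * s y)))"
          by (intro integral_mono integrable_norm int1 integrable_mult_right int_exp D_bound)
        finally show ?thesis by simp
      qed
    qed
    have rem: "norm (F u - F x - D x (u - x)) / norm (u - x) \<le> norm (u - x) * K"
      if u: "dist u x < 1" "u \<noteq> x" for u
    proof -
      define v where "v = u - x"
      have v: "norm v \<le> 1" "u = x + v" "norm v > 0" using u by (auto simp: v_def dist_norm)
      have pt: "norm (\<mu> y * exp (L u y) - \<mu> y * exp (L x y) - \<mu> y * (L v y * exp (L x y)))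
          \<le> (norm v)\<^sup>2 * (norm (\<mu> y) * exp ((norm x + 3) * s y))" for y
      proof -
        have "norm (exp (L v y) - 1 - L v y) \<le> exp \<bar>Re (L v y)\<bar> * (norm (L v y))\<^sup>2"
          using Taylor_exp[of "L v y" 1] by (simp add: numeral_2_eq_2 diff_diff_eq)
        also have "\<dots> \<le> exp (s y) * (norm v * exp (s y))\<^sup>2"
        proof (intro mult_mono power_mono)
          have "\<bar>Re (L v y)\<bar> \<le> norm v * s y" using abs_Re_le_cmod L order_trans by blast
          also have "\<dots> \<le> 1 * s y" using v s0 by (intro mult_right_mono) auto
          finally show "exp \<bar>Re (L v y)\<bar> \<le> exp (s y)" by simp
          have "norm (L v y) \<le> norm v * s y" by (rule L)
          also have "\<dots> \<le> norm v * exp (s y)"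
            by (intro mult_left_mono s_exp) auto
          finally show "norm (L v y) \<le> norm v * exp (s y)" .
        qed auto
        also have "\<dots> = (norm v)\<^sup>2 * exp (3 * s y)"
        proof -
          have "exp (3 * s y) = exp (s y) * (exp (s y) * exp (s y))" unfolding exp_add[symmetric] by simp
          then show ?thesis by (simp add: power2_eq_square mult_ac)
        qed
        finally have T: "norm (exp (L v y) - 1 - L v y) \<le> (norm v)\<^sup>2 * exp (3 * s y)" .
        have "\<mu> y * exp (L u y) - \<mu> y * exp (L x y) - \<mu> y * (L v y * exp (L x y))
            = \<mu> y * (exp (L x y) * (exp (L v y) - 1 - L v y))"
          unfolding v(2) L_add exp_add by (simp add: algebra_simps)
        also have "norm \<dots> \<le> norm (\<mu> y) * (exp (norm x * s y) * ((norm v)\<^sup>2 * exp (3 * s y)))"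
          unfolding norm_mult by (intro mult_left_mono mult_mono T exp_L) auto
        also have "\<dots> = (norm v)\<^sup>2 * (norm (\<mu> y) * exp ((norm x + 3) * s y))"
        proof -
          have "exp ((norm x + 3) * s y) = exp (norm x * s y) * exp (3 * s y)"
            by (simp only: distrib_right exp_add)
          then show ?thesis by (simp only: mult_ac)
        qed
        finally show ?thesis .
      qed
      have "F u - F x - D x v = (LINT y|M. \<mu> y * exp (L u y) - \<mu> y * exp (L x y) - \<mu> y * (L v y * exp (L x y)))"
        unfolding F_def D_def using int0[of u] int0[of x] int1[of v x] by simp
      also have "norm \<dots> \<le> (LINT y|M. norm (\<mu> y * exp (L u y) - \<mu> y * exp (L x y) - \<mu> y * (L v y * exp (L x y))))"
        by (rule integral_norm_bound)
      also have "\<dots> \<le> (LINT y|M. (norm v)\<^sup>2 * (norm (\<mu> y) * exp ((norm x + 3) * s y)))"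
        by (intro integral_mono integrable_norm Bochner_Integration.integrable_diff int0 int1 integrable_mult_right int_exp pt)
      also have "\<dots> = (norm v)\<^sup>2 * K" by (simp add: K_def)
      finally show ?thesis using v(3) unfolding v_def[symmetric] by (simp add: field_simps power2_eq_square)
    qed
    have lim: "((\<lambda>u. norm (u - x) * K) \<longlongrightarrow> 0) (at x)"
      by (rule tendsto_eq_intros | simp)+
    show "(F has_derivative D x) (at x)"
      by (rule has_derivativeI_sandwich[OF zero_less_one lin _ lim]) (use rem in auto)
  qed
  then show ?thesis by (simp add: F_def[abs_def] kern)
qed

section \<open>Operators on Fock space\<close>

text \<open>Both norms carry the same normalizing factor, so the constant of Schur's test survives
  unchanged.\<close>

lemma fock_norm_schur:
  fixes f g :: "'n::finite cfun" and K :: "(complex^'n) \<times> (complex^'n) \<Rightarrow> ennreal"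
  assumes t: "0 < t" and p: "1 < p" and f: "f \<in> fock_space t p" and g: "entire_cn g"
    and K[measurable]: "K \<in> borel_measurable (lborel \<Otimes>\<^sub>M lborel)" and C: "0 < C"
    and K1: "\<And>x. (\<integral>\<^sup>+z. K (x, z) \<partial>lborel) \<le> ennreal C"
    and K2: "\<And>z. (\<integral>\<^sup>+x. K (x, z) \<partial>lborel) \<le> ennreal C"
    and le: "\<And>x. ennreal (norm (weighted t g x)) \<le> (\<integral>\<^sup>+z. K (x, z) * ennreal (norm (weighted t f z)) \<partial>lborel)"
  shows "g \<in> fock_space t p" and "fock_norm t p g \<le> C * fock_norm t p f"
proof -
  note [measurable] = measurable_weighted[OF entire_cn_measurable[OF g], of t]
    measurable_weighted[OF fock_space_measurable[OF f], of t]
  have "(\<integral>\<^sup>+x. ennreal (norm (weighted t g x) powr p) \<partial>lborel)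
      \<le> ennreal (C powr p) * (\<integral>\<^sup>+z. ennreal (norm (weighted t f z) powr p) \<partial>lborel)"
    by (rule schur_test[OF K _ _ _ _ p C K1 K2 le]) auto
  also have "\<dots> = ennreal ((pi * (2 * t / p)) ^ CARD('n) * (C * fock_norm t p f) powr p)"
    using t p C by (simp add: nn_integral_weighted_powr[OF t p f] ennreal_mult[symmetric] powr_mult fock_norm_nonneg mult_ac)
  finally have *: "(\<integral>\<^sup>+x. ennreal (norm (weighted t g x) powr p) \<partial>lborel)
    \<le> ennreal ((pi * (2 * t / p)) ^ CARD('n) * (C * fock_norm t p f) powr p)" .
  show "g \<in> fock_space t p" "fock_norm t p g \<le> C * fock_norm t p f"
    using fock_norm_le[OF t p g _ *] C by (auto simp: fock_norm_nonneg)
qed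

text \<open>The common majorant of the averaged operators and of their differences; its width is the
  one at which kernels are Lipschitz in their centre.\<close>

definition gauss_conv :: "real \<Rightarrow> (complex^'n::finite \<Rightarrow> complex) \<Rightarrow> complex^'n \<Rightarrow> real" where
  "gauss_conv t f x = (LINT z|lborel. norm (weighted t f z) * gauss (8 * t) (x - z))"

lemma gauss_conv_nonneg: "0 \<le> gauss_conv t f x"
  by (auto simp: gauss_conv_def intro!: integral_nonneg_AE)

lemma fock_norm_gauss_conv:
  fixes f g :: "'n::finite cfun"
  assumes t: "0 < t" and p: "1 < p" and f: "f \<in> fock_space t p" and g: "entire_cn g" and B: "0 < B"
    and le: "\<And>x. norm (weighted t g x) \<le> B * gauss_conv t f x"
  shows "g \<in> fock_space t p" and "fock_norm t p g \<le> B * (pi * (8 * t)) ^ CARD('n) * fock_norm t p f"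
proof -
  define K where "K = (\<lambda>(x, z). ennreal (B * gauss (8 * t) (x - z :: complex^'n)))"
  have K: "K \<in> borel_measurable (lborel \<Otimes>\<^sub>M lborel)" unfolding K_def by measurable
  have C: "0 < B * (pi * (8 * t)) ^ CARD('n)" using B t by simp
  have K1: "(\<integral>\<^sup>+z. K (x, z) \<partial>lborel) \<le> ennreal (B * (pi * (8 * t)) ^ CARD('n))" for x
    using B t nn_integral_gauss_translate(1)[of "8 * t" x]
    by (simp add: K_def ennreal_mult nn_integral_cmult del: mult_exp_exp)
  have K2: "(\<integral>\<^sup>+x. K (x, z) \<partial>lborel) \<le> ennreal (B * (pi * (8 * t)) ^ CARD('n))" for z
    using B t nn_integral_gauss_translate(2)[of "8 * t" z]
    by (simp add: K_def ennreal_mult nn_integral_cmult del: mult_exp_exp)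
  have le': "ennreal (norm (weighted t g x)) \<le> (\<integral>\<^sup>+z. K (x, z) * ennreal (norm (weighted t f z)) \<partial>lborel)" for x
  proof -
    have i: "integrable lborel (\<lambda>z. norm (weighted t f z) * gauss (8 * t) (x - z))"
      using t by (intro integrable_weighted_gauss[OF t p _ f]) simp
    have "ennreal (norm (weighted t g x)) \<le> ennreal B * ennreal (gauss_conv t f x)"
      using le[of x] B gauss_conv_nonneg[of t f x] by (simp add: ennreal_mult[symmetric] ennreal_leI)
    also have "ennreal (gauss_conv t f x) = (\<integral>\<^sup>+z. ennreal (norm (weighted t f z) * gauss (8 * t) (x - z)) \<partial>lborel)"
      unfolding gauss_conv_def by (rule nn_integral_eq_integral[OF i, symmetric]) simp
    also have "ennreal B * \<dots> = (\<integral>\<^sup>+z. ennreal B * ennreal (norm (weighted t f z) * gauss (8 * t) (x - z)) \<partial>lborel)"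
      using borel_measurable_integrable[OF i] by (intro nn_integral_cmult[symmetric]) simp
    also have "\<dots> = (\<integral>\<^sup>+z. K (x, z) * ennreal (norm (weighted t f z)) \<partial>lborel)"
      using B by (intro nn_integral_cong) (simp add: K_def ennreal_mult mult_ac)
    finally show ?thesis .
  qed
  show "g \<in> fock_space t p" "fock_norm t p g \<le> B * (pi * (8 * t)) ^ CARD('n) * fock_norm t p f"
    by (rule fock_norm_schur[OF t p f g K C K1 K2 le'])+
qed

text \<open>The factor is the p-th root of the ratio \<open>4 ^ n\<close> between the integral of
  \<open>gauss (8 * t / p)\<close> and the normalization by
  \<open>gauss (2 * t / p)\<close>.\<close>

lemma fock_norm_gauss_le:
  fixes g :: "'n::finite cfun"
  assumes t: "0 < t" and p: "1 < p" and g: "entire_cn g" and B: "0 \<le> B"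
    and le: "\<And>x. norm (weighted t g x) \<le> B * gauss (8 * t) x"
  shows "g \<in> fock_space t p" and "fock_norm t p g \<le> B * 4 powr (real CARD('n) / p)"
proof -
  have "(\<integral>\<^sup>+x. ennreal (norm (weighted t g x) powr p) \<partial>lborel)
      \<le> (\<integral>\<^sup>+x. ennreal (B powr p) * ennreal (gauss (8 * t / p) (x::complex^'n)) \<partial>lborel)"
  proof (intro nn_integral_mono)
    fix x :: "complex^'n"
    have "norm (weighted t g x) powr p \<le> (B * gauss (8 * t) x) powr p"
      using p by (intro powr_mono2 le) auto
    also have "\<dots> = B powr p * gauss (8 * t / p) x"
      using B by (simp add: powr_mult) (simp add: powr_def)
    finally show "ennreal (norm (weighted t g x) powr p) \<le> ennreal (B powr p) * ennreal (gauss (8 * t / p) x)"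
      by (simp add: ennreal_mult[symmetric] ennreal_leI)
  qed
  also have "\<dots> = ennreal (B powr p * (pi * (8 * t / p)) ^ CARD('n))"
  proof -
    have "(\<integral>\<^sup>+x. ennreal (B powr p) * ennreal (gauss (8 * t / p) (x::complex^'n)) \<partial>lborel)
        = ennreal (B powr p) * (\<integral>\<^sup>+x. ennreal (gauss (8 * t / p) (x::complex^'n)) \<partial>lborel)"
      by (intro nn_integral_cmult) measurable
    also have "\<dots> = ennreal (B powr p) * ennreal ((pi * (8 * t / p)) ^ CARD('n))"
      by (subst nn_integral_gauss) (use t p in auto)
    also have "\<dots> = ennreal (B powr p * (pi * (8 * t / p)) ^ CARD('n))"
      using t p by (intro ennreal_mult[symmetric]) auto
    finally show ?thesis .
  qed
  also have "B powr p * (pi * (8 * t / p)) ^ CARD('n) = (pi * (2 * t / p)) ^ CARD('n) * (B * 4 powr (real CARD('n) / p)) powr p"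
  proof -
    have "(B * 4 powr (real CARD('n) / p)) powr p = B powr p * 4 ^ CARD('n)"
      using B p by (simp add: powr_mult powr_powr powr_realpow)
    moreover have "(pi * (8 * t / p)) ^ CARD('n) = (pi * (2 * t / p)) ^ CARD('n) * 4 ^ CARD('n)"
    proof -
      have "pi * (8 * t / p) = pi * (2 * t / p) * 4" by simp
      then show ?thesis by (simp only: power_mult_distrib)
    qed
    ultimately show ?thesis by simp
  qed
  finally have *: "(\<integral>\<^sup>+x. ennreal (norm (weighted t g x) powr p) \<partial>lborel)
    \<le> ennreal ((pi * (2 * t / p)) ^ CARD('n) * (B * 4 powr (real CARD('n) / p)) powr p)" .
  show "g \<in> fock_space t p" "fock_norm t p g \<le> B * 4 powr (real CARD('n) / p)"
    using fock_norm_le[OF t p g _ *] B by auto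
qed

lemma fock_norm_fock_kernel:
  fixes z :: "complex^'n::finite"
  assumes t: "0 < t" and p: "1 < p"
  shows "fock_norm t p (fock_kernel t z) \<le> 1"
proof (rule fock_norm_le(2)[OF t p entire_cn_fock_kernel])
  have "gauss (2 * t) (x - z) powr p = gauss (2 * t / p) (x - z)" for x
    by (simp add: powr_def)
  then show "(\<integral>\<^sup>+x. ennreal (norm (kern t z x) powr p) \<partial>lborel)
      \<le> ennreal ((pi * (2 * t / p)) ^ CARD('n) * 1 powr p)"
    using t p nn_integral_gauss_translate(2)[of "2 * t / p" z]
    by (simp add: norm_weighted_fock_kernel)
qed simp

section \<open>The operator norm and combinations of bounded operators\<close>

lemma fock_opnorm_le:
  fixes T :: "'n::finite cop"
  assumes C: "0 \<le> C" and le: "\<And>f. f \<in> fock_space t p \<Longrightarrow> fock_norm t p (T f) \<le> C * fock_norm t p f"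
  shows "fock_opnorm t p T \<le> C"
  unfolding fock_opnorm_def
proof (rule cSup_least)
  show "{fock_norm t p (T f) |f. f \<in> fock_space t p \<and> fock_norm t p f \<le> 1} \<noteq> {}"
  proof -
    have "\<exists>f::'n cfun. f \<in> fock_space t p \<and> fock_norm t p f \<le> 1"
      by (rule exI[of _ "\<lambda>z. 0"]) (simp add: fock_space_zero fock_norm_zero)
    then show ?thesis by blast
  qed
  fix y assume "y \<in> {fock_norm t p (T f) |f. f \<in> fock_space t p \<and> fock_norm t p f \<le> 1}"
  then obtain f where f: "f \<in> fock_space t p" "fock_norm t p f \<le> 1" "y = fock_norm t p (T f)" by blast
  then have "y \<le> C * fock_norm t p f" using le by simp
  also have "\<dots> \<le> C * 1" using C f by (intro mult_left_mono) auto
  finally show "y \<le> C" by simp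
qed

text \<open>The norm sees an operator only on the carrier, where chosen integrals and their explicit
  versions agree.\<close>

lemma fock_opnorm_cong:
  assumes "\<And>f. f \<in> fock_space t p \<Longrightarrow> S f = T f"
  shows "fock_opnorm t p S = fock_opnorm t p T"
  unfolding fock_opnorm_def using assms by (intro arg_cong[of _ _ Sup] Collect_cong ex_cong1) auto

lemma
  fixes T :: "'n::finite cop"
  assumes p: "1 < p" and T: "fock_bounded_op t p T"
  shows fock_norm_le_opnorm: "f \<in> fock_space t p \<Longrightarrow> fock_norm t p (T f) \<le> fock_opnorm t p T * fock_norm t p f"
    and fock_opnorm_nonneg: "0 \<le> fock_opnorm t p T"
proof -
  obtain C where C: "\<And>f. f \<in> fock_space t p \<Longrightarrow> fock_norm t p (T f) \<le> C * fock_norm t p f"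
    using T unfolding fock_bounded_op_def by blast
  have bdd: "bdd_above {fock_norm t p (T f) |f. f \<in> fock_space t p \<and> fock_norm t p f \<le> 1}"
  \<comment> \<open>The constant in the definition of boundedness carries no sign condition.\<close>
  proof (rule bdd_aboveI[of _ "max C 0"])
    fix y assume "y \<in> {fock_norm t p (T f) |f. f \<in> fock_space t p \<and> fock_norm t p f \<le> 1}"
    then obtain f where f: "f \<in> fock_space t p" "fock_norm t p f \<le> 1" "y = fock_norm t p (T f)" by blast
    then have "y \<le> C * fock_norm t p f" using C by simp
    also have "\<dots> \<le> max C 0 * 1" using f fock_norm_nonneg[of t p f] by (intro mult_mono) auto
    finally show "y \<le> max C 0" by simp
  qed
  have upper: "fock_norm t p (T f) \<le> fock_opnorm t p T" if "f \<in> fock_space t p" "fock_norm t p f \<le> 1" for f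
    unfolding fock_opnorm_def using that by (intro cSup_upper bdd) auto
  show "0 \<le> fock_opnorm t p T"
    using upper[OF fock_space_zero] fock_norm_nonneg[of t p] by (auto simp: fock_norm_zero intro: order_trans)
  show "fock_norm t p (T f) \<le> fock_opnorm t p T * fock_norm t p f" if f: "f \<in> fock_space t p"
  \<comment> \<open>A function of norm 0 cannot be scaled to norm 1; there boundedness itself forces
    the norm of \<open>T f\<close> to be 0.\<close>
  proof (cases "fock_norm t p f = 0")
    case True
    then show ?thesis using C[OF f] by simp
  next
    case False
    define c where "c = fock_norm t p f"
    have c: "c > 0" using False fock_norm_nonneg[of t p f] by (simp add: c_def)
    have sc: "fock_norm t p (\<lambda>z. complex_of_real (1 / c) * g z) = 1 / c * fock_norm t p g" for g :: "'n cfun"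
    proof -
      have "fock_norm t p (\<lambda>z. complex_of_real (1 / c) * g z) = norm (complex_of_real (1 / c)) * fock_norm t p g"
        using p by (intro fock_norm_cmult) simp
      then show ?thesis unfolding norm_of_real using c by simp
    qed
    have "fock_norm t p (\<lambda>z. complex_of_real (1 / c) * f z) \<le> 1"
      unfolding sc using c by (simp add: c_def)
    then have "fock_norm t p (T (\<lambda>z. complex_of_real (1 / c) * f z)) \<le> fock_opnorm t p T"
      by (intro upper fock_space_cmult f)
    moreover have "T (\<lambda>z. complex_of_real (1 / c) * f z) = (\<lambda>z. complex_of_real (1 / c) * T f z)"
      using T f unfolding fock_bounded_op_def by blast
    ultimately have "1 / c * fock_norm t p (T f) \<le> fock_opnorm t p T"
      by (simp only: sc)
    then show ?thesis using c by (simp add: field_simps c_def[symmetric])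
  qed
qed

lemma fock_bounded_opD:
  assumes "fock_bounded_op t p T"
  shows "f \<in> fock_space t p \<Longrightarrow> T f \<in> fock_space t p"
    and "f \<in> fock_space t p \<Longrightarrow> g \<in> fock_space t p \<Longrightarrow> T (\<lambda>z. f z + g z) = (\<lambda>z. T f z + T g z)"
    and "f \<in> fock_space t p \<Longrightarrow> T (\<lambda>z. c * f z) = (\<lambda>z. c * T f z)"
  using assms by (auto simp: fock_bounded_op_def)

lemma fock_bounded_op_minus_arg:
  assumes t: "0 < t" and p: "1 < p" and T: "fock_bounded_op t p T" and f: "f \<in> fock_space t p" and g: "g \<in> fock_space t p"
  shows "T (\<lambda>z. f z - g z) = (\<lambda>z. T f z - T g z)"
  using fock_bounded_opD(2)[OF T f fock_space_uminus[OF g]] fock_bounded_opD(3)[OF T g, of "-1"] by simp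

lemma fock_bounded_op_zero: "fock_bounded_op t p (\<lambda>f x. 0)"
  unfolding fock_bounded_op_def by (auto simp: fock_space_zero fock_norm_zero intro!: exI[of _ 0])

lemma fock_bounded_op_add_cmult:
  fixes S T :: "'n::finite cop"
  assumes t: "0 < t" and p: "1 < p" and S: "fock_bounded_op t p S" and T: "fock_bounded_op t p T"
  shows "fock_bounded_op t p (\<lambda>f x. S f x + c * T f x)"
  unfolding fock_bounded_op_def
proof (intro conjI ballI allI exI)
  fix f :: "'n cfun" assume f: "f \<in> fock_space t p"
  note Sf = fock_bounded_opD(1)[OF S f] and Tf = fock_bounded_opD(1)[OF T f]
  show "(\<lambda>x. S f x + c * T f x) \<in> fock_space t p"
    by (intro fock_space_add t p Sf fock_space_cmult Tf)
  show "(\<lambda>x. S (\<lambda>z. d * f z) x + c * T (\<lambda>z. d * f z) x) = (\<lambda>x. d * (S f x + c * T f x))" for d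
    by (simp add: fock_bounded_opD(3)[OF S f] fock_bounded_opD(3)[OF T f] algebra_simps)
  show "(\<lambda>x. S (\<lambda>z. f z + g z) x + c * T (\<lambda>z. f z + g z) x) = (\<lambda>x. S f x + c * T f x + (S g x + c * T g x))"
    if g: "g \<in> fock_space t p" for g
    by (simp add: fock_bounded_opD(2)[OF S f g] fock_bounded_opD(2)[OF T f g] algebra_simps)
  have "fock_norm t p (\<lambda>x. S f x + c * T f x) \<le> fock_norm t p (S f) + fock_norm t p (\<lambda>x. c * T f x)"
    by (intro fock_norm_triangle t p Sf fock_space_cmult Tf)
  also have "\<dots> \<le> fock_opnorm t p S * fock_norm t p f + norm c * (fock_opnorm t p T * fock_norm t p f)"
    using p fock_norm_le_opnorm[OF p S f] fock_norm_le_opnorm[OF p T f]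
    by (simp add: fock_norm_cmult add_mono mult_left_mono)
  finally show "fock_norm t p (\<lambda>x. S f x + c * T f x) \<le> (fock_opnorm t p S + norm c * fock_opnorm t p T) * fock_norm t p f"
    by (simp add: algebra_simps)
qed

lemma fock_bounded_op_diff:
  assumes "0 < t" "1 < p" "fock_bounded_op t p S" "fock_bounded_op t p T"
  shows "fock_bounded_op t p (S - T)"
  using fock_bounded_op_add_cmult[OF assms, of "-1"] by (simp add: fun_diff_def)

lemma fock_bounded_op_lincomb:
  fixes m :: nat
  assumes t: "0 < t" and p: "1 < p" and T: "\<And>i. i < m \<Longrightarrow> fock_bounded_op t p (T i)"
  shows "fock_bounded_op t p (\<lambda>f x. \<Sum>i<m. c i * T i f x)"
  using T
proof (induction m)
  case 0
  then show ?case by (simp add: fock_bounded_op_zero)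
next
  case (Suc m)
  then show ?case using fock_bounded_op_add_cmult[OF t p Suc.IH, of "T m" "c m"] by simp
qed

lemma fock_bounded_op_simple:
  assumes t: "0 < t" and p: "1 < p" and T: "\<And>i. i < m \<Longrightarrow> fock_bounded_op t p (T i)"
  shows "fock_bounded_op t p (simple_op m E T w)" "fock_bounded_op t p (simple_op_integral m E T)"
  unfolding simple_op_def simple_op_integral_def by (rule fock_bounded_op_lincomb[OF t p T]; assumption)+

lemma fock_opnorm_triangle:
  fixes S T U :: "'n::finite cop"
  assumes t: "0 < t" and p: "1 < p" and S: "fock_bounded_op t p S" and T: "fock_bounded_op t p T" and U: "fock_bounded_op t p U"
  shows "fock_opnorm t p (S - U) \<le> fock_opnorm t p (S - T) + fock_opnorm t p (T - U)"
proof (rule fock_opnorm_le)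
  note ST = fock_bounded_op_diff[OF t p S T] and TU = fock_bounded_op_diff[OF t p T U]
  show "0 \<le> fock_opnorm t p (S - T) + fock_opnorm t p (T - U)"
    using fock_opnorm_nonneg[OF p ST] fock_opnorm_nonneg[OF p TU] by simp
  fix f :: "'n cfun" assume f: "f \<in> fock_space t p"
  have "fock_norm t p ((S - U) f) = fock_norm t p (\<lambda>x. (S - T) f x + (T - U) f x)"
    by (simp add: fun_diff_def)
  also have "\<dots> \<le> fock_norm t p ((S - T) f) + fock_norm t p ((T - U) f)"
    by (intro fock_norm_triangle t p fock_bounded_opD(1)[OF ST f] fock_bounded_opD(1)[OF TU f])
  also have "\<dots> \<le> (fock_opnorm t p (S - T) + fock_opnorm t p (T - U)) * fock_norm t p f"
    using fock_norm_le_opnorm[OF p ST f] fock_norm_le_opnorm[OF p TU f] by (simp add: distrib_right)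
  finally show "fock_norm t p ((S - U) f) \<le> (fock_opnorm t p (S - T) + fock_opnorm t p (T - U)) * fock_norm t p f" .
qed

section \<open>Uniqueness of weak operator integrals\<close>

text \<open>The kernels belong to the dual space, so the weak identities may be tested on them, and
  by the reproducing formula these tests are point evaluations.\<close>

lemma has_op_integral_unique:
  fixes S S' :: "(complex^'n::finite \<Rightarrow> complex) \<Rightarrow> (complex^'n \<Rightarrow> complex)"
  assumes t: "0 < t" and p: "1 < p"
    and S: "has_op_integral t p h \<phi> \<psi> S" and S': "has_op_integral t p h \<phi> \<psi> S'"
    and f: "f \<in> fock_space t p"
  shows "S f = S' f"
proof
  fix x
  have q: "1 < conj_exponent p" using p by (simp add: conj_exponent_def)
  have "fock_pairing t (S f) (fock_kernel t x) = fock_pairing t (S' f) (fock_kernel t x)"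
    using S S' f fock_kernel_in_fock_space[OF t q, of x] by (simp add: has_op_integral_def)
  moreover have "S f \<in> fock_space t p" "S' f \<in> fock_space t p"
    using S S' f by (auto simp: has_op_integral_def fock_bounded_op_def)
  ultimately have "weighted t (S f) x = weighted t (S' f) x"
    by (simp add: fock_reproducing(1)[OF t p])
  then show "S f x = S' f x" by (simp add: weighted_eq_iff)
qed

lemma op_integral_works:
  "has_op_integral t p h \<phi> \<psi> S \<Longrightarrow> has_op_integral t p h \<phi> \<psi> (op_integral t p h \<phi> \<psi>)"
  unfolding op_integral_def by (rule someI[of "has_op_integral t p h \<phi> \<psi>"])

section \<open>Weyl translates of kernels\<close>

lemma weyl_fock_kernel_0: "weyl t z (fock_kernel t 0) = fock_kernel t z"
  by (simp add: weyl_def fock_kernel_def fun_eq_iff)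

text \<open>The cocycle of the Weyl operators. The exponent of the phase is \<open>i\<close> times
  the imaginary part of \<open>herm_dot w z\<close>, divided by \<open>t\<close>: it depends on
  \<open>z\<close> and \<open>w\<close> but not on the argument \<open>x\<close>.\<close>

lemma weyl_fock_kernel:
  fixes z w :: "complex^'n::finite"
  assumes t: "0 < t"
  shows "\<exists>\<theta>. norm \<theta> = 1 \<and> weyl t z (fock_kernel t w) = (\<lambda>x. \<theta> * fock_kernel t (z + w) x)"
proof (intro exI conjI)
  define \<theta> where "\<theta> = exp ((herm_dot w z - herm_dot z w) / (2 * complex_of_real t))"
  have "Re (herm_dot w z - herm_dot z w) = 0" by (simp add: Re_herm_dot inner_commute)
  moreover have "(herm_dot w z - herm_dot z w) / (2 * complex_of_real t) = (herm_dot w z - herm_dot z w) / complex_of_real (2 * t)"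
    by simp
  ultimately show "norm \<theta> = 1" by (simp only: \<theta>_def norm_exp_eq_Re Re_divide_of_real) simp
  show "weyl t z (fock_kernel t w) = (\<lambda>x. \<theta> * fock_kernel t (z + w) x)"
  proof
    fix x
    have nn: "complex_of_real ((norm u)\<^sup>2 / (2 * t)) = herm_dot u u / (2 * complex_of_real t)" for u :: "complex^'n"
      by (simp add: herm_dot_self)
    have "(herm_dot x z / t - herm_dot z z / (2 * complex_of_real t)) + (herm_dot (x - z) w / t - herm_dot w w / (2 * complex_of_real t))
      = (herm_dot w z - herm_dot z w) / (2 * complex_of_real t) +
        (herm_dot x (z + w) / t - herm_dot (z + w) (z + w) / (2 * complex_of_real t))"
      using t by (simp add: herm_dot_add_left herm_dot_add_right herm_dot_diff_left field_simps)
    then show "weyl t z (fock_kernel t w) x = \<theta> * fock_kernel t (z + w) x"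
      unfolding weyl_def fock_kernel_def \<theta>_def exp_add[symmetric] nn by simp
  qed
qed

lemma weighted_weyl: "weighted t (weyl t z f) x = kern t z x * f (x - z)"
  by (simp add: weighted_def weyl_def)

lemma norm_weighted_weyl:
  assumes "0 < t" shows "norm (weighted t (weyl t z f) x) = norm (weighted t f (x - z))"
  using assms by (simp add: weighted_weyl norm_mult norm_weighted_fock_kernel) (simp add: weighted_def norm_mult)

text \<open>The unimodular factor that accompanies the translation by \<open>z\<close> is the same
  for \<open>f\<close> and \<open>g\<close>. Hence estimates for kernels centred near 0 pass to all
  translates with the same constant.\<close>

lemma norm_weighted_weyl_diff:
  assumes "0 < t"
  shows "norm (weighted t (weyl t z f) x - weighted t (weyl t z g) x) = norm (weighted t f (x - z) - weighted t g (x - z))"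
  using norm_weighted_weyl[OF assms, of z "\<lambda>x. f x - g x" x]
  by (simp add: weighted_weyl weighted_diff algebra_simps)

section \<open>Matrix coefficients of the operator with respect to kernels\<close>

locale bounded_fock_operator =
  fixes t p :: real and A :: "'n::finite cop"
  assumes t: "0 < t" and p: "1 < p" and A: "fock_bounded_op t p A"
begin

abbreviation Kint :: "complex^'n \<Rightarrow> 'n cop" where
  "Kint \<equiv> kernel_integral t p A"

abbreviation wkern :: "complex^'n \<Rightarrow> complex^'n \<Rightarrow> 'n cfun" where
  "wkern z w \<equiv> weighted t (weyl t z (fock_kernel t w))"

abbreviation opnorm :: "'n cop \<Rightarrow> real" where
  "opnorm \<equiv> fock_opnorm t p"

abbreviation bdd_op :: "'n cop \<Rightarrow> bool" where
  "bdd_op \<equiv> fock_bounded_op t p"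

text \<open>By the reproducing formula this is the pairing of \<open>A k_z\<close> with
  \<open>k_u\<close>; as a weighted function of \<open>u\<close> its continuity is visible.\<close>

definition coef :: "complex^'n \<Rightarrow> complex^'n \<Rightarrow> complex" where
  "coef z u = weighted t (A (fock_kernel t z)) u"

text \<open>Raised by 1 to be positive also for the zero operator, since Schur's test asks for a
  positive constant.\<close>

definition coef_const :: real where
  "coef_const = fock_sup_const t p TYPE('n) * opnorm A + 1"

lemma coef_const_pos: "0 < coef_const"
  unfolding coef_const_def using fock_sup_const_nonneg[of t p "TYPE('n)"] fock_opnorm_nonneg[OF p A]
  by (intro add_nonneg_pos mult_nonneg_nonneg) auto

lemma A_kernel: "A (fock_kernel t z) \<in> fock_space t p"
  by (intro fock_bounded_opD(1)[OF A] fock_kernel_in_fock_space t p)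

lemma norm_weighted_A_le:
  assumes f: "f \<in> fock_space t p" and B: "fock_norm t p f \<le> B"
  shows "norm (weighted t (A f) u) \<le> coef_const * B"
proof -
  have "0 \<le> B" using B fock_norm_nonneg[of t p f] by linarith
  have "norm (weighted t (A f) u) \<le> fock_sup_const t p TYPE('n) * fock_norm t p (A f)"
    by (rule norm_weighted_le_fock_norm[OF t p fock_bounded_opD(1)[OF A f]])
  also have "\<dots> \<le> fock_sup_const t p TYPE('n) * (opnorm A * B)"
    using fock_norm_le_opnorm[OF p A f] mult_left_mono[OF B fock_opnorm_nonneg[OF p A]] fock_sup_const_nonneg
    by (intro mult_left_mono) auto
  also have "\<dots> \<le> coef_const * B" using \<open>0 \<le> B\<close> by (simp add: coef_const_def algebra_simps)
  finally show ?thesis .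
qed

lemma norm_coef_le: "norm (coef z u) \<le> coef_const"
  using norm_weighted_A_le[OF fock_kernel_in_fock_space[OF t p] fock_norm_fock_kernel[OF t p], of z u]
  by (simp add: coef_def)

text \<open>The difference of two kernels is small in Fock norm by its Gaussian majorant, and
  \<open>A\<close> followed by a point evaluation is bounded. The constant depends on
  \<open>R\<close> but not on \<open>u\<close>.\<close>

lemma norm_coef_diff_le:
  assumes z: "norm z \<le> R" "norm z' \<le> R"
  shows "norm (coef z u - coef z' u)
    \<le> coef_const * (kernel_lip t R * norm (z - z') * 4 powr (real CARD('n) / p))"
proof -
  have R: "0 \<le> R" using z(1) norm_ge_zero[of z] by linarith
  have e: "entire_cn (\<lambda>x. fock_kernel t z x - fock_kernel t z' x)"
    using entire_cn_add[OF entire_cn_fock_kernel entire_cn_mult[OF entire_cn_const entire_cn_fock_kernel], of t z "-1" t z'] by simp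
  have le: "norm (weighted t (\<lambda>x. fock_kernel t z x - fock_kernel t z' x) x)
      \<le> kernel_lip t R * norm (z - z') * gauss (8 * t) x" for x
    unfolding weighted_diff by (rule norm_weighted_kernel_diff_le[OF t z])
  have "0 \<le> kernel_lip t R * norm (z - z')"
    using kernel_lip_pos[OF t R] by simp
  note * = fock_norm_gauss_le[OF t p e this le]
  have "coef z u - coef z' u = weighted t (A (\<lambda>x. fock_kernel t z x - fock_kernel t z' x)) u"
    by (simp add: coef_def fock_bounded_op_minus_arg[OF t p A] fock_kernel_in_fock_space t p weighted_diff)
  then show ?thesis using norm_weighted_A_le[OF *] by simp
qed

text \<open>The modulus of continuity in \<open>z\<close> is uniform in \<open>u\<close>, so
  continuity in \<open>u\<close> for fixed \<open>z\<close> upgrades to joint continuity. The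
  measurability behind all Fubini arguments rests on this.\<close>

lemma continuous_coef: "continuous_on UNIV (\<lambda>y. coef (fst y) (snd y))"
  unfolding continuous_on_eq_continuous_at[OF open_UNIV]
proof
  fix y0 :: "(complex^'n) \<times> (complex^'n)"
  define z0 where "z0 = fst y0"
  define R where "R = norm z0 + 1"
  define L where "L = coef_const * (kernel_lip t R * 4 powr (real CARD('n) / p))"
  have "((\<lambda>y. coef (fst y) (snd y) - coef z0 (snd y)) \<longlongrightarrow> 0) (at y0)"
  proof (rule Lim_null_comparison)
    have "\<forall>\<^sub>F y in at y0. dist (fst y) (fst y0) < 1"
      using tendsto_fst[OF tendsto_ident_at, of y0 UNIV] by (auto dest!: tendstoD[of _ _ _ 1])
    then show "\<forall>\<^sub>F y in at y0. norm (coef (fst y) (snd y) - coef z0 (snd y)) \<le> L * norm (fst y - z0)"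
    proof eventually_elim
      case (elim y)
      have "norm (fst y) \<le> R" using elim norm_triangle_sub[of "fst y" z0] by (simp add: R_def z0_def dist_norm)
      from norm_coef_diff_le[OF this, of z0 "snd y"] show ?case by (simp add: R_def L_def mult_ac)
    qed
    show "((\<lambda>y. L * norm (fst y - z0)) \<longlongrightarrow> 0) (at y0)"
      unfolding z0_def by (rule tendsto_eq_intros | simp)+
  qed
  moreover have "((\<lambda>y. coef z0 (snd y)) \<longlongrightarrow> coef z0 (snd y0)) (at y0)"
  proof -
    have "continuous_on UNIV (coef z0)"
      unfolding coef_def using t by (intro continuous_on_weighted fock_space_entire[OF A_kernel]) simp
    then have "isCont (coef z0) (snd y0)" by (simp add: continuous_on_eq_continuous_at)
    then show ?thesis by (rule isCont_tendsto_compose) (intro tendsto_intros)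
  qed
  ultimately have "((\<lambda>y. (coef (fst y) (snd y) - coef z0 (snd y)) + coef z0 (snd y)) \<longlongrightarrow> 0 + coef z0 (snd y0)) (at y0)"
    by (rule tendsto_add)
  then show "isCont (\<lambda>y. coef (fst y) (snd y)) y0"
    by (simp add: isCont_def z0_def)
qed

lemma measurable_coef[measurable]:
  assumes [measurable]: "f \<in> borel_measurable M" "g \<in> borel_measurable M"
  shows "(\<lambda>y. coef (f y) (g y)) \<in> borel_measurable M"
  using measurable_compose[OF _ borel_measurable_continuous_onI[OF continuous_coef], of "\<lambda>y. (f y, g y)" M] by simp

lemma kernel_coeff_eq: "kernel_coeff t A w z = coef z (z + w)"
  by (simp add: kernel_coeff_def coef_def fock_reproducing(1)[OF t p A_kernel])

section \<open>The translation-averaged operators\<close>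

text \<open>The phase between \<open>W_z k_w\<close> and \<open>k_(z+w)\<close> occurs in the kernel
  and, conjugated through the second slot of the pairing, in the coefficient; the product is free of
  it.\<close>

lemma
  shows weyl_coeff_times_weyl_kernel: "weyl_coeff t A w z * (X * wkern z w x)
      = coef z (z + w) * (X * kern t (z + w) x)"
    and weyl_coeff_rank_one: "weyl_coeff t A w z * fock_pairing t f' (weyl t z (fock_kernel t 0)) * fock_pairing t (weyl t z (fock_kernel t w)) g
      = kernel_coeff t A w z * fock_pairing t f' (fock_kernel t z) * fock_pairing t (fock_kernel t (z + w)) g"
    and norm_weyl_coeff_le: "norm (weyl_coeff t A w z) \<le> coef_const"
proof -
  obtain \<theta> where \<theta>: "norm \<theta> = 1" "weyl t z (fock_kernel t w) = (\<lambda>x. \<theta> * fock_kernel t (z + w) x)"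
    using weyl_fock_kernel[OF t] by blast
  have c: "weyl_coeff t A w z = cnj \<theta> * kernel_coeff t A w z"
    by (simp add: weyl_coeff_def weyl_fock_kernel_0 \<theta>(2) fock_pairing_cmult kernel_coeff_def)
  have u: "cnj \<theta> * \<theta> = 1"
    using \<theta>(1) complex_norm_square[of \<theta>] by (simp add: mult.commute)
  have "weyl_coeff t A w z * (X * wkern z w x)
      = (cnj \<theta> * \<theta>) * (kernel_coeff t A w z * (X * kern t (z + w) x))"
    unfolding c \<theta>(2) weighted_cmult by (simp only: mult_ac)
  then show "weyl_coeff t A w z * (X * wkern z w x)
      = coef z (z + w) * (X * kern t (z + w) x)"
    unfolding u kernel_coeff_eq by simp
  have "weyl_coeff t A w z * fock_pairing t f' (weyl t z (fock_kernel t 0)) * fock_pairing t (weyl t z (fock_kernel t w)) g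
      = (cnj \<theta> * \<theta>) * (kernel_coeff t A w z * fock_pairing t f' (fock_kernel t z) * fock_pairing t (fock_kernel t (z + w)) g)"
    unfolding c \<theta>(2) weyl_fock_kernel_0 fock_pairing_cmult by (simp only: mult_ac)
  then show "weyl_coeff t A w z * fock_pairing t f' (weyl t z (fock_kernel t 0)) * fock_pairing t (weyl t z (fock_kernel t w)) g
      = kernel_coeff t A w z * fock_pairing t f' (fock_kernel t z) * fock_pairing t (fock_kernel t (z + w)) g"
    unfolding u by simp
  show "norm (weyl_coeff t A w z) \<le> coef_const"
    using \<theta>(1) norm_coef_le[of z "z + w"] by (simp add: c norm_mult kernel_coeff_eq)
qed

lemma has_op_integral_weyl_iff:
  "has_op_integral t p (weyl_coeff t A w) (\<lambda>z. weyl t z (fock_kernel t w)) (\<lambda>z. weyl t z (fock_kernel t 0)) S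
    \<longleftrightarrow> has_op_integral t p (kernel_coeff t A w) (\<lambda>z. fock_kernel t (z + w)) (\<lambda>z. fock_kernel t z) S"
  unfolding has_op_integral_def weyl_coeff_rank_one ..

text \<open>The two choices are made from equivalent predicates, so they coincide as HOL functions
  and not merely on the Fock space.\<close>

lemma weyl_integral_eq: "weyl_integral t p A w = Kint w"
  by (simp add: weyl_integral_def kernel_integral_def op_integral_def has_op_integral_weyl_iff)

lemma entire_weyl_kernel: "entire_cn (weyl t z (fock_kernel t w))"
proof -
  obtain \<theta> where "weyl t z (fock_kernel t w) = (\<lambda>x. \<theta> * fock_kernel t (z + w) x)"
    using weyl_fock_kernel[OF t] by blast
  then show ?thesis by (simp add: entire_cn_mult entire_cn_const entire_cn_fock_kernel)
qed

lemma norm_weyl_kernel_le: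
  assumes "norm w \<le> R"
  shows "norm (wkern z w x)
    \<le> kernel_lip t R * gauss (8 * t) (x - z)"
  unfolding norm_weighted_weyl[OF t] by (rule norm_weighted_kernel_le[OF t assms])

lemma norm_weyl_kernel_diff_le:
  assumes "norm w \<le> R" "norm w' \<le> R"
  shows "norm (wkern z w x - wkern z w' x)
    \<le> kernel_lip t R * norm (w - w') * gauss (8 * t) (x - z)"
  unfolding norm_weighted_weyl_diff[OF t] by (rule norm_weighted_kernel_diff_le[OF t assms])

text \<open>Only the second slot of the pairing depends on \<open>w\<close>. There the difference of
  Weyl translates has a Gaussian majorant of mass \<open>(8 * pi * t) ^ n\<close>, and dividing by
  the normalization \<open>(pi * t) ^ n\<close> leaves the factor \<open>8 ^ n\<close>, for every
  \<open>z\<close>.\<close>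

lemma norm_weyl_coeff_diff_le:
  assumes w: "norm w \<le> R" "norm w' \<le> R"
  shows "norm (weyl_coeff t A w z - weyl_coeff t A w' z)
    \<le> 8 ^ CARD('n) * (coef_const * (kernel_lip t R * norm (w - w')))"
proof -
  define c where "c = 1 / (pi * t) ^ CARD('n)"
  have c: "0 < c" using t by (simp add: c_def)
  define B where "B = coef_const * (kernel_lip t R * norm (w - w'))"
  have R: "0 \<le> R" using w(1) norm_ge_zero[of w] by linarith
  note L = kernel_lip_pos[OF t R]
  note [measurable] = measurable_weighted[OF entire_cn_measurable[OF entire_weyl_kernel], of t]
    measurable_weighted[OF fock_space_measurable[OF A_kernel], of t]
  define k where "k w x = wkern z w x" for w x
  have [measurable]: "k w \<in> borel_measurable borel" for w unfolding k_def by measurable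
  have G: "integrable lborel (\<lambda>x. gauss (8 * t) (x - z))"
    using integrable_gauss_translate[of "8 * t" z] t by (simp add: norm_minus_commute)
  have i: "integrable lborel (\<lambda>x. coef z x * cnj (k v x))" if "norm v \<le> R" for v
  proof (rule Bochner_Integration.integrable_bound[OF integrable_mult_right[OF G, of "coef_const * kernel_lip t R"]])
    show "AE x in lborel. norm (coef z x * cnj (k v x))
        \<le> norm (coef_const * kernel_lip t R * gauss (8 * t) (x - z))" (is "AE x in _. ?P x")
    proof (rule AE_I2)
      fix x
      have "norm (coef z x) * norm (k v x) \<le> coef_const * (kernel_lip t R * gauss (8 * t) (x - z))"
        unfolding k_def using coef_const_pos by (intro mult_mono norm_coef_le norm_weyl_kernel_le that) auto
      then show "?P x"
        using coef_const_pos L by (simp add: norm_mult mult_ac)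
    qed
  qed measurable
  have eq: "weyl_coeff t A v z = complex_of_real c * (LINT x|lborel. coef z x * cnj (k v x))" for v
    unfolding weyl_coeff_def weyl_fock_kernel_0 c_def coef_def k_def
    by (intro fock_pairing_eq t fock_space_measurable[OF A_kernel] entire_cn_measurable entire_weyl_kernel)
  have "weyl_coeff t A w z - weyl_coeff t A w' z = complex_of_real c * (LINT x|lborel. coef z x * cnj (k w x - k w' x))"
    unfolding eq using i[OF w(1)] i[OF w(2)] by (simp add: right_diff_distrib)
  then have "norm (weyl_coeff t A w z - weyl_coeff t A w' z) = c * norm (LINT x|lborel. coef z x * cnj (k w x - k w' x))"
    using c by (simp add: norm_mult)
  also have "norm (LINT x|lborel. coef z x * cnj (k w x - k w' x)) \<le> (LINT x|lborel. norm (coef z x * cnj (k w x - k w' x)))"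
    by (rule integral_norm_bound)
  also have "\<dots> \<le> (LINT x|lborel. B * gauss (8 * t) (x - z))"
  proof (intro integral_mono integrable_norm integrable_mult_right G)
    show "integrable lborel (\<lambda>x. coef z x * cnj (k w x - k w' x))"
      using i[OF w(1)] i[OF w(2)] by (simp add: right_diff_distrib)
    fix x
    have "norm (coef z x) * norm (k w x - k w' x)
        \<le> coef_const * (kernel_lip t R * norm (w - w') * gauss (8 * t) (x - z))"
      unfolding k_def using coef_const_pos by (intro mult_mono norm_coef_le norm_weyl_kernel_diff_le w) auto
    then show "norm (coef z x * cnj (k w x - k w' x)) \<le> B * gauss (8 * t) (x - z)"
      by (simp only: norm_mult complex_mod_cnj B_def mult.assoc)
  qed
  also have "\<dots> = B * (pi * (8 * t)) ^ CARD('n)"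
    using lborel_translate(1)[of "\<lambda>x::complex^'n. gauss (8 * t) x" "- z"]
      integrable_gauss(2)[of "8 * t", where 'n='n] t by simp
  finally have "norm (weyl_coeff t A w z - weyl_coeff t A w' z) \<le> c * (B * (pi * (8 * t)) ^ CARD('n))"
    using c by (simp add: mult_left_mono)
  also have "c * (B * (pi * (8 * t)) ^ CARD('n)) = 8 ^ CARD('n) * B"
    using t by (simp add: c_def power_mult_distrib)
  finally show ?thesis by (simp add: B_def)
qed

text \<open>An explicit candidate for the weak integral: \<open>weighted t f z\<close> stands for
  the pairing of \<open>f\<close> with \<open>k_z\<close>, and the integral is taken separately for
  each argument \<open>x\<close>.\<close>

definition avg_op :: "complex^'n \<Rightarrow> 'n cop" where
  "avg_op w f x = (LINT z|lborel. coef z (z + w) * weighted t f z * fock_kernel t (z + w) x)"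

lemma integrable_avg:
  assumes f: "f \<in> fock_space t p"
  shows "integrable lborel (\<lambda>z. coef z (z + w) * (weighted t f z * kern t (z + w) x))"
    and "integrable lborel (\<lambda>z. coef z (z + w) * weighted t f z * fock_kernel t (z + w) x)"
proof -
  note [measurable] = measurable_weighted[OF fock_space_measurable[OF f], of t]
  show 1: "integrable lborel (\<lambda>z. coef z (z + w) * (weighted t f z * kern t (z + w) x))"
  proof (rule Bochner_Integration.integrable_bound)
    show "integrable lborel (\<lambda>z. coef_const * (norm (weighted t f z) * gauss (2 * t) (x - w - z)))"
      using t by (intro integrable_mult_right integrable_weighted_gauss[OF t p _ f]) simp
    show "AE z in lborel. norm (coef z (z + w) * (weighted t f z * kern t (z + w) x))
        \<le> norm (coef_const * (norm (weighted t f z) * gauss (2 * t) (x - w - z)))" (is "AE z in _. ?P z")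
    proof (rule AE_I2)
      fix z
      have xe: "x - w - z = x - (z + w)" by simp
      show "?P z"
        unfolding xe using coef_const_pos norm_coef_le by (simp add: norm_mult norm_weighted_fock_kernel[OF t] mult_right_mono)
    qed
  qed measurable
  define e where "e = complex_of_real (gauss (2 * t) x)"
  have e: "e \<noteq> 0" by (simp add: e_def)
  have "coef z (z + w) * weighted t f z * fock_kernel t (z + w) x
      = (1 / e) * (coef z (z + w) * (weighted t f z * kern t (z + w) x))" for z
    using e by (simp add: weighted_def[of t "fock_kernel t (z + w)"] e_def[symmetric])
  then show "integrable lborel (\<lambda>z. coef z (z + w) * weighted t f z * fock_kernel t (z + w) x)"
    using integrable_mult_right[OF 1, of "1 / e"] by simp
qed

lemma weighted_avg_op:
  "weighted t (avg_op w f) x = (LINT z|lborel. coef z (z + w) * (weighted t f z * kern t (z + w) x))"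
proof -
  define e where "e = complex_of_real (gauss (2 * t) x)"
  have wk: "kern t (z + w) x = e * fock_kernel t (z + w) x" for z
    by (simp only: weighted_def e_def)
  have eq: "coef z (z + w) * (weighted t f z * kern t (z + w) x)
      = e * (coef z (z + w) * weighted t f z * fock_kernel t (z + w) x)" for z
    unfolding wk by (simp only: mult_ac)
  show ?thesis unfolding eq by (simp add: weighted_def[of t "avg_op w f"] e_def[symmetric] avg_op_def)
qed

text \<open>In this form both factors that depend on \<open>w\<close> are Lipschitz in
  \<open>w\<close> with constants free of \<open>z\<close>.\<close>

lemma weighted_avg_op_weyl:
  "weighted t (avg_op w f) x = (LINT z|lborel. weyl_coeff t A w z * (weighted t f z * wkern z w x))"
  unfolding weighted_avg_op weyl_coeff_times_weyl_kernel ..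

lemma entire_avg_op:
  assumes f: "f \<in> fock_space t p"
  shows "entire_cn (avg_op w f)"
  unfolding avg_op_def[abs_def]
proof (rule entire_cn_superposition[OF t])
  note [measurable] = measurable_weighted[OF fock_space_measurable[OF f], of t]
  show "(\<lambda>z. coef z (z + w) * weighted t f z) \<in> borel_measurable lborel" "(\<lambda>z. z + w) \<in> borel_measurable lborel"
    by measurable
  show "integrable lborel (\<lambda>z. norm (coef z (z + w) * weighted t f z) * gauss (4 * t) (z + w))"
  proof (rule Bochner_Integration.integrable_bound)
    show "integrable lborel (\<lambda>z. coef_const * (norm (weighted t f z) * gauss (4 * t) (- w - z)))"
      using t by (intro integrable_mult_right integrable_weighted_gauss[OF t p _ f]) simp
    show "AE z in lborel. norm (norm (coef z (z + w) * weighted t f z) * gauss (4 * t) (z + w))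
        \<le> norm (coef_const * (norm (weighted t f z) * gauss (4 * t) (- w - z)))" (is "AE z in _. ?P z")
    proof (rule AE_I2)
      fix z
      have "- w - z = - (z + w)" by simp
      then have "norm (- w - z) = norm (z + w)" by (simp only: norm_minus_cancel)
      then show "?P z"
        using coef_const_pos norm_coef_le by (simp add: norm_mult mult.assoc[symmetric] mult_right_mono)
    qed
  qed measurable
qed

lemma integrable_gauss_conv:
  assumes f: "f \<in> fock_space t p"
  shows "integrable lborel (\<lambda>z. norm (weighted t f z) * gauss (8 * t) (x - z))"
  using t by (intro integrable_weighted_gauss[OF t p _ f]) simp

lemma integrable_avg_weyl:
  assumes f: "f \<in> fock_space t p"
  shows "integrable lborel (\<lambda>z. weyl_coeff t A w z * (weighted t f z * wkern z w x))"
  unfolding weyl_coeff_times_weyl_kernel by (rule integrable_avg[OF f])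

text \<open>The two summands come from the product rule: variation of the coefficient times the size
  of the kernel, and size of the coefficient times the variation of the kernel. The second also
  bounds the operator itself.\<close>

definition avg_const :: "real \<Rightarrow> real" where
  "avg_const R = coef_const * kernel_lip t R * (8 ^ CARD('n) * kernel_lip t R + 1)"

lemma avg_const_pos: "0 \<le> R \<Longrightarrow> 0 < avg_const R"
  unfolding avg_const_def using coef_const_pos kernel_lip_pos[OF t, of R]
  by (intro mult_pos_pos add_nonneg_pos) auto

lemma norm_avg_op_le:
  assumes f: "f \<in> fock_space t p" and w: "norm w \<le> R"
  shows "norm (weighted t (avg_op w f) x) \<le> avg_const R * gauss_conv t f x"
proof -
  have R: "0 \<le> R" using w norm_ge_zero[of w] by linarith
  note L = kernel_lip_pos[OF t R]
  have "norm (weighted t (avg_op w f) x)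
      \<le> (LINT z|lborel. norm (weyl_coeff t A w z * (weighted t f z * wkern z w x)))"
    unfolding weighted_avg_op_weyl by (rule integral_norm_bound)
  also have "\<dots> \<le> (LINT z|lborel. avg_const R * (norm (weighted t f z) * gauss (8 * t) (x - z)))"
  proof (intro integral_mono integrable_norm integrable_mult_right integrable_avg_weyl[OF f] integrable_gauss_conv[OF f])
    fix z
    have "norm (weyl_coeff t A w z) * (norm (weighted t f z) * norm (wkern z w x))
        \<le> coef_const * (norm (weighted t f z) * (kernel_lip t R * gauss (8 * t) (x - z)))"
      using coef_const_pos
      by (intro mult_mono mult_nonneg_nonneg norm_weyl_coeff_le norm_weyl_kernel_le w order_refl) auto
    also have "\<dots> = (coef_const * kernel_lip t R) * (norm (weighted t f z) * gauss (8 * t) (x - z))"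
      by (simp only: mult_ac)
    also have "\<dots> \<le> avg_const R * (norm (weighted t f z) * gauss (8 * t) (x - z))"
      unfolding avg_const_def using coef_const_pos L
        mult_left_mono[of 1 "8 ^ CARD('n) * kernel_lip t R + 1" "coef_const * kernel_lip t R"]
      by (intro mult_right_mono) auto
    finally show "norm (weyl_coeff t A w z * (weighted t f z * wkern z w x))
        \<le> avg_const R * (norm (weighted t f z) * gauss (8 * t) (x - z))"
      by (simp only: norm_mult)
  qed
  finally show ?thesis by (simp add: gauss_conv_def)
qed

lemma norm_avg_op_diff_le:
  assumes f: "f \<in> fock_space t p" and w: "norm w \<le> R" "norm w' \<le> R"
  shows "norm (weighted t (avg_op w f) x - weighted t (avg_op w' f) x) \<le> avg_const R * norm (w - w') * gauss_conv t f x"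
proof -
  have R: "0 \<le> R" using w(1) norm_ge_zero[of w] by linarith
  note L = kernel_lip_pos[OF t R]
  define k where "k w z = wkern z w x" for w z
  define b where "b w z = weyl_coeff t A w z" for w z
  define g where "g z = gauss (8 * t) (x - z)" for z
  note i = integrable_avg_weyl[OF f, of _ x, folded k_def b_def]
  have "norm (weighted t (avg_op w f) x - weighted t (avg_op w' f) x)
      = norm (LINT z|lborel. b w z * (weighted t f z * k w z) - b w' z * (weighted t f z * k w' z))"
    unfolding weighted_avg_op_weyl using i[of w] i[of w'] by (simp add: k_def b_def)
  also have "\<dots> \<le> (LINT z|lborel. norm (b w z * (weighted t f z * k w z) - b w' z * (weighted t f z * k w' z)))"
    by (rule integral_norm_bound)
  also have "\<dots> \<le> (LINT z|lborel. avg_const R * norm (w - w') * (norm (weighted t f z) * gauss (8 * t) (x - z)))"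
  proof (intro integral_mono integrable_norm integrable_mult_right Bochner_Integration.integrable_diff i integrable_gauss_conv[OF f])
    fix z
    \<comment> \<open>The product rule for differences, with the common factor
      \<open>weighted t f z\<close> left out.\<close>
    have "norm ((b w z - b w' z) * k w z + b w' z * (k w z - k w' z))
        \<le> (8 ^ CARD('n) * (coef_const * (kernel_lip t R * norm (w - w')))) * (kernel_lip t R * g z)
          + coef_const * (kernel_lip t R * norm (w - w') * g z)"
      unfolding b_def k_def g_def
      using coef_const_pos L
      by (intro norm_triangle_le add_mono, unfold norm_mult)
         (intro mult_mono norm_weyl_coeff_diff_le norm_weyl_kernel_le norm_weyl_kernel_diff_le
            norm_weyl_coeff_le w, auto)+
    also have "\<dots> = avg_const R * norm (w - w') * g z"
      by (simp add: avg_const_def algebra_simps)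
    finally have "norm (weighted t f z) * norm ((b w z - b w' z) * k w z + b w' z * (k w z - k w' z))
        \<le> norm (weighted t f z) * (avg_const R * norm (w - w') * g z)"
      by (intro mult_left_mono) auto
    also have "norm (weighted t f z) * norm ((b w z - b w' z) * k w z + b w' z * (k w z - k w' z))
        = norm (b w z * (weighted t f z * k w z) - b w' z * (weighted t f z * k w' z))"
      unfolding norm_mult[symmetric] by (rule arg_cong[of _ _ norm]) (simp add: algebra_simps)
    finally show "norm (b w z * (weighted t f z * k w z) - b w' z * (weighted t f z * k w' z))
        \<le> avg_const R * norm (w - w') * (norm (weighted t f z) * gauss (8 * t) (x - z))"
      unfolding g_def by (simp only: mult_ac)
  qed
  finally show ?thesis by (simp add: gauss_conv_def)
qed

end

section \<open>Auxiliary inequalities and partitions of a ball\<close>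

text \<open>Young's inequality with its factors raised to 1; it makes products of functions from
  dual Fock spaces integrable.\<close>

lemma mult_le_powr_conj:
  fixes a b :: real
  assumes p: "1 < p" and "0 \<le> a" "0 \<le> b"
  shows "a * b \<le> a powr p + b powr conj_exponent p"
proof -
  have q: "1 < conj_exponent p" using p by (simp add: conj_exponent_def)
  have "a * b \<le> a powr p / p + b powr conj_exponent p / conj_exponent p"
    by (rule Youngs_inequality[OF p q conj_exponent[OF p] assms(2,3)])
  also have "\<dots> \<le> a powr p / 1 + b powr conj_exponent p / 1"
    using p q by (intro add_mono frac_le) auto
  finally show ?thesis by simp
qed

text \<open>Estimates for differences may have constant 0, for instance when \<open>w = w'\<close>.
  Then \<open>g\<close> vanishes identically and Schur's test is avoided.\<close>

lemma fock_norm_gauss_conv_le: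
  fixes f g :: "'n::finite cfun"
  assumes t: "0 < t" and p: "1 < p" and f: "f \<in> fock_space t p" and g: "entire_cn g" and B: "0 \<le> B"
    and le: "\<And>x. norm (weighted t g x) \<le> B * gauss_conv t f x"
  shows "fock_norm t p g \<le> B * (pi * (8 * t)) ^ CARD('n) * fock_norm t p f"
proof (cases "B = 0")
  case True
  then have "g = (\<lambda>x. 0)" using le by (simp add: weighted_zero_iff fun_eq_iff)
  then show ?thesis using True by (simp add: fock_norm_zero)
next
  case False
  then show ?thesis using fock_norm_gauss_conv(2)[OF t p f g _ le] B by simp
qed

text \<open>A finite cover by small balls, made disjoint by giving each point to the first ball that
  contains it. Unique existence of \<open>i\<close> expresses covering and disjointness at once. The
  centres \<open>c i\<close> are not claimed to lie in the large ball.\<close>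

lemma ball_partition:
  fixes r e :: real
  assumes e: "0 < e"
  shows "\<exists>m c E. (\<forall>i<m. E i \<in> sets borel \<and> E i \<subseteq> ball (0::'a::euclidean_space) r \<and> E i \<subseteq> ball (c i) e) \<and>
    (\<forall>w\<in>ball 0 r. \<exists>!i. i < (m::nat) \<and> w \<in> E i)"
proof -
  have "compact (cball (0::'a) r)" by simp
  then obtain k where k: "finite k" "cball 0 r \<subseteq> (\<Union>x\<in>k. ball (x::'a) e)"
    using e unfolding compact_eq_totally_bounded by blast
  then obtain xs where xs: "set xs = k" using finite_list by blast
  define E where "E i = (ball (xs ! i) e \<inter> ball 0 r) - (\<Union>j<i. ball (xs ! j) e)" for i
  have "\<exists>!i. i < length xs \<and> w \<in> E i" if w: "w \<in> ball 0 r" for w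
  proof -
    have ex: "\<exists>i. i < length xs \<and> w \<in> ball (xs ! i) e"
      using k(2) w xs by (force simp: in_set_conv_nth)
    define i where "i = (LEAST i. i < length xs \<and> w \<in> ball (xs ! i) e)"
    have i: "i < length xs" "w \<in> ball (xs ! i) e" using LeastI_ex[OF ex] by (auto simp: i_def)
    have "w \<notin> ball (xs ! j) e" if "j < i" for j
      using not_less_Least[of j "\<lambda>i. i < length xs \<and> w \<in> ball (xs ! i) e"] that i unfolding i_def by auto
    then have "w \<in> E i" using i w by (auto simp: E_def)
    moreover have "j = i" if "j < length xs" "w \<in> E j" for j
    proof (rule antisym)
      show "j \<le> i" using that(2) i(2) by (auto simp: E_def not_less[symmetric])
      show "i \<le> j" unfolding i_def using that by (intro Least_le) (auto simp: E_def)
    qed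
    ultimately show ?thesis using i by blast
  qed
  then show ?thesis
    by (intro exI[of _ "length xs"] exI[of _ "\<lambda>i. xs ! i"] exI[of _ E]) (auto simp: E_def)
qed

section \<open>The averaged operators as weak integrals\<close>

context bounded_fock_operator
begin

lemma avg_op_add:
  assumes f: "f \<in> fock_space t p" and g: "g \<in> fock_space t p"
  shows "avg_op w (\<lambda>z. f z + g z) x = avg_op w f x + avg_op w g x"
  unfolding avg_op_def weighted_add
  using integrable_avg(2)[OF f, of w x] integrable_avg(2)[OF g, of w x] by (simp add: algebra_simps)

lemma avg_op_cmult: "avg_op w (\<lambda>z. c * f z) x = c * avg_op w f x"
proof -
  have eq: "coef z (z + w) * (c * weighted t f z) * fock_kernel t (z + w) x
      = c * (coef z (z + w) * weighted t f z * fock_kernel t (z + w) x)" for z by (simp only: mult_ac)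
  show ?thesis unfolding avg_op_def weighted_cmult eq by simp
qed

lemma fock_bounded_avg_op: "bdd_op (avg_op w)"
  unfolding fock_bounded_op_def
proof (intro conjI ballI allI exI)
  fix f :: "'n cfun" assume f: "f \<in> fock_space t p"
  note * = fock_norm_gauss_conv[OF t p f entire_avg_op[OF f] avg_const_pos[OF norm_ge_zero] norm_avg_op_le[OF f order_refl], of w]
  show "avg_op w f \<in> fock_space t p" by (rule *)
  show "fock_norm t p (avg_op w f) \<le> avg_const (norm w) * (pi * (8 * t)) ^ CARD('n) * fock_norm t p f"
    by (rule *)
  show "avg_op w (\<lambda>z. c * f z) = (\<lambda>z. c * avg_op w f z)" for c by (rule ext) (rule avg_op_cmult)
  show "avg_op w (\<lambda>z. f z + g z) = (\<lambda>z. avg_op w f z + avg_op w g z)" if "g \<in> fock_space t p" for g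
    by (rule ext) (rule avg_op_add[OF f that])
qed

text \<open>Pairing the candidate with \<open>g\<close> gives a double integral over
  \<open>x\<close> and \<open>z\<close>. After exchanging the order, the integral over
  \<open>x\<close> pairs \<open>k_(z+w)\<close> with \<open>g\<close>, which the reproducing formula
  in the dual space evaluates.\<close>

lemma has_op_integral_avg_op:
  "has_op_integral t p (kernel_coeff t A w) (\<lambda>z. fock_kernel t (z + w)) (\<lambda>z. fock_kernel t z) (avg_op w)"
  unfolding has_op_integral_def
proof (intro conjI ballI fock_bounded_avg_op)
  define q where "q = conj_exponent p"
  have q: "1 < q" using p by (simp add: q_def conj_exponent_def)
  fix f g :: "'n cfun" assume f: "f \<in> fock_space t p" and "g \<in> fock_space t (conj_exponent p)"
  then have g: "g \<in> fock_space t q" by (simp add: q_def)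
  note [measurable] = measurable_weighted[OF fock_space_measurable[OF f], of t]
    measurable_weighted[OF fock_space_measurable[OF g], of t]
  define F where "F z = norm (weighted t f z) powr p" for z
  define G where "G x = norm (weighted t g x) powr q" for x
  have [measurable]: "F \<in> borel_measurable borel" "G \<in> borel_measurable borel"
    unfolding F_def G_def by measurable
  have FG0: "0 \<le> F z" "0 \<le> G z" for z by (auto simp: F_def G_def)
  have FG: "integrable lborel F" "integrable lborel G"
    using f g t p q by (auto simp: fock_space_iff F_def[abs_def] G_def[abs_def])
  have young: "norm (coef z (z + w)) * (norm (weighted t f z) * norm (weighted t g x)) \<le> coef_const * (F z + G x)" for z x
    unfolding F_def G_def q_def using coef_const_pos
    by (intro mult_mono norm_coef_le mult_le_powr_conj p) auto
  have eq: "kernel_coeff t A w u * fock_pairing t f (fock_kernel t u) * fock_pairing t (fock_kernel t (u + w)) g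
      = coef u (u + w) * weighted t f u * cnj (weighted t g (u + w))" for u
    by (simp add: kernel_coeff_eq fock_reproducing(1)[OF t p f] fock_reproducing(2)[OF t q g])
  show "integrable lborel (\<lambda>u. kernel_coeff t A w u * fock_pairing t f (fock_kernel t u) * fock_pairing t (fock_kernel t (u + w)) g)"
    unfolding eq
  proof (rule Bochner_Integration.integrable_bound)
    have "integrable lborel (\<lambda>u. G (w + u))" using lborel_translate(2)[of G w] FG(2) by simp
    then show "integrable lborel (\<lambda>u. coef_const * (F u + G (u + w)))"
      using FG(1) by (simp add: add.commute)
    show "AE u in lborel. norm (coef u (u + w) * weighted t f u * cnj (weighted t g (u + w))) \<le> norm (coef_const * (F u + G (u + w)))" (is "AE u in _. ?P u")
    proof (rule AE_I2)
      fix u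
      show "?P u"
        using young[of u "u + w"] FG0 coef_const_pos by (simp add: norm_mult mult.assoc)
    qed
  qed measurable
  define \<Phi> where "\<Phi> x z = coef z (z + w) * (weighted t f z * kern t (z + w) x) * cnj (weighted t g x)" for x z
  have int: "integrable (lborel \<Otimes>\<^sub>M lborel) (\<lambda>(x, z). \<Phi> x z)"
  proof (rule integrableI_bounded)
    show "(\<lambda>(x, z). \<Phi> x z) \<in> borel_measurable (lborel \<Otimes>\<^sub>M lborel)"
      unfolding \<Phi>_def by measurable
    define E where "E = (\<lambda>(x, z). gauss (2 * t) (x - (z + w)))"
    have E[measurable]: "E \<in> borel_measurable (borel \<Otimes>\<^sub>M borel)" unfolding E_def by measurable
    define c where "c = ennreal ((pi * (2 * t)) ^ CARD('n))"
    have Ex: "(\<integral>\<^sup>+x. ennreal (E (x, z)) \<partial>lborel) = c" for z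
      using t nn_integral_gauss_translate(2)[of "2 * t" "z + w"] by (simp add: E_def c_def)
    have Ez: "(\<integral>\<^sup>+z. ennreal (E (x, z)) \<partial>lborel) = c" for x
      using t nn_integral_gauss_translate(1)[of "2 * t" "x - w"] by (simp add: E_def c_def algebra_simps)
    \<comment> \<open>Young splits the two functions, and the Gaussian \<open>E\<close> is left to
      make each summand integrable in the variable that its function does not contain.\<close>
    have "(\<integral>\<^sup>+y. ennreal (norm (case y of (x, z) \<Rightarrow> \<Phi> x z)) \<partial>(lborel \<Otimes>\<^sub>M lborel))
        \<le> (\<integral>\<^sup>+y. ennreal coef_const * (ennreal (F (snd y)) * ennreal (E y)) + ennreal coef_const * (ennreal (G (fst y)) * ennreal (E y)) \<partial>(lborel \<Otimes>\<^sub>M lborel))"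
    proof (intro nn_integral_mono)
      fix y :: "(complex^'n) \<times> (complex^'n)"
      obtain x z where y: "y = (x, z)" by (cases y)
      have E0: "0 \<le> E (x, z)" by (simp add: E_def)
      have "norm (\<Phi> x z) = (norm (coef z (z + w)) * (norm (weighted t f z) * norm (weighted t g x))) * E (x, z)"
        by (simp add: \<Phi>_def norm_mult norm_weighted_fock_kernel[OF t] E_def)
      also have "\<dots> \<le> coef_const * (F z + G x) * E (x, z)"
        by (intro mult_right_mono young E0)
      finally have "ennreal (norm (\<Phi> x z)) \<le> ennreal (coef_const * (F z * E (x, z)) + coef_const * (G x * E (x, z)))"
        by (intro ennreal_leI) (simp add: algebra_simps)
      also have "\<dots> = ennreal coef_const * (ennreal (F z) * ennreal (E (x, z))) + ennreal coef_const * (ennreal (G x) * ennreal (E (x, z)))"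
        using E0 FG0 coef_const_pos by (simp add: ennreal_mult ennreal_plus)
      finally show "ennreal (norm (case y of (x, z) \<Rightarrow> \<Phi> x z))
          \<le> ennreal coef_const * (ennreal (F (snd y)) * ennreal (E y)) + ennreal coef_const * (ennreal (G (fst y)) * ennreal (E y))"
        by (simp add: y)
    qed
    also have "\<dots> = ennreal coef_const * (\<integral>\<^sup>+y. ennreal (F (snd y)) * ennreal (E y) \<partial>(lborel \<Otimes>\<^sub>M lborel))
        + ennreal coef_const * (\<integral>\<^sup>+y. ennreal (G (fst y)) * ennreal (E y) \<partial>(lborel \<Otimes>\<^sub>M lborel))"
      by (subst nn_integral_add, measurable, subst (1 2) nn_integral_cmult, measurable)
    also have "(\<integral>\<^sup>+y. ennreal (F (snd y)) * ennreal (E y) \<partial>(lborel \<Otimes>\<^sub>M lborel))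
        = (\<integral>\<^sup>+z. (\<integral>\<^sup>+x. ennreal (F z) * ennreal (E (x, z)) \<partial>lborel) \<partial>lborel)"
      by (subst lborel_pair.nn_integral_snd[symmetric]) auto
    also have "\<dots> = (\<integral>\<^sup>+z. ennreal (F z) \<partial>lborel) * c"
      by (simp add: nn_integral_cmult nn_integral_multc Ex)
    also have "(\<integral>\<^sup>+y. ennreal (G (fst y)) * ennreal (E y) \<partial>(lborel \<Otimes>\<^sub>M lborel))
        = (\<integral>\<^sup>+x. (\<integral>\<^sup>+z. ennreal (G x) * ennreal (E (x, z)) \<partial>lborel) \<partial>lborel)"
      by (subst lborel.nn_integral_fst[symmetric]) auto
    also have "\<dots> = (\<integral>\<^sup>+x. ennreal (G x) \<partial>lborel) * c"
      by (simp add: nn_integral_cmult nn_integral_multc Ez)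
    also have "ennreal coef_const * ((\<integral>\<^sup>+z. ennreal (F z) \<partial>lborel) * c) + ennreal coef_const * ((\<integral>\<^sup>+x. ennreal (G x) \<partial>lborel) * c) < \<infinity>"
      using nn_integral_eq_integral[OF FG(1)] nn_integral_eq_integral[OF FG(2)] FG0
      by (simp add: c_def ennreal_mult_less_top)
    finally show "(\<integral>\<^sup>+y. ennreal (norm (case y of (x, z) \<Rightarrow> \<Phi> x z)) \<partial>(lborel \<Otimes>\<^sub>M lborel)) < \<infinity>" .
  qed
  define c where "c = complex_of_real (1 / (pi * t) ^ CARD('n))"
  have "fock_pairing t (avg_op w f) g = c * (LINT x|lborel. weighted t (avg_op w f) x * cnj (weighted t g x))"
    unfolding c_def
    by (intro fock_pairing_eq t entire_cn_measurable entire_avg_op[OF f] fock_space_measurable[OF g])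
  also have "(\<lambda>x. weighted t (avg_op w f) x * cnj (weighted t g x)) = (\<lambda>x. LINT z|lborel. \<Phi> x z)"
    unfolding weighted_avg_op \<Phi>_def by simp
  also have "(LINT x|lborel. (LINT z|lborel. \<Phi> x z)) = (LINT z|lborel. (LINT x|lborel. \<Phi> x z))"
    by (rule lborel_pair.Fubini_integral[OF int, symmetric])
  also have "c * \<dots> = (LINT z|lborel. c * (LINT x|lborel. \<Phi> x z))"
    by simp
  also have "(\<lambda>z. c * (LINT x|lborel. \<Phi> x z)) = (\<lambda>z. coef z (z + w) * weighted t f z * cnj (weighted t g (z + w)))"
  proof
    fix z
    have "c * (LINT x|lborel. \<Phi> x z)
        = c * (LINT x|lborel. (coef z (z + w) * weighted t f z) * (kern t (z + w) x * cnj (weighted t g x)))"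
      unfolding \<Phi>_def by (simp only: mult_ac)
    also have "\<dots> = (coef z (z + w) * weighted t f z) * (c * (LINT x|lborel. kern t (z + w) x * cnj (weighted t g x)))"
      unfolding integral_mult_right_zero by (simp only: mult_ac)
    also have "c * (LINT x|lborel. kern t (z + w) x * cnj (weighted t g x)) = fock_pairing t (fock_kernel t (z + w)) g"
      unfolding c_def
      by (intro fock_pairing_eq[symmetric] t entire_cn_measurable entire_cn_fock_kernel fock_space_measurable[OF g])
    also have "\<dots> = cnj (weighted t g (z + w))" by (rule fock_reproducing(2)[OF t q g])
    finally show "c * (LINT x|lborel. \<Phi> x z) = coef z (z + w) * weighted t f z * cnj (weighted t g (z + w))" .
  qed
  finally show "fock_pairing t (avg_op w f) g = (LINT u|lborel. kernel_coeff t A w u * fock_pairing t f (fock_kernel t u) *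
      fock_pairing t (fock_kernel t (u + w)) g)"
    unfolding eq .
qed

lemma has_op_integral_kernel_integral:
  "has_op_integral t p (kernel_coeff t A w) (\<lambda>z. fock_kernel t (z + w)) (\<lambda>z. fock_kernel t z) (Kint w)"
  unfolding kernel_integral_def by (rule op_integral_works[OF has_op_integral_avg_op])

lemma fock_bounded_kernel_integral: "bdd_op (Kint w)"
  using has_op_integral_kernel_integral by (simp add: has_op_integral_def)

lemma kernel_integral_eq: "f \<in> fock_space t p \<Longrightarrow> Kint w f = avg_op w f"
  by (rule has_op_integral_unique[OF t p has_op_integral_kernel_integral has_op_integral_avg_op])

section \<open>Lipschitz continuity and boundedness in operator norm\<close>

text \<open>The pointwise estimate by \<open>gauss_conv\<close> is turned into a norm estimate by
  Schur's test; \<open>(8 * pi * t) ^ n\<close> is the mass of the Gaussian.\<close>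

lemma opnorm_kernel_integral_diff_le:
  assumes w: "norm w \<le> R" "norm w' \<le> R"
  shows "opnorm (Kint w - Kint w')
    \<le> avg_const R * (pi * (8 * t)) ^ CARD('n) * norm (w - w')"
proof (rule fock_opnorm_le)
  have R: "0 \<le> R" using w(1) norm_ge_zero[of w] by linarith
  note c = avg_const_pos[OF R]
  show "0 \<le> avg_const R * (pi * (8 * t)) ^ CARD('n) * norm (w - w')" using c t by simp
  fix f :: "'n cfun" assume f: "f \<in> fock_space t p"
  have "fock_norm t p (\<lambda>x. avg_op w f x - avg_op w' f x)
      \<le> avg_const R * norm (w - w') * (pi * (8 * t)) ^ CARD('n) * fock_norm t p f"
  proof (rule fock_norm_gauss_conv_le[OF t p f])
    show "entire_cn (\<lambda>x. avg_op w f x - avg_op w' f x)"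
      using fock_space_entire[OF fock_space_diff[OF t p fock_bounded_opD(1)[OF fock_bounded_avg_op f] fock_bounded_opD(1)[OF fock_bounded_avg_op f]]] .
    show "norm (weighted t (\<lambda>x. avg_op w f x - avg_op w' f x) x) \<le> avg_const R * norm (w - w') * gauss_conv t f x" for x
      unfolding weighted_diff by (rule norm_avg_op_diff_le[OF f w])
  qed (use c in auto)
  then show "fock_norm t p ((Kint w - Kint w') f)
      \<le> avg_const R * (pi * (8 * t)) ^ CARD('n) * norm (w - w') * fock_norm t p f"
    by (simp add: fun_diff_def kernel_integral_eq[OF f] mult_ac)
qed

lemma opnorm_kernel_integral_le:
  assumes w: "norm w \<le> R"
  shows "opnorm (Kint w) \<le> avg_const R * (pi * (8 * t)) ^ CARD('n)"
proof (rule fock_opnorm_le)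
  have R: "0 \<le> R" using w(1) norm_ge_zero[of w] by linarith
  note c = avg_const_pos[OF R]
  show "0 \<le> avg_const R * (pi * (8 * t)) ^ CARD('n)" using c t by simp
  fix f :: "'n cfun" assume f: "f \<in> fock_space t p"
  show "fock_norm t p (Kint w f) \<le> avg_const R * (pi * (8 * t)) ^ CARD('n) * fock_norm t p f"
    unfolding kernel_integral_eq[OF f]
    by (rule fock_norm_gauss_conv(2)[OF t p f entire_avg_op[OF f] c norm_avg_op_le[OF f w]])
qed


section \<open>The Bochner integral over a ball\<close>

text \<open>The candidate for the Bochner integral, again formed as a scalar integral for each
  \<open>x\<close>, so that no completeness of the space of operators enters.\<close>

definition ball_op :: "real \<Rightarrow> 'n cop" where
  "ball_op r f x = (LINT w|lborel. indicator (ball 0 r) w *\<^sub>R avg_op w f x)"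

text \<open>The ball has finite volume and \<open>weighted t f\<close> is bounded, so Tonelli
  suffices. The width \<open>s\<close> is \<open>2 * t\<close> for exchanging integrals and
  \<open>4 * t\<close> for analyticity.\<close>

lemma integrable_ball_gauss:
  fixes f :: "'n cfun"
  assumes f: "f \<in> fock_space t p" and s: "0 < s"
  shows "integrable (lborel \<Otimes>\<^sub>M lborel)
    (\<lambda>(w, z). indicator (ball 0 r) w * (norm (weighted t f z) * gauss s (x - (z + w))))" (is "integrable _ (\<lambda>(w, z). ?H w z)")
proof (rule integrableI_bounded)
  define J where "J = (indicator (ball 0 r) :: complex^'n \<Rightarrow> real)"
  have [measurable]: "J \<in> borel_measurable borel" unfolding J_def by (intro borel_measurable_indicator) auto
  note [measurable] = measurable_weighted[OF fock_space_measurable[OF f], of t]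
  show "(\<lambda>(w, z). ?H w z)
      \<in> borel_measurable (lborel \<Otimes>\<^sub>M lborel)"
    unfolding J_def[symmetric] by measurable
  define C where "C = fock_sup_const t p TYPE('n) * fock_norm t p f"
  let ?C = "\<lambda>w z. ennreal (C * gauss s (x - (z + w)))"
    and ?J = "\<lambda>w::complex^'n. ennreal (indicator (ball 0 r) w)"
  have C: "norm (weighted t f z) \<le> C" for z unfolding C_def by (rule norm_weighted_le_fock_norm[OF t p f])
  have C0: "0 \<le> C" using C[of 0] norm_ge_zero order_trans by blast
  have [measurable]: "(\<lambda>(w, z). ?J w * ?C w z)
      \<in> borel_measurable (lborel \<Otimes>\<^sub>M lborel)" unfolding J_def[symmetric] by measurable
  have G: "(\<integral>\<^sup>+z. ?C w z \<partial>lborel) = ennreal (C * (pi * s) ^ CARD('n))" for w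
    using C0 s nn_integral_gauss_translate(1)[OF s, of "x - w"]
    by (simp add: ennreal_mult nn_integral_cmult algebra_simps)
  have "(\<integral>\<^sup>+y. ennreal (norm (case y of (w, z) \<Rightarrow> ?H w z)) \<partial>(lborel \<Otimes>\<^sub>M lborel))
      \<le> (\<integral>\<^sup>+y. (case y of (w, z) \<Rightarrow> ?J w * ?C w z) \<partial>(lborel \<Otimes>\<^sub>M lborel))"
    by (intro nn_integral_mono)
       (auto simp: ennreal_mult[symmetric] C0 split: split_indicator intro!: ennreal_leI mult_right_mono C)
  also have "\<dots> = (\<integral>\<^sup>+w. (\<integral>\<^sup>+z. ?J w * ?C w z \<partial>lborel) \<partial>lborel)"
    by (subst lborel.nn_integral_fst[symmetric]) auto
  also have "\<dots> = (\<integral>\<^sup>+w. ?J w * ennreal (C * (pi * s) ^ CARD('n)) \<partial>lborel)"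
  proof (intro nn_integral_cong)
    fix w
    show "(\<integral>\<^sup>+z. ?J w * ?C w z \<partial>lborel)
        = ?J w * ennreal (C * (pi * s) ^ CARD('n))"
      unfolding G[of w, symmetric] by (intro nn_integral_cmult) measurable
  qed
  also have "\<dots> = emeasure lborel (ball (0::complex^'n) r) * ennreal (C * (pi * s) ^ CARD('n))"
    by (subst nn_integral_multc) (auto simp: ennreal_indicator intro!: borel_measurable_indicator)
  also have "\<dots> < \<infinity>"
    using emeasure_bounded_finite[OF bounded_ball, of "0::complex^'n" r] by (simp add: ennreal_mult_less_top)
  finally show "(\<integral>\<^sup>+y. ennreal (norm (case y of (w, z) \<Rightarrow> ?H w z)) \<partial>(lborel \<Otimes>\<^sub>M lborel)) < \<infinity>" .
qed

lemma integrable_ball_kernel: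
  assumes f: "f \<in> fock_space t p"
  shows "integrable (lborel \<Otimes>\<^sub>M lborel)
    (\<lambda>(w, z). indicator (ball 0 r) w *\<^sub>R (coef z (z + w) * (weighted t f z * kern t (z + w) x)))"
    (is "integrable _ (\<lambda>(w, z). ?h w z)")
proof (rule Bochner_Integration.integrable_bound)
  define J where "J = (indicator (ball 0 r) :: complex^'n \<Rightarrow> real)"
  have [measurable]: "J \<in> borel_measurable borel" unfolding J_def by (intro borel_measurable_indicator) auto
  note [measurable] = measurable_weighted[OF fock_space_measurable[OF f], of t]
  show "integrable (lborel \<Otimes>\<^sub>M lborel)
      (\<lambda>y. coef_const * (case y of (w, z) \<Rightarrow> indicator (ball 0 r) w * (norm (weighted t f z) * gauss (2 * t) (x - (z + w)))))"
    using t by (intro integrable_mult_right integrable_ball_gauss[OF f]) simp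
  show "(\<lambda>(w, z). ?h w z)
      \<in> borel_measurable (lborel \<Otimes>\<^sub>M lborel)"
    unfolding J_def[symmetric] by measurable
  show "AE y in lborel \<Otimes>\<^sub>M lborel. norm (case y of (w, z) \<Rightarrow> ?h w z)
      \<le> norm (coef_const * (case y of (w, z) \<Rightarrow> indicator (ball 0 r) w * (norm (weighted t f z) * gauss (2 * t) (x - (z + w)))))"
    using coef_const_pos norm_coef_le
    by (intro AE_I2) (auto simp: norm_mult norm_weighted_fock_kernel[OF t] mult_right_mono split: split_indicator)
qed

text \<open>The form with \<open>w\<close> outside is compared with Riemann sums; the exchanged
  form, with \<open>z\<close> outside, is compared with \<open>A f\<close>.\<close>

lemma weighted_ball_op:
  assumes f: "f \<in> fock_space t p"
  shows "integrable lborel (\<lambda>w. indicator (ball 0 r) w *\<^sub>R weighted t (avg_op w f) x)"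
    and "weighted t (ball_op r f) x = (LINT w|lborel. indicator (ball 0 r) w *\<^sub>R weighted t (avg_op w f) x)"
    and "weighted t (ball_op r f) x = (LINT z|lborel. (LINT w|lborel.
      indicator (ball 0 r) w *\<^sub>R (coef z (z + w) * (weighted t f z * kern t (z + w) x))))"
    and "integrable lborel (\<lambda>z. LINT w|lborel.
      indicator (ball 0 r) w *\<^sub>R (coef z (z + w) * (weighted t f z * kern t (z + w) x)))"
proof -
  note i = integrable_ball_kernel[OF f, of r x]
  have eq: "indicator (ball 0 r) w *\<^sub>R weighted t (avg_op w f) x = (LINT z|lborel. indicator (ball 0 r) w *\<^sub>R (coef z (z + w) *
    (weighted t f z * kern t (z + w) x)))" for w
    unfolding weighted_avg_op by simp
  show 1: "integrable lborel (\<lambda>w. indicator (ball 0 r) w *\<^sub>R weighted t (avg_op w f) x)"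
    unfolding eq using lborel_pair.integrable_fst[OF i] .
  have "weighted t (ball_op r f) x = complex_of_real (gauss (2 * t) x) * (LINT w|lborel. indicator (ball 0 r) w *\<^sub>R avg_op w f x)"
    by (simp add: weighted_def ball_op_def)
  also have "\<dots> = (LINT w|lborel. indicator (ball 0 r) w *\<^sub>R weighted t (avg_op w f) x)"
    by (simp add: weighted_def flip: integral_mult_right_zero)
  finally show 2: "weighted t (ball_op r f) x = (LINT w|lborel. indicator (ball 0 r) w *\<^sub>R weighted t (avg_op w f) x)" .
  show "weighted t (ball_op r f) x = (LINT z|lborel. (LINT w|lborel.
      indicator (ball 0 r) w *\<^sub>R (coef z (z + w) * (weighted t f z * kern t (z + w) x))))"
    unfolding 2 eq by (rule lborel_pair.Fubini_integral[OF i, symmetric])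
  show "integrable lborel (\<lambda>z. LINT w|lborel.
      indicator (ball 0 r) w *\<^sub>R (coef z (z + w) * (weighted t f z * kern t (z + w) x)))"
    by (rule lborel_pair.integrable_snd[OF i])
qed

lemma integrable_ball_avg_op:
  assumes f: "f \<in> fock_space t p"
  shows "integrable lborel (\<lambda>w. indicator (ball 0 r) w *\<^sub>R avg_op w f x)"
proof -
  define e where "e = complex_of_real (gauss (2 * t) x)"
  have "e \<noteq> 0" by (simp add: e_def)
  then have eq: "indicator (ball 0 r) w *\<^sub>R avg_op w f x = (1 / e) * (indicator (ball 0 r) w *\<^sub>R weighted t (avg_op w f) x)" for w
    by (simp add: weighted_def e_def[symmetric])
  show ?thesis unfolding eq by (intro integrable_mult_right weighted_ball_op(1)[OF f])
qed

text \<open>A superposition of kernels over the product measure, with centre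
  \<open>z + w\<close>.\<close>

lemma entire_ball_op:
  assumes f: "f \<in> fock_space t p"
  shows "entire_cn (ball_op r f)"
proof -
  note [measurable] = measurable_weighted[OF fock_space_measurable[OF f], of t]
  define J where "J = (indicator (ball 0 r) :: complex^'n \<Rightarrow> real)"
  have [measurable]: "J \<in> borel_measurable borel" unfolding J_def by (intro borel_measurable_indicator) auto
  define m where "m = (\<lambda>(w, z). indicator (ball 0 r) w *\<^sub>R (coef z (z + w) * weighted t f z))"
  have "entire_cn (\<lambda>x. LINT y|(lborel \<Otimes>\<^sub>M lborel). m y * fock_kernel t (snd y + fst y) x)"
  proof (rule entire_cn_superposition[OF t])
    show "m \<in> borel_measurable (lborel \<Otimes>\<^sub>M lborel)" unfolding m_def J_def[symmetric] by measurable
    show "(\<lambda>y. snd y + fst y) \<in> borel_measurable (lborel \<Otimes>\<^sub>M lborel)" by measurable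
    show "integrable (lborel \<Otimes>\<^sub>M lborel) (\<lambda>y. norm (m y) * gauss (4 * t) (snd y + fst y))"
    proof (rule Bochner_Integration.integrable_bound)
      show "integrable (lborel \<Otimes>\<^sub>M lborel)
        (\<lambda>y. coef_const * (case y of (w, z) \<Rightarrow> indicator (ball 0 r) w * (norm (weighted t f z) * gauss (4 * t) (0 - (z + w)))))"
        using t by (intro integrable_mult_right integrable_ball_gauss[OF f]) simp
      show "(\<lambda>y. norm (m y) * gauss (4 * t) (snd y + fst y)) \<in> borel_measurable (lborel \<Otimes>\<^sub>M lborel)"
        unfolding m_def J_def[symmetric] by measurable
      show "AE y in lborel \<Otimes>\<^sub>M lborel. norm (norm (m y) * gauss (4 * t) (snd y + fst y))
        \<le> norm (coef_const * (case y of (w, z) \<Rightarrow> indicator (ball 0 r) w * (norm (weighted t f z) * gauss (4 * t) (0 - (z + w)))))"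
      proof (rule AE_I2)
        fix y :: "(complex^'n) \<times> (complex^'n)"
        obtain w z where y: "y = (w, z)" by (cases y)
        have "norm (0 - (z + w)) = norm (z + w)" by (simp only: diff_0 norm_minus_cancel)
        then show "norm (norm (m y) * gauss (4 * t) (snd y + fst y))
          \<le> norm (coef_const * (case y of (w, z) \<Rightarrow> indicator (ball 0 r) w * (norm (weighted t f z) * gauss (4 * t) (0 - (z + w)))))"
          using coef_const_pos norm_coef_le
          by (simp add: y m_def norm_mult mult.assoc[symmetric] mult_right_mono split: split_indicator)
      qed
    qed
  qed
  moreover have "(LINT y|(lborel \<Otimes>\<^sub>M lborel). m y * fock_kernel t (snd y + fst y) x) = ball_op r f x" for x
  proof -
    define e where "e = complex_of_real (gauss (2 * t) x)"
    have e: "e \<noteq> 0" by (simp add: e_def)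
    have "m y * fock_kernel t (snd y + fst y) x = (1 / e) * (case y of (w, z) \<Rightarrow>
        indicator (ball 0 r) w *\<^sub>R (coef z (z + w) * (weighted t f z * kern t (z + w) x)))" for y
      using e by (cases y) (simp add: m_def weighted_def[of t "fock_kernel t _"] e_def[symmetric] scaleR_conv_of_real)
    then have "integrable (lborel \<Otimes>\<^sub>M lborel) (\<lambda>y. m y * fock_kernel t (snd y + fst y) x)"
      using integrable_mult_right[OF integrable_ball_kernel[OF f, of r x], of "1 / e"] by simp
    from lborel_pair.integral_fst'[OF this]
    show ?thesis by (simp add: m_def ball_op_def avg_op_def mult.assoc)
  qed
  ultimately show ?thesis by simp
qed

lemma norm_ball_integral_le:
  fixes h :: "complex^'n \<Rightarrow> complex"
  assumes h: "integrable lborel h" and B: "\<And>w. w \<in> ball 0 r \<Longrightarrow> norm (h w) \<le> B"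
    and z: "\<And>w. w \<notin> ball 0 r \<Longrightarrow> h w = 0"
  shows "norm (LINT w|lborel. h w) \<le> measure lborel (ball (0::complex^'n) r) * B"
proof -
  have "norm (LINT w|lborel. h w) \<le> (LINT w|lborel. norm (h w))" by (rule integral_norm_bound)
  also have "\<dots> \<le> (LINT w|lborel. indicator (ball (0::complex^'n) r) w * B)"
  proof (rule Bochner_Integration.integral_mono)
    show "integrable lborel (\<lambda>w. norm (h w))" using h by (rule integrable_norm)
    show "integrable lborel (\<lambda>w. indicat_real (ball (0::complex^'n) r) w * B)"
      using emeasure_bounded_finite[OF bounded_ball, of "0::complex^'n" r]
      by (intro integrable_mult_left integrable_real_indicator) auto
    show "norm (h w) \<le> indicator (ball 0 r) w * B" for w
      using B[of w] z[of w] by (auto split: split_indicator)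
  qed
  finally show ?thesis by simp
qed

lemma norm_ball_op_le:
  assumes f: "f \<in> fock_space t p"
  shows "norm (weighted t (ball_op r f) x) \<le> measure lborel (ball (0::complex^'n) r) * avg_const \<bar>r\<bar> * gauss_conv t f x"
proof -
  have "norm (weighted t (ball_op r f) x) \<le> measure lborel (ball (0::complex^'n) r) * (avg_const \<bar>r\<bar> * gauss_conv t f x)"
    unfolding weighted_ball_op(2)[OF f]
    by (rule norm_ball_integral_le[OF weighted_ball_op(1)[OF f]]) (auto intro!: norm_avg_op_le[OF f])
  then show ?thesis by (simp add: mult.assoc)
qed

lemma fock_bounded_ball_op: "bdd_op (ball_op r)"
  unfolding fock_bounded_op_def
proof (intro conjI ballI allI exI)
  fix f :: "'n cfun" assume f: "f \<in> fock_space t p"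
  \<comment> \<open>The summand 1 keeps the constant positive when the ball is empty;
    \<open>r\<close> is any real number here.\<close>
  define B where "B = measure lborel (ball (0::complex^'n) r) * avg_const \<bar>r\<bar> + 1"
  have B: "0 < B" using avg_const_pos[of "\<bar>r\<bar>"] by (simp add: B_def add_nonneg_pos)
  have "norm (weighted t (ball_op r f) x) \<le> B * gauss_conv t f x" for x
    using norm_ball_op_le[OF f, of r x] gauss_conv_nonneg[of t f x] by (simp add: B_def distrib_right)
  note * = fock_norm_gauss_conv[OF t p f entire_ball_op[OF f] B this]
  show "ball_op r f \<in> fock_space t p" by (rule *)
  show "fock_norm t p (ball_op r f) \<le> (measure lborel (ball (0::complex^'n) r) * avg_const \<bar>r\<bar> + 1) * (pi * (8 * t)) ^ CARD('n) * fock_norm t p f"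
    unfolding B_def[symmetric] by (rule *)
  show "ball_op r (\<lambda>z. c * f z) = (\<lambda>z. c * ball_op r f z)" for c
    unfolding ball_op_def avg_op_cmult mult_scaleR_right[symmetric] integral_mult_right_zero ..
  show "ball_op r (\<lambda>z. f z + g z) = (\<lambda>z. ball_op r f z + ball_op r g z)" if g: "g \<in> fock_space t p" for g
    using integrable_ball_avg_op[OF f] integrable_ball_avg_op[OF g]
    by (simp add: ball_op_def avg_op_add[OF f g] fun_eq_iff scaleR_add_right)
qed

lemma simple_op_outside: "(\<And>i. i < m \<Longrightarrow> w \<notin> E i) \<Longrightarrow> simple_op m E T w f x = 0"
  unfolding simple_op_def by (intro sum.neutral) auto

text \<open>Evaluation at one point turns simple operators into simple scalar functions. Both the
  existence and the uniqueness of the Bochner integral are reduced to this scalar integral.\<close>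

lemma ball_op_minus_simple_op_integral:
  fixes r :: real and x :: "complex^'n" and T :: "nat \<Rightarrow> 'n cop"
  assumes f: "f \<in> fock_space t p"
    and E: "\<And>i. i < m \<Longrightarrow> E i \<in> sets lborel" "\<And>i. i < m \<Longrightarrow> emeasure lborel (E i) < \<infinity>"
  defines "h \<equiv> \<lambda>w. indicator (ball 0 r) w *\<^sub>R weighted t (avg_op w f) x - weighted t (simple_op m E T w f) x"
  shows "integrable lborel h"
    and "(LINT w|lborel. h w) = weighted t (ball_op r f) x - weighted t (simple_op_integral m E T f) x"
proof -
  define v where "v w = (\<Sum>i<m. indicator (E i) w *\<^sub>R weighted t (T i f) x)" for w
  have v: "weighted t (simple_op m E T w f) x = v w" for w
    unfolding v_def simple_op_def weighted_def sum_distrib_left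
    by (intro sum.cong refl) (simp split: split_indicator)
  have iE: "integrable lborel (\<lambda>w. indicator (E i) w *\<^sub>R weighted t (T i f) x)" if "i < m" for i
    using E[OF that] by (intro integrable_indicator) auto
  have iv: "integrable lborel v" unfolding v_def by (intro Bochner_Integration.integrable_sum iE) simp
  have "(LINT w|lborel. v w) = (\<Sum>i<m. (LINT w|lborel. indicator (E i) w *\<^sub>R weighted t (T i f) x))"
    unfolding v_def by (intro Bochner_Integration.integral_sum iE) simp
  also have "\<dots> = (\<Sum>i<m. complex_of_real (measure lborel (E i)) * weighted t (T i f) x)"
    using E by (intro sum.cong) (auto simp: scaleR_conv_of_real)
  also have "\<dots> = weighted t (simple_op_integral m E T f) x"
    unfolding simple_op_integral_def weighted_def sum_distrib_left by (simp only: mult_ac)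
  finally have Iv: "(LINT w|lborel. v w) = weighted t (simple_op_integral m E T f) x" .
  show "integrable lborel h"
    unfolding h_def v by (intro Bochner_Integration.integrable_diff weighted_ball_op(1)[OF f] iv)
  show "(LINT w|lborel. h w) = weighted t (ball_op r f) x - weighted t (simple_op_integral m E T f) x"
    unfolding h_def v using weighted_ball_op(1)[OF f] iv by (simp add: Iv weighted_ball_op(2)[OF f])
qed

text \<open>Evaluation at \<open>x\<close> is bounded by the operator norm, so both limits in the
  definition pass to the values at \<open>x\<close> and leave no freedom for
  \<open>S f\<close>.\<close>

lemma has_op_bochner_integral_eval:
  assumes S: "has_op_bochner_integral t p (ball 0 r) (Kint) S"
    and f: "f \<in> fock_space t p"
  shows "S f = ball_op r f"
proof
  fix x
  obtain m E T where fin: "\<And>k i. i < m k \<Longrightarrow> E k i \<in> sets lborel \<and> E k i \<subseteq> ball 0 r \<and>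
        emeasure lborel (E k i) < \<infinity> \<and> bdd_op (T k i)"
    and meas: "\<And>k. (\<lambda>w. indicator (ball 0 r) w * opnorm (Kint w - simple_op (m k) (E k) (T k) w))
        \<in> borel_measurable lborel"
    and lim1: "(\<lambda>k. \<integral>\<^sup>+w. ennreal (indicator (ball 0 r) w *
        opnorm (Kint w - simple_op (m k) (E k) (T k) w)) \<partial>lborel) \<longlonglongrightarrow> 0"
    and lim2: "(\<lambda>k. opnorm (S - simple_op_integral (m k) (E k) (T k))) \<longlonglongrightarrow> 0"
    and Sb: "bdd_op S"
    using S unfolding has_op_bochner_integral_def by blast
  let ?s = "\<lambda>k. simple_op (m k) (E k) (T k)" and ?I = "\<lambda>k. simple_op_integral (m k) (E k) (T k)"
  let ?N = "\<lambda>k w. indicator (ball 0 r) w * opnorm (Kint w - ?s k w)"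
  define C where "C = fock_sup_const t p TYPE('n) * fock_norm t p f"
  have C: "0 \<le> C" unfolding C_def by (intro mult_nonneg_nonneg fock_sup_const_nonneg fock_norm_nonneg)
  have ev: "norm (weighted t (U f) x) \<le> C * opnorm U" if U: "bdd_op U" for U
  proof -
    have "norm (weighted t (U f) x) \<le> fock_sup_const t p TYPE('n) * fock_norm t p (U f)"
      by (rule norm_weighted_le_fock_norm[OF t p fock_bounded_opD(1)[OF U f]])
    also have "\<dots> \<le> fock_sup_const t p TYPE('n) * (opnorm U * fock_norm t p f)"
      by (intro mult_left_mono fock_norm_le_opnorm[OF p U f] fock_sup_const_nonneg)
    finally show ?thesis by (simp add: C_def mult_ac)
  qed
  define a where "a = norm (weighted t (S f) x - weighted t (ball_op r f) x)"
  define X where "X k = opnorm (S - ?I k)" for k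
  define Y where "Y k = (\<integral>\<^sup>+w. ennreal (?N k w) \<partial>lborel)" for k
  \<comment> \<open>The integral of the k-th simple operator is inserted: \<open>X k\<close>
    measures its distance to \<open>S\<close>, and \<open>Y k\<close> controls its distance to
    \<open>ball_op r\<close>.\<close>
  have bd: "ennreal a \<le> ennreal (C * X k) + ennreal C * Y k" for k
  proof -
    have Tk: "bdd_op (?s k w)" "bdd_op (?I k)" for w
      using fin[of _ k] by (auto intro!: fock_bounded_op_simple[OF t p])
    define h where "h w = indicator (ball 0 r) w *\<^sub>R weighted t (avg_op w f) x - weighted t (?s k w f) x" for w
    note H = ball_op_minus_simple_op_integral[OF f, where m = "m k" and E = "E k" and T = "T k" and r = r and x = x, folded h_def]
    have ih: "integrable lborel h" and Ih: "(LINT w|lborel. h w) = weighted t (ball_op r f) x - weighted t (?I k f) x"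
      using fin[of _ k] by (auto intro!: H)
    have hb: "norm (h w) \<le> C * (?N k w)" for w
    proof (cases "w \<in> ball 0 r")
      case True
      then have "h w = weighted t ((Kint w - ?s k w) f) x"
        by (simp add: h_def kernel_integral_eq[OF f] fun_diff_def weighted_diff)
      then show ?thesis
        using True ev[OF fock_bounded_op_diff[OF t p fock_bounded_kernel_integral Tk(1)], of w w] by simp
    next
      case False
      then have "w \<notin> E k i" if "i < m k" for i using fin[OF that] by blast
      then show ?thesis using False by (simp add: h_def simple_op_outside weighted_zero_iff)
    qed
    have "ennreal (norm (LINT w|lborel. h w)) \<le> (\<integral>\<^sup>+w. ennreal (norm (h w)) \<partial>lborel)"
      by (rule integral_norm_bound_ennreal[OF ih])
    also have "\<dots> \<le> (\<integral>\<^sup>+w. ennreal C * ennreal (?N k w) \<partial>lborel)"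
      using hb C by (intro nn_integral_mono)
        (simp add: ennreal_mult'[symmetric] ennreal_leI)
    also have "\<dots> = ennreal C * Y k" unfolding Y_def using meas by (intro nn_integral_cmult) simp
    finally have 1: "ennreal (norm (LINT w|lborel. h w)) \<le> ennreal C * Y k" .
    have "a \<le> norm (weighted t ((S - ?I k) f) x) + norm (LINT w|lborel. h w)"
      unfolding a_def Ih fun_diff_def weighted_diff
      using norm_triangle_ineq4[of "weighted t (S f) x - weighted t (?I k f) x"
          "weighted t (ball_op r f) x - weighted t (?I k f) x"] by simp
    also have "\<dots> \<le> C * X k + norm (LINT w|lborel. h w)"
      unfolding X_def by (intro add_right_mono ev fock_bounded_op_diff[OF t p Sb Tk(2)])
    finally have "ennreal a \<le> ennreal (C * X k + norm (LINT w|lborel. h w))" by (rule ennreal_leI)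
    also have "\<dots> = ennreal (C * X k) + ennreal (norm (LINT w|lborel. h w))"
      using C fock_opnorm_nonneg[OF p fock_bounded_op_diff[OF t p Sb Tk(2)]] unfolding X_def
      by (intro ennreal_plus) auto
    also have "\<dots> \<le> ennreal (C * X k) + ennreal C * Y k" by (intro add_left_mono 1)
    finally show ?thesis .
  qed
  have "(\<lambda>k. ennreal (C * X k) + ennreal C * Y k) \<longlonglongrightarrow> ennreal (C * 0) + ennreal C * 0"
    unfolding X_def Y_def
    by (intro tendsto_add tendsto_ennrealI tendsto_mult_left ennreal_tendsto_cmult lim1 lim2) auto
  then have "ennreal a \<le> ennreal (C * 0) + ennreal C * 0"
    by (rule LIMSEQ_le_const) (use bd in auto)
  then have "a = 0" by (simp add: a_def ennreal_eq_0_iff)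
  then show "S f x = ball_op r f x" by (simp add: a_def weighted_eq_iff)
qed


text \<open>Supplies the measurability demanded by the Bochner integral: on the piece with sample
  point \<open>c\<close>, the distance to the simple operator is this function.\<close>

lemma continuous_opnorm_kernel_integral:
  "continuous_on UNIV (\<lambda>w. opnorm (Kint w - Kint c))"
  unfolding continuous_on_eq_continuous_at[OF open_UNIV]
proof
  fix w0 :: "complex^'n"
  define R where "R = norm w0 + 1"
  define L where "L = avg_const R * (pi * (8 * t)) ^ CARD('n)"
  define \<phi> where "\<phi> w = opnorm (Kint w - Kint c)" for w
  note tri = fock_opnorm_triangle[OF t p fock_bounded_kernel_integral fock_bounded_kernel_integral fock_bounded_kernel_integral]
  have "((\<lambda>w. \<phi> w - \<phi> w0) \<longlongrightarrow> 0) (at w0)"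
  proof (rule Lim_null_comparison)
    have "\<forall>\<^sub>F w in at w0. dist w w0 < 1" by (rule tendstoD[OF tendsto_ident_at]) simp
    then show "\<forall>\<^sub>F w in at w0. norm (\<phi> w - \<phi> w0) \<le> L * norm (w - w0)"
    proof eventually_elim
      case (elim w)
      have w: "norm w \<le> R" "norm w0 \<le> R" using elim norm_triangle_sub[of w w0] by (auto simp: R_def dist_norm)
      from opnorm_kernel_integral_diff_le[OF w] opnorm_kernel_integral_diff_le[OF w(2,1)]
        tri[of w c w0] tri[of w0 c w]
      show ?case by (simp add: \<phi>_def L_def norm_minus_commute[of w0 w] abs_le_iff)
    qed
    show "((\<lambda>w. L * norm (w - w0)) \<longlongrightarrow> 0) (at w0)" by (rule tendsto_eq_intros | simp)+
  qed
  then show "isCont (\<lambda>w. opnorm (Kint w - Kint c)) w0"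
    unfolding \<phi>_def isCont_def by (rule LIM_zero_cancel)
qed

text \<open>The k-th simple operator is constant on the pieces of a partition of mesh
  \<open>1 / (k + 1)\<close>, with value \<open>Kint\<close> at the centre of the covering
  ball.\<close>

lemma has_op_bochner_integral_ball_op:
  "has_op_bochner_integral t p (ball 0 r) (Kint) (ball_op r)"
proof -
  define e where "e k = 1 / real (Suc k)" for k
  have e: "0 < e k" "e k \<le> 1" for k by (auto simp: e_def)
  define P where "P k m c E \<longleftrightarrow> (\<forall>i<m. E i \<in> sets borel \<and> E i \<subseteq> ball (0::complex^'n) r \<and> E i \<subseteq> ball (c i) (e k)) \<and>
    (\<forall>w\<in>ball 0 r. \<exists>!i. i < (m::nat) \<and> w \<in> E i)" for k m c E
  have "\<forall>k. \<exists>m c E. P k m c E" unfolding P_def by (intro allI ball_partition e)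
  then obtain m c E where P: "\<And>k. P k (m k) (c k) (E k)" by metis
  define T where "T k i = Kint (c k i)" for k i
  let ?s = "\<lambda>k. simple_op (m k) (E k) (T k)" and ?I = "\<lambda>k. simple_op_integral (m k) (E k) (T k)"
  let ?N = "\<lambda>k w. indicator (ball 0 r) w * opnorm (Kint w - ?s k w)"
  \<comment> \<open>A sample point may lie outside the ball, but if its piece is nonempty it is
    within \<open>e k \<le> 1\<close> of a point of the ball.\<close>
  define R where "R = \<bar>r\<bar> + 1"
  have R: "0 \<le> R" by (simp add: R_def)
  define L where "L = avg_const R * (pi * (8 * t)) ^ CARD('n)"
  have L: "0 < L" unfolding L_def using avg_const_pos[OF R] t by simp
  define V where "V = measure lborel (ball (0::complex^'n) r)"
  have Vf: "emeasure lborel (ball (0::complex^'n) r) = ennreal V"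
    using emeasure_bounded_finite[OF bounded_ball, of "0::complex^'n" r] unfolding V_def
    by (intro emeasure_eq_ennreal_measure) auto
  have V0: "0 \<le> V" by (simp add: V_def)
  have EB: "E k i \<in> sets borel" "E k i \<subseteq> ball 0 r" "E k i \<subseteq> ball (c k i) (e k)" if "i < m k" for k i
    using P[of k] that unfolding P_def by auto
  have nearR: "norm w \<le> R" if "w \<in> ball 0 r" for w :: "complex^'n" using that by (simp add: R_def)
  have simple: "\<exists>i<m k. norm (c k i) \<le> R \<and> norm (w - c k i) \<le> e k \<and>
      ?s k w = T k i \<and>
      (\<Sum>j<m k. indicator (E k j) w * opnorm (Kint w - T k j)) = opnorm (Kint w - T k i)"
    if w: "w \<in> ball 0 r" for k w
  proof -
    have ex1: "\<exists>!i. i < m k \<and> w \<in> E k i" using P[of k] w unfolding P_def by blast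
    then obtain i where i: "i < m k" "w \<in> E k i" by blast
    have ind: "w \<in> E k j \<longleftrightarrow> j = i" if "j < m k" for j using ex1 that i by blast
    have d: "dist (c k i) w < e k" using EB(3)[OF i(1)] i(2) by auto
    have "norm (c k i) \<le> norm w + dist (c k i) w"
      using norm_triangle_sub[of "c k i" w] by (simp add: dist_norm)
    then have near: "norm (c k i) \<le> R" using d e(2)[of k] w by (simp add: R_def)
    have close: "norm (w - c k i) \<le> e k" using d by (simp add: dist_norm norm_minus_commute)
    have pick: "(\<Sum>j<m k. indicator (E k j) w * g j) = g i" for g :: "nat \<Rightarrow> 'z::semiring_1"
    proof -
      have "(\<Sum>j<m k. indicator (E k j) w * g j) = (\<Sum>j<m k. if j = i then g j else 0)"
        by (intro sum.cong) (auto simp: ind indicator_def)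
      then show ?thesis using i(1) by simp
    qed
    have op: "?s k w = T k i"
      unfolding simple_op_def fun_eq_iff by (intro allI pick)
    show ?thesis by (intro exI[of _ i] conjI i(1) near close op pick)
  qed
  have Efin: "emeasure lborel (E k i) < \<infinity>" if "i < m k" for k i
    using emeasure_bounded_finite[OF bounded_subset[OF bounded_ball EB(2)[OF that]]] .
  \<comment> \<open>The operator norm of the difference is rewritten as a finite sum of indicators
    times continuous functions, from which measurability is evident.\<close>
  have dist_eq: "?N k w
      = (\<Sum>i<m k. indicator (E k i) w * opnorm (Kint w - T k i))" for k w
  proof (cases "w \<in> ball 0 r")
    case True
    then show ?thesis using simple[OF True, of k] by auto
  next
    case False
    then have "w \<notin> E k i" if "i < m k" for i using EB(2)[OF that] by blast
    then have "(\<Sum>i<m k. indicator (E k i) w * opnorm (Kint w - T k i)) = 0"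
      by (intro sum.neutral) auto
    then show ?thesis using False by simp
  qed
  have bound: "?N k w
      \<le> L * e k * indicator (ball 0 r) w" for k w
  proof (cases "w \<in> ball 0 r")
    case True
    obtain i where i: "i < m k" "norm (c k i) \<le> R" "norm (w - c k i) \<le> e k" "?s k w = T k i"
      using simple[OF True, of k] by blast
    have "opnorm (Kint w - T k i) \<le> L * norm (w - c k i)"
      unfolding T_def L_def by (rule opnorm_kernel_integral_diff_le[OF nearR[OF True] i(2)])
    also have "\<dots> \<le> L * e k" using L i(3) by (intro mult_left_mono) auto
    finally show ?thesis using True by (simp add: i(4))
  qed simp
  have elim: "e \<longlonglongrightarrow> 0" unfolding e_def by (rule LIMSEQ_Suc[OF lim_1_over_n])
  show ?thesis
    unfolding has_op_bochner_integral_def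
  proof (intro conjI exI allI impI ballI)
    show "ball 0 r \<in> sets (lborel :: (complex^'n) measure)" by simp
    show "bdd_op (Kint w)" for w by (rule fock_bounded_kernel_integral)
    show "bdd_op (ball_op r)" by (rule fock_bounded_ball_op)
    show "E k i \<in> sets lborel" "E k i \<subseteq> ball 0 r" "emeasure lborel (E k i) < \<infinity>" "bdd_op (T k i)" if "i < m k" for k i
      using EB[OF that] Efin[OF that] by (auto simp: T_def fock_bounded_kernel_integral)
    show "(\<lambda>w. ?N k w) \<in> borel_measurable lborel" for k
      unfolding dist_eq T_def using EB(1)
      by (intro borel_measurable_sum borel_measurable_times borel_measurable_indicator)
         (auto intro!: borel_measurable_continuous_onI continuous_opnorm_kernel_integral)
    show "(\<lambda>k. \<integral>\<^sup>+w. ennreal (?N k w) \<partial>lborel) \<longlonglongrightarrow> 0"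
    proof (rule tendsto_sandwich[OF _ _ tendsto_const])
      show "\<forall>\<^sub>F k in sequentially. (\<integral>\<^sup>+w. ennreal (?N k w) \<partial>lborel) \<le> ennreal (L * e k * V)"
      proof (intro always_eventually allI)
        fix k
        have "(\<integral>\<^sup>+w. ennreal (?N k w) \<partial>lborel)
          \<le> (\<integral>\<^sup>+w. ennreal (L * e k) * indicator (ball (0::complex^'n) r) w \<partial>lborel)"
        proof (intro nn_integral_mono)
          fix w
          show "ennreal (?N k w)
            \<le> ennreal (L * e k) * indicator (ball 0 r) w"
            using ennreal_leI[OF bound[of w k]] by (auto split: split_indicator)
        qed
        also have "\<dots> = ennreal (L * e k) * ennreal V" by (simp add: nn_integral_cmult_indicator Vf)
        also have "\<dots> = ennreal (L * e k * V)" using L e(1)[of k] V0 by (intro ennreal_mult[symmetric]) auto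
        finally show "(\<integral>\<^sup>+w. ennreal (?N k w) \<partial>lborel) \<le> ennreal (L * e k * V)" .
      qed
      have "(\<lambda>k. L * e k * V) \<longlonglongrightarrow> L * 0 * V" by (intro tendsto_intros elim)
      then show "(\<lambda>k. ennreal (L * e k * V)) \<longlonglongrightarrow> 0" by (metis ennreal_0 mult_zero_left mult_zero_right tendsto_ennrealI)
    qed simp
    \<comment> \<open>Here the error of the Riemann sum is bounded at each \<open>x\<close> by
      \<open>gauss_conv\<close>, and only then is the norm taken. This avoids a norm inequality for
      integrals of operators.\<close>
    show "(\<lambda>k. opnorm (ball_op r - ?I k)) \<longlonglongrightarrow> 0"
    proof (rule tendsto_sandwich[OF _ _ tendsto_const])
      have Tk: "bdd_op (?I k)" for k
        by (rule fock_bounded_op_simple[OF t p]) (simp add: T_def fock_bounded_kernel_integral)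
      show "\<forall>\<^sub>F k in sequentially. 0 \<le> opnorm (ball_op r - ?I k)"
        by (intro always_eventually allI fock_opnorm_nonneg[OF p] fock_bounded_op_diff[OF t p fock_bounded_ball_op Tk])
      show "\<forall>\<^sub>F k in sequentially. opnorm (ball_op r - ?I k) \<le> V * (L * e k)"
      proof (intro always_eventually allI fock_opnorm_le)
        fix k
        show "0 \<le> V * (L * e k)" using L V0 e(1)[of k] by simp
        fix f :: "'n cfun" assume f: "f \<in> fock_space t p"
        define B where "B = V * (avg_const R * e k)"
        have B: "0 \<le> B" using V0 avg_const_pos[OF R] e(1)[of k] by (simp add: B_def)
        have "fock_norm t p (\<lambda>x. ball_op r f x - ?I k f x) \<le> B * (pi * (8 * t)) ^ CARD('n) * fock_norm t p f"
        proof (rule fock_norm_gauss_conv_le[OF t p f _ B])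
          show "entire_cn (\<lambda>x. ball_op r f x - ?I k f x)"
            using fock_space_entire[OF fock_space_diff[OF t p fock_bounded_opD(1)[OF fock_bounded_ball_op f] fock_bounded_opD(1)[OF Tk f]]] .
          fix x
          define h where "h w = indicator (ball 0 r) w *\<^sub>R weighted t (avg_op w f) x - weighted t (?s k w f) x" for w
          note H = ball_op_minus_simple_op_integral[OF f, where m = "m k" and E = "E k" and T = "T k" and r = r and x = x, folded h_def]
          have ih: "integrable lborel h" and Ih: "(LINT w|lborel. h w) = weighted t (ball_op r f) x - weighted t (?I k f) x"
            using EB(1)[of _ k] Efin[of _ k] by (auto intro!: H)
          have "norm (LINT w|lborel. h w) \<le> measure lborel (ball (0::complex^'n) r) * (avg_const R * e k * gauss_conv t f x)"
          proof (rule norm_ball_integral_le[OF ih])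
            fix w :: "complex^'n" assume w: "w \<in> ball 0 r"
            obtain i where i: "i < m k" "norm (c k i) \<le> R" "norm (w - c k i) \<le> e k" "?s k w = T k i"
              using simple[OF w, of k] by blast
            have "norm (h w) \<le> avg_const R * norm (w - c k i) * gauss_conv t f x"
              using norm_avg_op_diff_le[OF f nearR[OF w] i(2)] w by (simp add: h_def i(4) T_def kernel_integral_eq[OF f])
            also have "\<dots> \<le> avg_const R * e k * gauss_conv t f x"
              using avg_const_pos[OF R] by (intro mult_right_mono mult_left_mono i gauss_conv_nonneg) auto
            finally show "norm (h w) \<le> avg_const R * e k * gauss_conv t f x" .
          next
            fix w :: "complex^'n" assume w: "w \<notin> ball 0 r"
            then have "w \<notin> E k i" if "i < m k" for i using EB(2)[OF that] by blast
            then show "h w = 0" using w by (simp add: h_def simple_op_outside weighted_zero_iff)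
          qed
          then show "norm (weighted t (\<lambda>x. ball_op r f x - ?I k f x) x) \<le> B * gauss_conv t f x"
            unfolding weighted_diff Ih B_def V_def by (simp only: mult.assoc)
        qed
        then show "fock_norm t p ((ball_op r - ?I k) f) \<le> V * (L * e k) * fock_norm t p f"
          by (simp add: fun_diff_def B_def L_def mult_ac)
      qed
      have "(\<lambda>k. V * (L * e k)) \<longlonglongrightarrow> V * (L * 0)" by (intro tendsto_intros elim)
      then show "(\<lambda>k. V * (L * e k)) \<longlonglongrightarrow> 0" by simp
    qed
  qed
qed

lemma has_op_bochner_integral_kernel_integral:
  "has_op_bochner_integral t p (ball 0 r) (Kint) (op_bochner_integral t p (ball 0 r) (Kint))"
  unfolding op_bochner_integral_def
  by (rule someI[of "has_op_bochner_integral t p (ball 0 r) (Kint)"]) (rule has_op_bochner_integral_ball_op)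

lemma op_bochner_integral_eq:
  "f \<in> fock_space t p \<Longrightarrow> op_bochner_integral t p (ball 0 r) (Kint) f = ball_op r f"
  by (rule has_op_bochner_integral_eval[OF has_op_bochner_integral_kernel_integral])


section \<open>Weakly localized operators\<close>

text \<open>The integrand is that of the duality pairing; Young's inequality dominates it by the sum
  of the two powers.\<close>

lemma integrable_mult_conj:
  fixes f g :: "complex^'n \<Rightarrow> complex"
  assumes f: "f \<in> fock_space t p" and g: "g \<in> fock_space t (conj_exponent p)"
  shows "integrable lborel (\<lambda>z. weighted t f z * cnj (weighted t g z))"
proof (rule Bochner_Integration.integrable_bound)
  have q: "1 < conj_exponent p" using p by (simp add: conj_exponent_def)
  note [measurable] = measurable_weighted[OF fock_space_measurable[OF f], of t]
    measurable_weighted[OF fock_space_measurable[OF g], of t]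
  show "integrable lborel (\<lambda>z. norm (weighted t f z) powr p + norm (weighted t g z) powr conj_exponent p)"
    using f g t p q by (simp add: fock_space_iff)
  show "(\<lambda>z. weighted t f z * cnj (weighted t g z)) \<in> borel_measurable lborel" by measurable
  show "AE z in lborel. norm (weighted t f z * cnj (weighted t g z))
      \<le> norm (norm (weighted t f z) powr p + norm (weighted t g z) powr conj_exponent p)"
    using mult_le_powr_conj[OF p] by (intro AE_I2) (simp add: norm_mult)
qed

text \<open>Applying the reproducing formula to \<open>f\<close>, through the adjoint \<open>S\<close>, and then to each
  \<open>A k\<^sub>z\<close> writes \<open>A\<close> as a double integral; restricting it to \<open>|u - z| < r\<close> gives \<open>ball_op r\<close>.\<close>

lemma weighted_A_minus_ball_op:
  fixes r :: real and f :: "'n cfun"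
  assumes S: "is_fock_adjoint t p A S" and f: "f \<in> fock_space t p"
  defines "c \<equiv> complex_of_real (1 / (pi * t) ^ CARD('n))"
  defines "D \<equiv> \<lambda>z x. LINT u|lborel. indicator (- ball z r) u *\<^sub>R (coef z u * kern t u x)"
  shows "weighted t (A f) x - c * c * weighted t (ball_op r f) x = c * c * (LINT z|lborel. weighted t f z * D z x)"
    and "integrable lborel (\<lambda>z. weighted t f z * D z x)"
    and "ennreal (norm (D z x)) \<le> (\<integral>\<^sup>+u. indicator (- ball z r) u * (ennreal (norm (coef z u)) * ennreal (gauss (2 * t) (x - u))) \<partial>lborel)"
proof -
  define q where "q = conj_exponent p"
  have q: "1 < q" using p by (simp add: q_def conj_exponent_def)
  have c0: "c \<noteq> 0" using t by (simp add: c_def)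
  have kq: "fock_kernel t x \<in> fock_space t q" for x :: "complex^'n" by (rule fock_kernel_in_fock_space[OF t q])
  have Sk: "S (fock_kernel t x) \<in> fock_space t q" for x
    using S kq[of x] by (auto simp: is_fock_adjoint_def q_def fock_bounded_op_def)
  have adj: "fock_pairing t (A f) (fock_kernel t x) = fock_pairing t f (S (fock_kernel t x))"
    if "f \<in> fock_space t p" for f x
    using S that kq[of x] by (auto simp: is_fock_adjoint_def q_def)
  \<comment> \<open>The adjoint makes the coefficient, as a function of its first argument, a
    conjugated member of the dual Fock space.\<close>
  have wS: "cnj (weighted t (S (fock_kernel t x)) z) = coef z x" for x z
  proof -
    have "cnj (weighted t (S (fock_kernel t x)) z) = fock_pairing t (fock_kernel t z) (S (fock_kernel t x))"
      by (simp add: fock_reproducing(2)[OF t q Sk])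
    also have "\<dots> = fock_pairing t (A (fock_kernel t z)) (fock_kernel t x)"
      by (rule adj[symmetric]) (rule fock_kernel_in_fock_space[OF t p])
    finally show ?thesis by (simp add: coef_def fock_reproducing(1)[OF t p A_kernel])
  qed
  have iA: "integrable lborel (\<lambda>z. weighted t f z * coef z x)"
    using integrable_mult_conj[OF f Sk[unfolded q_def], of x] by (simp add: wS)
  have Af: "weighted t (A f) x = c * (LINT z|lborel. weighted t f z * coef z x)"
  proof -
    have "weighted t (A f) x = fock_pairing t f (S (fock_kernel t x))"
      by (simp add: fock_reproducing(1)[OF t p fock_bounded_opD(1)[OF A f]] flip: adj[OF f])
    also have "\<dots> = c * (LINT z|lborel. weighted t f z * cnj (weighted t (S (fock_kernel t x)) z))"
      unfolding c_def by (intro fock_pairing_eq t fock_space_measurable[OF f] fock_space_measurable[OF Sk])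
    finally show ?thesis by (simp only: wS)
  qed
  define h where "h z u = coef z u * kern t u x" for z u
  have ih: "integrable lborel (h z)" for z
  proof (rule Bochner_Integration.integrable_bound)
    show "integrable lborel (\<lambda>u. norm (weighted t (A (fock_kernel t z)) u) * gauss (2 * t) (x - u))"
      using t by (intro integrable_weighted_gauss[OF t p _ A_kernel]) simp
    show "h z \<in> borel_measurable lborel" unfolding h_def by measurable
    show "AE u in lborel. norm (h z u) \<le> norm (norm (weighted t (A (fock_kernel t z)) u) * gauss (2 * t) (x - u))"
      by (intro AE_I2) (simp add: h_def norm_mult norm_weighted_fock_kernel[OF t] coef_def)
  qed
  have ih': "integrable lborel (\<lambda>u. indicator X u *\<^sub>R h z u)" if "X \<in> sets borel" for X z
    using ih[of z] that by (intro integrable_mult_indicator) auto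
  have coef_rep: "coef z x = c * (LINT u|lborel. h z u)" for z
    unfolding h_def c_def coef_def by (rule weighted_reproducing[OF t p A_kernel])
  have D: "D z x = (LINT u|lborel. indicator (- ball z r) u *\<^sub>R h z u)" for z
    by (simp add: D_def h_def)
  have split: "(LINT u|lborel. h z u) = (LINT u|lborel. indicator (ball z r) u *\<^sub>R h z u) + D z x" for z
  proof -
    have "h z u = indicator (ball z r) u *\<^sub>R h z u + indicator (- ball z r) u *\<^sub>R h z u" for u
      by (simp split: split_indicator)
    then have "(LINT u|lborel. h z u) = (LINT u|lborel. indicator (ball z r) u *\<^sub>R h z u + indicator (- ball z r) u *\<^sub>R h z u)"
      by simp
    also have "\<dots> = (LINT u|lborel. indicator (ball z r) u *\<^sub>R h z u) + D z x"
      unfolding D by (intro Bochner_Integration.integral_add ih') auto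
    finally show ?thesis .
  qed
  \<comment> \<open>The substitution \<open>u = z + w\<close> carries the ball around 0 to the ball
    around \<open>z\<close>.\<close>
  have trans: "(LINT w|lborel. indicator (ball 0 r) w *\<^sub>R (coef z (z + w) * (weighted t f z * kern t (z + w) x)))
      = weighted t f z * (LINT u|lborel. indicator (ball z r) u *\<^sub>R h z u)" for z
  proof -
    have "(\<lambda>u. indicator (ball z r) u *\<^sub>R h z u) \<in> borel_measurable borel"
      using borel_measurable_integrable[OF ih'[of "ball z r" z]] by simp
    from lborel_translate(1)[OF this, of z]
    have "(LINT u|lborel. indicator (ball z r) u *\<^sub>R h z u) = (LINT w|lborel. indicator (ball z r) (z + w) *\<^sub>R h z (z + w))"
      by simp
    also have "(\<lambda>w. indicator (ball z r) (z + w) *\<^sub>R h z (z + w)) = (\<lambda>w. indicator (ball 0 r) w *\<^sub>R h z (z + w))"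
      by (auto simp: indicator_def dist_norm)
    finally have "weighted t f z * (LINT u|lborel. indicator (ball z r) u *\<^sub>R h z u)
        = (LINT w|lborel. weighted t f z * (indicator (ball 0 r) w *\<^sub>R h z (z + w)))"
      by (simp only: integral_mult_right_zero)
    then show ?thesis by (simp add: h_def mult_ac)
  qed
  note i2 = weighted_ball_op(4)[OF f, of r x, unfolded trans]
  \<comment> \<open>The part outside the ball is the whole minus the part inside. This yields its
    integrability from the two known pieces.\<close>
  have wD: "weighted t f z * D z x = (1 / c) * (weighted t f z * coef z x) - weighted t f z * (LINT u|lborel. indicator (ball z r) u *\<^sub>R h z u)" for z
    using c0 unfolding coef_rep split by (simp add: algebra_simps)
  show iD: "integrable lborel (\<lambda>z. weighted t f z * D z x)"
    unfolding wD by (intro Bochner_Integration.integrable_diff integrable_mult_right iA i2)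
  have "(LINT z|lborel. weighted t f z * D z x) = (1 / c) * (LINT z|lborel. weighted t f z * coef z x) - weighted t (ball_op r f) x"
    unfolding wD weighted_ball_op(3)[OF f] trans
    by (subst Bochner_Integration.integral_diff) (use iA i2 in \<open>auto intro!: integrable_mult_right\<close>)
  then show "weighted t (A f) x - c * c * weighted t (ball_op r f) x = c * c * (LINT z|lborel. weighted t f z * D z x)"
    using c0 unfolding Af by (simp add: right_diff_distrib)
  have "ennreal (norm (D z x)) \<le> (\<integral>\<^sup>+u. ennreal (norm (indicator (- ball z r) u *\<^sub>R h z u)) \<partial>lborel)"
    unfolding D by (rule integral_norm_bound_ennreal[OF ih']) auto
  also have "\<dots> = (\<integral>\<^sup>+u. indicator (- ball z r) u * (ennreal (norm (coef z u)) * ennreal (gauss (2 * t) (x - u))) \<partial>lborel)"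
    by (intro nn_integral_cong) (simp add: h_def norm_mult norm_weighted_fock_kernel[OF t] ennreal_mult split: split_indicator)
  finally show "ennreal (norm (D z x)) \<le> (\<integral>\<^sup>+u. indicator (- ball z r) u * (ennreal (norm (coef z u)) * ennreal (gauss (2 * t) (x - u))) \<partial>lborel)" .
qed

text \<open>The difference is dominated by the composition of the truncated coefficients with the
  Gaussian \<open>gauss (2 * t)\<close>. Schur's test for the composition multiplies the tail bound
  \<open>\<eta>\<close> by the mass of the Gaussian and by the squared normalization of the
  reproducing formula.\<close>

lemma opnorm_ball_op_minus_A_le:
  assumes S: "is_fock_adjoint t p A S" and \<eta>: "0 < \<eta>"
    and tail1: "\<And>z. (\<integral>\<^sup>+u. ennreal (norm (coef z u)) * indicator (- ball z r) u \<partial>lborel) \<le> ennreal \<eta>"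
    and tail2: "\<And>u. (\<integral>\<^sup>+z. ennreal (norm (coef z u)) * indicator (- ball u r) z \<partial>lborel) \<le> ennreal \<eta>"
  shows "opnorm ((\<lambda>f x. complex_of_real (1 / (pi * t) ^ (2 * CARD('n))) * ball_op r f x) - A)
    \<le> (1 / (pi * t) ^ (2 * CARD('n))) * (pi * (2 * t)) ^ CARD('n) * \<eta>"
proof (rule fock_opnorm_le)
  define d where "d = 1 / (pi * t) ^ (2 * CARD('n))"
  define g where "g = (pi * (2 * t)) ^ CARD('n)"
  have d: "0 < d" and g: "0 < g" using t by (auto simp: d_def g_def)
  show "0 \<le> (1 / (pi * t) ^ (2 * CARD('n))) * (pi * (2 * t)) ^ CARD('n) * \<eta>"
    using d g \<eta> unfolding d_def[symmetric] g_def[symmetric] by simp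
  define c where "c = complex_of_real (1 / (pi * t) ^ CARD('n))"
  have cc: "c * c = complex_of_real d"
    by (simp add: c_def d_def power_add[symmetric] mult_2 flip: of_real_mult)
  \<comment> \<open>The truncation depends only on the distance, so the same function is the tail in
    \<open>u\<close> around \<open>z\<close> and the tail in \<open>z\<close> around
    \<open>u\<close>.\<close>
  define b where "b z u = (if dist z u < r then 0 else ennreal (norm (coef z u)))" for z u
  define E where "E x u = ennreal (gauss (2 * t) (x - u))" for x u :: "complex^'n"
  define K where "K = (\<lambda>(x, z). ennreal d * (\<integral>\<^sup>+u. b z u * E x u \<partial>lborel))"
  have b[measurable]: "(\<lambda>y. b (\<alpha> y) (\<beta> y)) \<in> borel_measurable M"
    if [measurable]: "\<alpha> \<in> borel_measurable M" "\<beta> \<in> borel_measurable M" for M and \<alpha> \<beta> :: "'z \<Rightarrow> complex^'n"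
    unfolding b_def by measurable
  have E[measurable]: "(\<lambda>y. E (\<alpha> y) (\<beta> y)) \<in> borel_measurable M"
    if [measurable]: "\<alpha> \<in> borel_measurable M" "\<beta> \<in> borel_measurable M" for M and \<alpha> \<beta> :: "'z \<Rightarrow> complex^'n"
    unfolding E_def by measurable
  have b1: "(\<integral>\<^sup>+u. b z u \<partial>lborel) \<le> ennreal \<eta>" for z
    using tail1[of z] by (rule order_trans[rotated]) (intro nn_integral_mono, auto simp: b_def split: split_indicator)
  have b2: "(\<integral>\<^sup>+z. b z u \<partial>lborel) \<le> ennreal \<eta>" for u
    using tail2[of u] by (rule order_trans[rotated]) (intro nn_integral_mono, auto simp: b_def dist_commute split: split_indicator)
  have E1: "(\<integral>\<^sup>+x. E x u \<partial>lborel) = ennreal g" for u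
    using t nn_integral_gauss_translate(2)[of "2 * t" u] by (simp add: E_def g_def)
  have E2: "(\<integral>\<^sup>+u. E x u \<partial>lborel) = ennreal g" for x
    using t nn_integral_gauss_translate(1)[of "2 * t" x] by (simp add: E_def g_def)
  have K: "K \<in> borel_measurable (lborel \<Otimes>\<^sub>M lborel)"
    unfolding K_def by measurable
  have C: "0 < d * g * \<eta>" using d g \<eta> by simp
  have Cm: "ennreal d * (ennreal g * ennreal \<eta>) = ennreal (d * g * \<eta>)"
    using d g \<eta> by (simp add: ennreal_mult mult.assoc)
  \<comment> \<open>Integration over \<open>z\<close> meets the coefficients with \<open>u\<close>
    fixed, so this direction consumes \<open>tail2\<close>; the other one consumes
    \<open>tail1\<close>.\<close>
  have K1: "(\<integral>\<^sup>+z. K (x, z) \<partial>lborel) \<le> ennreal (d * g * \<eta>)" for x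
  proof -
    have Kd: "(\<integral>\<^sup>+z. K (x, z) \<partial>lborel) = ennreal d * (\<integral>\<^sup>+z. (\<integral>\<^sup>+u. b z u * E x u \<partial>lborel) \<partial>lborel)"
      unfolding K_def prod.case by (intro nn_integral_cmult) measurable
    have "(\<integral>\<^sup>+z. (\<integral>\<^sup>+u. b z u * E x u \<partial>lborel) \<partial>lborel) = (\<integral>\<^sup>+u. (\<integral>\<^sup>+z. b z u * E x u \<partial>lborel) \<partial>lborel)"
      by (rule lborel_pair.Fubini'[symmetric]) measurable
    also have "\<dots> = (\<integral>\<^sup>+u. (\<integral>\<^sup>+z. b z u \<partial>lborel) * E x u \<partial>lborel)"
      by (intro nn_integral_cong nn_integral_multc) measurable
    also have "\<dots> \<le> (\<integral>\<^sup>+u. ennreal \<eta> * E x u \<partial>lborel)"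
      by (intro nn_integral_mono mult_right_mono b2) auto
    also have "\<dots> = ennreal \<eta> * ennreal g"
      by (subst nn_integral_cmult) (auto simp: E2)
    finally have "(\<integral>\<^sup>+z. (\<integral>\<^sup>+u. b z u * E x u \<partial>lborel) \<partial>lborel) \<le> ennreal g * ennreal \<eta>"
      by (simp only: mult.commute)
    then show ?thesis unfolding Cm[symmetric] Kd by (intro mult_left_mono) auto
  qed
  have K2: "(\<integral>\<^sup>+x. K (x, z) \<partial>lborel) \<le> ennreal (d * g * \<eta>)" for z
  proof -
    have Kd: "(\<integral>\<^sup>+x. K (x, z) \<partial>lborel) = ennreal d * (\<integral>\<^sup>+x. (\<integral>\<^sup>+u. b z u * E x u \<partial>lborel) \<partial>lborel)"
      unfolding K_def prod.case by (intro nn_integral_cmult) measurable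
    have "(\<integral>\<^sup>+x. (\<integral>\<^sup>+u. b z u * E x u \<partial>lborel) \<partial>lborel) = (\<integral>\<^sup>+u. (\<integral>\<^sup>+x. b z u * E x u \<partial>lborel) \<partial>lborel)"
      by (rule lborel_pair.Fubini'[symmetric]) measurable
    also have "\<dots> = (\<integral>\<^sup>+u. b z u * ennreal g \<partial>lborel)"
      by (intro nn_integral_cong) (simp add: nn_integral_cmult E1)
    also have "\<dots> = (\<integral>\<^sup>+u. b z u \<partial>lborel) * ennreal g"
      by (intro nn_integral_multc) measurable
    also have "\<dots> \<le> ennreal \<eta> * ennreal g" by (intro mult_right_mono b1) auto
    finally have "(\<integral>\<^sup>+x. (\<integral>\<^sup>+u. b z u * E x u \<partial>lborel) \<partial>lborel) \<le> ennreal g * ennreal \<eta>"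
      by (simp only: mult.commute)
    then show ?thesis unfolding Cm[symmetric] Kd by (intro mult_left_mono) auto
  qed
  fix f :: "'n cfun" assume f: "f \<in> fock_space t p"
  note [measurable] = measurable_weighted[OF fock_space_measurable[OF f], of t]
  define T where "T x = complex_of_real d * ball_op r f x - A f x" for x
  have T: "T \<in> fock_space t p"
    unfolding T_def by (intro fock_space_diff t p fock_space_cmult fock_bounded_opD(1)[OF fock_bounded_ball_op f] fock_bounded_opD(1)[OF A f])
  have le: "ennreal (norm (weighted t T x)) \<le> (\<integral>\<^sup>+z. K (x, z) * ennreal (norm (weighted t f z)) \<partial>lborel)" for x
  proof -
    define D where "D z x = (LINT u|lborel. indicator (- ball z r) u *\<^sub>R (coef z u * kern t u x))" for z x
    note W = weighted_A_minus_ball_op[OF S f, where x = x and r = r, folded D_def, folded c_def]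
    have Db: "ennreal (norm (D z x)) \<le> (\<integral>\<^sup>+u. b z u * E x u \<partial>lborel)" for z
      using W(3)[of z] by (rule order_trans)
        (intro nn_integral_mono, auto simp: b_def E_def split: split_indicator)
    have "weighted t T x = c * c * weighted t (ball_op r f) x - weighted t (A f) x"
      unfolding T_def cc weighted_diff weighted_cmult ..
    then have "norm (weighted t T x) = norm (weighted t (A f) x - c * c * weighted t (ball_op r f) x)"
      by (simp only: norm_minus_commute)
    also have "\<dots> = d * norm (LINT z|lborel. weighted t f z * D z x)"
      unfolding W(1) norm_mult[of "c * c"] unfolding cc using d by simp
    finally have "ennreal (norm (weighted t T x)) = ennreal d * ennreal (norm (LINT z|lborel. weighted t f z * D z x))"
      using d by (simp add: ennreal_mult)
    also have "\<dots> \<le> ennreal d * (\<integral>\<^sup>+z. ennreal (norm (weighted t f z * D z x)) \<partial>lborel)"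
      by (intro mult_left_mono integral_norm_bound_ennreal W(2)) auto
    also have "\<dots> \<le> ennreal d * (\<integral>\<^sup>+z. ennreal (norm (weighted t f z)) * (\<integral>\<^sup>+u. b z u * E x u \<partial>lborel) \<partial>lborel)"
      by (intro mult_left_mono nn_integral_mono) (auto simp: norm_mult ennreal_mult intro!: mult_left_mono Db)
    also have "\<dots> = (\<integral>\<^sup>+z. ennreal d * (ennreal (norm (weighted t f z)) * (\<integral>\<^sup>+u. b z u * E x u \<partial>lborel)) \<partial>lborel)"
      by (intro nn_integral_cmult[symmetric]) measurable
    also have "\<dots> = (\<integral>\<^sup>+z. K (x, z) * ennreal (norm (weighted t f z)) \<partial>lborel)"
      by (intro nn_integral_cong) (simp add: K_def mult_ac)
    finally show ?thesis .
  qed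
  have "fock_norm t p T \<le> d * g * \<eta> * fock_norm t p f"
    by (rule fock_norm_schur(2)[OF t p f fock_space_entire[OF T] K C K1 K2 le])
  then show "fock_norm t p (((\<lambda>f x. complex_of_real (1 / (pi * t) ^ (2 * CARD('n))) * ball_op r f x) - A) f)
      \<le> (1 / (pi * t) ^ (2 * CARD('n))) * (pi * (2 * t)) ^ CARD('n) * \<eta> * fock_norm t p f"
    by (simp add: T_def[abs_def] fun_diff_def d_def g_def)
qed

text \<open>Once \<open>r\<close> is large, both suprema of tails are below a given
  \<open>\<eta>\<close>, and the norm estimate is linear in \<open>\<eta>\<close>.\<close>

lemma weakly_localized_limit:
  assumes loc: "weakly_localized t p A"
  shows "((\<lambda>r. opnorm ((\<lambda>f x. complex_of_real (1 / (pi * t) ^ (2 * CARD('n))) *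
      op_bochner_integral t p (ball 0 r) (Kint) f x) - A)) \<longlongrightarrow> 0) at_top"
proof -
  obtain S where S: "is_fock_adjoint t p A S" and lim: "\<And>U. U \<in> {A, S} \<Longrightarrow> ((\<lambda>r::real. SUP z. \<integral>\<^sup>+ w.
      ennreal (norm (fock_pairing t (U (fock_kernel t z)) (fock_kernel t w))) * indicator (- ball z r) w \<partial>lborel) \<longlongrightarrow> 0) at_top"
    using loc unfolding weakly_localized_def by blast
  define q where "q = conj_exponent p"
  have q: "1 < q" using p by (simp add: q_def conj_exponent_def)
  have cA: "norm (fock_pairing t (A (fock_kernel t z)) (fock_kernel t w)) = norm (coef z w)" for z w
    by (simp add: coef_def fock_reproducing(1)[OF t p A_kernel])
  \<comment> \<open>The coefficients of the adjoint are those of \<open>A\<close> with the arguments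
    exchanged, up to conjugation. Its tails are therefore the tails of \<open>coef\<close> in the
    first argument.\<close>
  have cS: "norm (fock_pairing t (S (fock_kernel t z)) (fock_kernel t w)) = norm (coef w z)" for z w
  proof -
    have "fock_pairing t (fock_kernel t w) (S (fock_kernel t z)) = fock_pairing t (A (fock_kernel t w)) (fock_kernel t z)"
      using S fock_kernel_in_fock_space[OF t p, of w] fock_kernel_in_fock_space[OF t q, of z]
      by (auto simp: is_fock_adjoint_def q_def)
    moreover have "norm (fock_pairing t (S (fock_kernel t z)) (fock_kernel t w)) = norm (fock_pairing t (fock_kernel t w) (S (fock_kernel t z)))"
      by (subst fock_pairing_cnj[symmetric]) (rule complex_mod_cnj)
    ultimately show ?thesis by (simp add: cA)
  qed
  define C where "C = (1 / (pi * t) ^ (2 * CARD('n))) * (pi * (2 * t)) ^ CARD('n)"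
  have C: "0 < C" using t by (simp add: C_def)
  define N where "N r = opnorm ((\<lambda>f x. complex_of_real (1 / (pi * t) ^ (2 * CARD('n))) * ball_op r f x) - A)" for r
  have N0: "0 \<le> N r" for r
    unfolding N_def
    using fock_bounded_op_add_cmult[OF t p fock_bounded_op_zero fock_bounded_ball_op, of "complex_of_real (1 / (pi * t) ^ (2 * CARD('n)))" r]
    by (intro fock_opnorm_nonneg[OF p] fock_bounded_op_diff[OF t p _ A]) simp
  have "(N \<longlongrightarrow> 0) at_top"
  proof (rule tendstoI)
    fix \<epsilon> :: real assume \<epsilon>: "0 < \<epsilon>"
    define \<eta> where "\<eta> = \<epsilon> / (2 * C)"
    have \<eta>: "0 < \<eta>" using \<epsilon> C by (simp add: \<eta>_def)
    have \<eta>': "(0::ennreal) < ennreal \<eta>" using \<eta> by simp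
    have "\<forall>\<^sub>F r in at_top. (SUP z. \<integral>\<^sup>+ w. ennreal (norm (coef z w)) * indicator (- ball z r) w \<partial>lborel) < ennreal \<eta>"
      using order_tendstoD(2)[OF lim[of A] \<eta>'] by (simp add: cA)
    moreover have "\<forall>\<^sub>F r in at_top. (SUP z. \<integral>\<^sup>+ w. ennreal (norm (coef w z)) * indicator (- ball z r) w \<partial>lborel) < ennreal \<eta>"
      using order_tendstoD(2)[OF lim[of S] \<eta>'] by (simp add: cS)
    ultimately show "\<forall>\<^sub>F r in at_top. dist (N r) 0 < \<epsilon>"
    proof eventually_elim
      case (elim r)
      have "N r \<le> C * \<eta>"
        unfolding N_def C_def
      proof (rule opnorm_ball_op_minus_A_le[OF S \<eta>])
        show "(\<integral>\<^sup>+u. ennreal (norm (coef z u)) * indicator (- ball z r) u \<partial>lborel) \<le> ennreal \<eta>" for z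
          by (rule order_trans[OF SUP_upper[OF UNIV_I] less_imp_le[OF elim(1)]])
        show "(\<integral>\<^sup>+z. ennreal (norm (coef z u)) * indicator (- ball u r) z \<partial>lborel) \<le> ennreal \<eta>" for u
          by (rule order_trans[OF SUP_upper[OF UNIV_I] less_imp_le[OF elim(2)]])
      qed
      also have "\<dots> < \<epsilon>" using C \<epsilon> by (simp add: \<eta>_def)
      finally show ?case using N0[of r] by simp
    qed
  qed
  \<comment> \<open>The chosen Bochner integral agrees with \<open>ball_op r\<close> on the carrier,
    which is all that the operator norm sees.\<close>
  moreover have "N = (\<lambda>r. opnorm ((\<lambda>f x. complex_of_real (1 / (pi * t) ^ (2 * CARD('n))) *
      op_bochner_integral t p (ball 0 r) (Kint) f x) - A))"
    unfolding N_def by (intro ext fock_opnorm_cong) (simp add: fun_diff_def op_bochner_integral_eq)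
  ultimately show ?thesis by (simp only:)
qed

text \<open>With the Lipschitz constant \<open>L\<close> of the ball, \<open>\<epsilon> / L\<close>
  is a suitable distance.\<close>

lemma uniformly_continuous_weyl_integral:
  assumes \<epsilon>: "0 < \<epsilon>" and r: "0 < r"
  shows "\<exists>\<delta>>0. \<forall>w\<in>ball 0 r. \<forall>w'\<in>ball 0 r. dist w w' < \<delta> \<longrightarrow>
    opnorm (weyl_integral t p A w - weyl_integral t p A w') < \<epsilon>"
proof -
  define L where "L = avg_const r * (pi * (8 * t)) ^ CARD('n)"
  have L: "0 < L" unfolding L_def using avg_const_pos[of r] r t by simp
  have "opnorm (weyl_integral t p A w - weyl_integral t p A w') < \<epsilon>"
    if w: "w \<in> ball 0 r" "w' \<in> ball 0 r" "dist w w' < \<epsilon> / L" for w w'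
  proof -
    have "opnorm (weyl_integral t p A w - weyl_integral t p A w') \<le> L * norm (w - w')"
      unfolding weyl_integral_eq L_def by (rule opnorm_kernel_integral_diff_le) (use w in auto)
    also have "\<dots> < \<epsilon>" using w(3) L by (simp add: dist_norm field_simps)
    finally show ?thesis .
  qed
  then show ?thesis using L \<epsilon> by (intro exI[of _ "\<epsilon> / L"]) auto
qed

end

theorem theorem2p5:
  fixes t p :: real
    and A :: "(complex^'n::finite \<Rightarrow> complex) \<Rightarrow> (complex^'n \<Rightarrow> complex)"
  assumes t: "t > 0" and p: "1 < p" and A: "fock_bounded_op t p A"
  shows "(\<forall>r>0.
            (\<forall>w\<in>ball 0 r.
               has_op_integral t p (weyl_coeff t A w)
                 (\<lambda>z. weyl t z (fock_kernel t w)) (\<lambda>z. weyl t z (fock_kernel t 0))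
                 (weyl_integral t p A w) \<and>
               has_op_integral t p (kernel_coeff t A w)
                 (\<lambda>z. fock_kernel t (z + w)) (\<lambda>z. fock_kernel t z)
                 (kernel_integral t p A w) \<and>
               (\<forall>f\<in>fock_space t p. weyl_integral t p A w f = kernel_integral t p A w f)) \<and>
            (\<forall>\<epsilon>>0. \<exists>\<delta>>0. \<forall>w\<in>ball 0 r. \<forall>w'\<in>ball 0 r. dist w w' < \<delta> \<longrightarrow>
               fock_opnorm t p (weyl_integral t p A w - weyl_integral t p A w') < \<epsilon>) \<and>
            (\<exists>C. \<forall>w\<in>ball 0 r. fock_opnorm t p (weyl_integral t p A w) \<le> C) \<and>
            has_op_bochner_integral t p (ball 0 r) (kernel_integral t p A)
              (op_bochner_integral t p (ball 0 r) (kernel_integral t p A))) \<and>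
         (weakly_localized t p A \<longrightarrow>
            ((\<lambda>r. fock_opnorm t p
                ((\<lambda>f x. complex_of_real (1 / (pi * t) ^ (2 * CARD('n))) *
                    op_bochner_integral t p (ball 0 r) (kernel_integral t p A) f x) - A))
              \<longlongrightarrow> 0) at_top)"
proof -
  interpret bounded_fock_operator t p A by unfold_locales (rule t p A)+
  show ?thesis
  proof (intro conjI allI impI ballI)
    fix r :: real assume r: "0 < r"
    show "\<exists>C. \<forall>w\<in>ball 0 r. fock_opnorm t p (weyl_integral t p A w) \<le> C"
      unfolding weyl_integral_eq
      by (intro exI[of _ "avg_const r * (pi * (8 * t)) ^ CARD('n)"] ballI opnorm_kernel_integral_le) simp
    show "\<exists>\<delta>>0. \<forall>w\<in>ball 0 r. \<forall>w'\<in>ball 0 r. dist w w' < \<delta> \<longrightarrow>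
        fock_opnorm t p (weyl_integral t p A w - weyl_integral t p A w') < \<epsilon>" if "0 < \<epsilon>" for \<epsilon>
      by (rule uniformly_continuous_weyl_integral[OF that r])
  next
    fix w
    show "has_op_integral t p (weyl_coeff t A w) (\<lambda>z. weyl t z (fock_kernel t w)) (\<lambda>z. weyl t z (fock_kernel t 0)) (weyl_integral t p A w)"
      unfolding has_op_integral_weyl_iff weyl_integral_eq by (rule has_op_integral_kernel_integral)
  qed (rule has_op_integral_kernel_integral has_op_bochner_integral_kernel_integral weakly_localized_limit
      | simp add: weyl_integral_eq)+
qed

end
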